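(* For any input displacement sequence $D$ of length $n$, the Basic Type Reconstruction Problem (find a basic tree $T$ representing $D$ such that $\mathrm{cost}(T)\le \mathrm{cost}(T')$ for every basic tree $T'$ representing $D$) can be solved by an algorithm running in $O(n^4)$ time and using $O(n^2)$ space.
   Context: A displacement sequence of length $n$ is a sequence $D=\langle d_0,\dots,d_{n-1}\rangle$ of integers (entries may repeat), $D[i]=d_i$. A basic tree is a rooted ordered tree whose nodes are of four kinds: a leaf $\mathsf{con}(c)$ with count $c\ge 1$; a node $\mathsf{vec}(c,d,C)$ with count $c$, integer stride $d$ and one child $C$; a node $\mathsf{idx}(c,\langle i_0,\dots,i_{c-1}\rangle,C)$ with count $c$, integer indices and one child $C$; a node $\mathsf{strc}(c,\langle i_0,\dots,i_{c-1}\rangle,\langle C_0,\dots,C_{c-1}\rangle)$ with count $c$, integer indices and $c$ children. For a sequence $S$ and integer $x$ let $S+x$ add $x$ to every entry. The sequence $\mathrm{Flat}(T)$ represented by a basic tree is defined recursively: $\mathrm{Flat}(\mathsf{con}(c))=\langle 0,1,\dots,c-1\rangle$; $\mathrm{Flat}(\mathsf{vec}(c,d,C))$ is the concatenation of $\mathrm{Flat}(C)+kd$ for $k=0,\dots,c-1$; $\mathrm{Flat}(\mathsf{idx}(c,\langle i_k\rangle,C))$ is the concatenation of $\mathrm{Flat}(C)+i_k$ for $k=0,\dots,c-1$; $\mathrm{Flat}(\mathsf{strc}(c,\langle i_k\rangle,\langle C_k\rangle))$ is the concatenation of $\mathrm{Flat}(C_k)+i_k$ for $k=0,\dots,c-1$.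 $T$ represents $D$ if $\mathrm{Flat}(T)=D$. Node costs, with fixed positive constants $K_{\mathsf{con}},K_{\mathsf{vec}},K_{\mathsf{idx}},K_{\mathsf{strc}},K_{\mathrm{lookup}}$: $\mathrm{cost}(\mathsf{con}(c))=K_{\mathsf{con}}$, $\mathrm{cost}(\mathsf{vec}(c,d,C))=K_{\mathsf{vec}}$, $\mathrm{cost}(\mathsf{idx}(c,\dots))=K_{\mathsf{idx}}+cK_{\mathrm{lookup}}$, $\mathrm{cost}(\mathsf{strc}(c,\dots))=K_{\mathsf{strc}}+2cK_{\mathrm{lookup}}$; the cost of a tree is the sum of the costs of its nodes. All numbers are assumed to be representable in a constant number of machine words (constant-cost arithmetic). *)

theory Defs
  imports Complex_Main "HOL-Library.Landau_Symbols"
begin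

section \<open>Basic trees and the sequences they represent\<close>

datatype btree =
    Con nat
  | Vec nat int btree
  | Idx nat "int list" btree
  | Strc nat "int list" "btree list"

text \<open>Only leaf counts are required to be positive.\<close>

fun basic_tree :: "btree \<Rightarrow> bool" where
  "basic_tree (Con c) \<longleftrightarrow> c \<ge> 1"
| "basic_tree (Vec c d C) \<longleftrightarrow> basic_tree C"
| "basic_tree (Idx c xs C) \<longleftrightarrow> length xs = c \<and> basic_tree C"
| "basic_tree (Strc c xs Cs) \<longleftrightarrow>
     length xs = c \<and> length Cs = c \<and> (\<forall>C\<in>set Cs. basic_tree C)"

definition shift :: "int list \<Rightarrow> int \<Rightarrow> int list" where
  "shift S x = map (\<lambda>y. y + x) S"

primrec flat :: "btree \<Rightarrow> int list" where
  "flat (Con c) = map int [0..<c]"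
| "flat (Vec c d C) = concat (map (\<lambda>k. shift (flat C) (int k * d)) [0..<c])"
| "flat (Idx c xs C) = concat (map (\<lambda>k. shift (flat C) (xs ! k)) [0..<c])"
| "flat (Strc c xs Cs) = concat (map (\<lambda>k. shift (map flat Cs ! k) (xs ! k)) [0..<c])"

definition represents :: "btree \<Rightarrow> int list \<Rightarrow> bool" where
  "represents T D \<longleftrightarrow> basic_tree T \<and> flat T = D"

record cost_consts =
  Kcon :: real
  Kvec :: real
  Kidx :: real
  Kstrc :: real
  Klookup :: real

primrec cost :: "cost_consts \<Rightarrow> btree \<Rightarrow> real" where
  "cost K (Con c) = Kcon K"
| "cost K (Vec c d C) = Kvec K + cost K C"
| "cost K (Idx c xs C) = Kidx K + real c * Klookup K + cost K C"
| "cost K (Strc c xs Cs) =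
     Kstrc K + 2 * real c * Klookup K + sum_list (map (cost K) Cs)"

definition optimal_tree :: "cost_consts \<Rightarrow> int list \<Rightarrow> btree \<Rightarrow> bool" where
  "optimal_tree K D T \<longleftrightarrow>
     represents T D \<and> (\<forall>T'. represents T' D \<longrightarrow> cost K T \<le> cost K T')"


section \<open>A unit-cost random access machine\<close>

text \<open>
  Algorithms are structured programs for a random access machine with finitely many
  registers (those named in the program text) and an addressable memory. There are two banks
  of registers and of memory: one holds integers, the other holds costs. The cost constants
  are arbitrary positive reals, so costs are kept apart from integers: they can only be moved,
  added and compared, and never converted to integers. Every cost occurring in a computation
  is therefore a sum of cost constants, and no other information can be packed into it.
\<close>

type_synonym reg = nat

record state =
  ireg :: "reg \<Rightarrow> int"
  creg :: "reg \<Rightarrow> real"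
  imem :: "nat \<Rightarrow> int"
  cmem :: "nat \<Rightarrow> real"

datatype instr =
    IConst reg int
  | IAdd reg reg reg
  | ISub reg reg reg
  | IMul reg reg reg
  | IDiv reg reg reg
  | IMod reg reg reg
  | ILoad reg reg
  | IStore reg reg
  | CAdd reg reg reg
  | CLoad reg reg
  | CStore reg reg

text \<open>
  The first argument is the target, except that in a store the first register holds the
  address and the second one the value. In all loads and stores the address is held in an
  integer register.
\<close>

fun effect :: "instr \<Rightarrow> state \<Rightarrow> state" where
  "effect (IConst r z) s = s\<lparr>ireg := (ireg s)(r := z)\<rparr>"
| "effect (IAdd r a b) s = s\<lparr>ireg := (ireg s)(r := ireg s a + ireg s b)\<rparr>"
| "effect (ISub r a b) s = s\<lparr>ireg := (ireg s)(r := ireg s a - ireg s b)\<rparr>"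
| "effect (IMul r a b) s = s\<lparr>ireg := (ireg s)(r := ireg s a * ireg s b)\<rparr>"
| "effect (IDiv r a b) s = s\<lparr>ireg := (ireg s)(r := ireg s a div ireg s b)\<rparr>"
| "effect (IMod r a b) s = s\<lparr>ireg := (ireg s)(r := ireg s a mod ireg s b)\<rparr>"
| "effect (ILoad r a) s = s\<lparr>ireg := (ireg s)(r := imem s (nat (ireg s a)))\<rparr>"
| "effect (IStore a b) s = s\<lparr>imem := (imem s)(nat (ireg s a) := ireg s b)\<rparr>"
| "effect (CAdd r a b) s = s\<lparr>creg := (creg s)(r := creg s a + creg s b)\<rparr>"
| "effect (CLoad r a) s = s\<lparr>creg := (creg s)(r := cmem s (nat (ireg s a)))\<rparr>"
| "effect (CStore a b) s = s\<lparr>cmem := (cmem s)(nat (ireg s a) := creg s b)\<rparr>"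

fun accessed :: "instr \<Rightarrow> state \<Rightarrow> int set" where
  "accessed (ILoad r a) s = {ireg s a}"
| "accessed (IStore a b) s = {ireg s a}"
| "accessed (CLoad r a) s = {ireg s a}"
| "accessed (CStore a b) s = {ireg s a}"
| "accessed _ s = {}"

definition fits :: "nat \<Rightarrow> state \<Rightarrow> bool" where
  "fits W s \<longleftrightarrow>
     (\<forall>r. \<bar>ireg s r\<bar> \<le> int W) \<and> (\<forall>a. \<bar>imem s a\<bar> \<le> int W) \<and>
     (\<forall>r. \<bar>creg s r\<bar> \<le> real W) \<and> (\<forall>a. \<bar>cmem s a\<bar> \<le> real W)"

datatype test =
    ILess reg reg
  | IEq reg reg
  | CLess reg reg

fun holds :: "test \<Rightarrow> state \<Rightarrow> bool" where
  "holds (ILess a b) s \<longleftrightarrow> ireg s a < ireg s b"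
| "holds (IEq a b) s \<longleftrightarrow> ireg s a = ireg s b"
| "holds (CLess a b) s \<longleftrightarrow> creg s a < creg s b"

datatype prog =
    Skip
  | Do instr
  | Seq prog prog
  | If test prog prog
  | While test prog

text \<open>
  \<open>exec S W P s t s'\<close>: started in \<open>s\<close>, the program \<open>P\<close> terminates in \<open>s'\<close> after \<open>t\<close> steps, on a
  machine whose memory banks have \<open>S\<close> cells each and whose numbers are bounded in absolute value
  by \<open>W\<close>. An access outside the memory or an overflow has no transition, so such a
  computation does not terminate.
\<close>

inductive exec :: "nat \<Rightarrow> nat \<Rightarrow> prog \<Rightarrow> state \<Rightarrow> nat \<Rightarrow> state \<Rightarrow> bool"
  for S W :: nat where
  Skip: "exec S W Skip s 1 s"
| Do: "accessed i s \<subseteq> {0..<int S} \<Longrightarrow> fits W (effect i s) \<Longrightarrow>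
    exec S W (Do i) s 1 (effect i s)"
| Seq: "exec S W P s t s' \<Longrightarrow> exec S W Q s' u s'' \<Longrightarrow> exec S W (Seq P Q) s (t + u) s''"
| IfTrue: "holds b s \<Longrightarrow> exec S W P s t s' \<Longrightarrow> exec S W (If b P Q) s (1 + t) s'"
| IfFalse: "\<not> holds b s \<Longrightarrow> exec S W Q s t s' \<Longrightarrow> exec S W (If b P Q) s (1 + t) s'"
| WhileFalse: "\<not> holds b s \<Longrightarrow> exec S W (While b P) s 1 s"
| WhileTrue: "holds b s \<Longrightarrow> exec S W P s t s' \<Longrightarrow> exec S W (While b P) s' u s'' \<Longrightarrow>
    exec S W (While b P) s (1 + t + u) s''"


section \<open>Input and output of a reconstruction algorithm\<close>

text \<open>
  Integer register 0 holds the length of the displacement sequence, integer memory starts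
  with its entries, and the cost registers 0 to 4 hold the cost constants.
\<close>

definition init_state :: "cost_consts \<Rightarrow> int list \<Rightarrow> state" where
  "init_state K D = \<lparr>
     ireg = (\<lambda>_. 0)(0 := int (length D)),
     creg = (\<lambda>_. 0)(0 := Kcon K, 1 := Kvec K, 2 := Kidx K, 3 := Kstrc K, 4 := Klookup K),
     imem = (\<lambda>a. if a < length D then D ! a else 0),
     cmem = (\<lambda>_. 0)\<rparr>"

text \<open>Trees are output explicitly, without sharing of subtrees, in preorder.\<close>

primrec encode :: "btree \<Rightarrow> int list" where
  "encode (Con c) = [0, int c]"
| "encode (Vec c d C) = [1, int c, d] @ encode C"
| "encode (Idx c xs C) = [2, int c] @ xs @ encode C"
| "encode (Strc c xs Cs) = [3, int c] @ xs @ concat (map encode Cs)"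

text \<open>The output starts at the address in integer register 0, inside the \<open>S\<close> cells available.\<close>

definition outputs :: "nat \<Rightarrow> state \<Rightarrow> btree \<Rightarrow> bool" where
  "outputs S s T \<longleftrightarrow>
     (\<exists>a. ireg s 0 = int a \<and> a + length (encode T) \<le> S \<and>
        (\<forall>j<length (encode T). imem s (a + j) = encode T ! j))"

text \<open>
  A bound on the numbers of an instance. That every number fits into a constant number of
  machine words means that the numbers are bounded by a fixed power of this bound.
\<close>

definition magnitude :: "int list \<Rightarrow> nat" where
  "magnitude D = 2 + length D + nat (Max (insert 0 (abs ` set D)))"

definition solves_reconstruction ::
  "cost_consts \<Rightarrow> prog \<Rightarrow> (nat \<Rightarrow> nat) \<Rightarrow> (nat \<Rightarrow> nat) \<Rightarrow> bool" where
  "solves_reconstruction K P time space \<longleftrightarrow>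
     (\<exists>w. \<forall>D. \<exists>t s T.
        exec (space (length D)) (magnitude D ^ w) P (init_state K D) t s \<and>
        t \<le> time (length D) \<and>
        outputs (space (length D)) s T \<and>
        optimal_tree K D T)"

end

theory Submission
  imports Defs
begin

text \<open>
  An interval dynamic program. A segment of \<open>D\<close> is represented up to translation, because the
  indices of an \<open>Idx\<close> or \<open>Strc\<close> node can absorb any translation of its children; translation
  matters only along the chain of \<open>Vec\<close> nodes below the root, which must start at 0 if the chain
  ends in a leaf. So a segment needs two optima, one for its translate that starts at 0 and one for
  all its other translates. The root of an optimal tree is a leaf, a \<open>Vec\<close> or \<open>Idx\<close> node over a
  prefix whose length divides that of the segment, or a \<open>Strc\<close> node over an optimal partition.
  There are quadratically many segments, at most linearly many divisors for each, and each divisor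
  is tested in linear time; a partition is optimised over the length of its first piece. The choices
  are recorded, and the tree is written out in preorder with a stack. Its cost is linear in the
  length of \<open>D\<close> and every node costs at least a fixed positive amount per word of its encoding, so
  the output is of linear size as well.
\<close>

section \<open>The dynamic program and its correctness\<close>

text \<open>The two optima are not symmetric: the one for the translate that starts at 0 bounds the
  cost of every translate from below. Only a leaf forces a translation. A \<open>Vec\<close> node
  hands its own to its child, since its first copy is shifted by 0. Two circularities have to be
  broken: a partition may consist of the segment alone, and an \<open>Idx\<close> node may have
  count 1. For the translate that starts at 0 such a root only adds cost, so the optima of a segment
  can be computed in the order \<open>V 0\<close>, \<open>V 2\<close>, \<open>V 1\<close>. Inner
  nodes may have count 0. Hence a child may represent the empty sequence, which the lower bound for
  partitions has to allow for, and the empty input has several candidate trees; the cheapest depends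
  on the constants and is built into the program. Costs can only be added and compared. Multiples of
  \<open>Kl\<close> are therefore accumulated along the loops, and in place of an infinite start
  value every minimum starts from an attainable cost or another valid upper bound.\<close>

lemma length_shift [simp]: "length (shift L x) = length L"
  and nth_shift [simp]: "j < length L \<Longrightarrow> shift L x ! j = L ! j + x"
  and shift_Nil [simp]: "shift [] x = []"
  by (auto simp: shift_def)

lemma length_concat_shift:
  "length (concat (map (\<lambda>k. shift L (g k)) [0..<c])) = c * length L"
  by (induction c) auto

lemma nth_concat_shift:
  assumes "j < c * length L"
  shows "concat (map (\<lambda>k. shift L (g k)) [0..<c]) ! j = L ! (j mod length L) + g (j div length L)"
  using assms
proof (induction c)
  case (Suc c)
  show ?case
  proof (cases "j < c * length L")
    case True
    then show ?thesis using Suc.IH by (simp add: nth_append length_concat_shift)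
  next
    case False
    define j' where "j' = j - c * length L"
    have j: "j = j' + c * length L" "j' < length L" using False Suc.prems by (auto simp: j'_def)
    moreover have "length L \<noteq> 0" using j(2) by auto
    ultimately have "j mod length L = j'" "j div length L = c" by simp_all
    then show ?thesis using j by (simp add: nth_append length_concat_shift)
  qed
qed simp

lemma flat_Strc:
  assumes "length xs = c" "length Cs = c"
  shows "flat (Strc c xs Cs) = concat (map (\<lambda>(C, x). shift (flat C) x) (zip Cs xs))"
proof -
  have "map (\<lambda>k. shift (map flat Cs ! k) (xs ! k)) [0..<c] = map (\<lambda>(C, x). shift (flat C) x) (zip Cs xs)"
    using assms by (intro nth_equalityI) auto
  then show ?thesis by simp
qed

section \<open>Minimisation with recorded choices, and the recurrences\<close>

definition improve :: "bool \<Rightarrow> real \<Rightarrow> nat \<Rightarrow> real \<times> nat \<Rightarrow> real \<times> nat" where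
  "improve b v c x = (if b \<and> v < fst x then (v, c) else x)"

lemma improve_le: "fst (improve b v c x) \<le> fst x"
  and improve_le_new: "b \<Longrightarrow> fst (improve b v c x) \<le> v"
  and improve_cases: "improve b v c x = x \<or> b \<and> improve b v c x = (v, c)"
  and improve_ge: "u \<le> fst x \<Longrightarrow> u \<le> v \<Longrightarrow> u \<le> fst (improve b v c x)"
  by (auto simp: improve_def)

locale reconstruction =
  fixes K :: cost_consts and D :: "int list"
  assumes pos: "Kcon K > 0" "Kvec K > 0" "Kidx K > 0" "Kstrc K > 0" "Klookup K > 0"
begin

abbreviation "Kl \<equiv> Klookup K"

definition consec :: "nat \<Rightarrow> nat \<Rightarrow> bool" where
  "consec i l \<longleftrightarrow> (\<forall>k<l. D ! (i + k) - D ! i = int k)"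

text \<open>\<open>k - k mod m\<close> is the start of the block of length \<open>m\<close> that
  contains \<open>k\<close>; each block is compared with the first one up to translation.\<close>

definition idxc :: "nat \<Rightarrow> nat \<Rightarrow> nat \<Rightarrow> bool" where
  "idxc i l m \<longleftrightarrow> (\<forall>k<l. D ! (i + k) - D ! (i + (k - k mod m)) = D ! (i + k mod m) - D ! i)"

text \<open>The only possible stride is read off the segment itself, as the distance between the
  starts of the first two blocks.\<close>

definition vecc :: "nat \<Rightarrow> nat \<Rightarrow> nat \<Rightarrow> bool" where
  "vecc i l m \<longleftrightarrow> (\<forall>k<l. D ! (i + k) - D ! (i + k mod m) = int (k div m) * (D ! (i + m) - D ! i))"

primrec ploop :: "(nat \<Rightarrow> nat \<Rightarrow> nat \<Rightarrow> real) \<Rightarrow> nat \<Rightarrow> nat \<Rightarrow> real \<times> nat \<Rightarrow> nat \<Rightarrow> real \<times> nat" where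
  "ploop V i l x 0 = x"
| "ploop V i l x (Suc j) =
     improve True (V 0 i (j + 1) + 2 * Kl + V 2 (i + (j + 1)) (l - (j + 1))) (j + 1) (ploop V i l x j)"

text \<open>Counts start at 2. A \<open>Vec\<close> root with count 1 never helps, and an
  \<open>Idx\<close> root with count 1 is the start value of \<open>cell1\<close>. The child of
  \<open>Vec\<close> inherits \<open>q\<close>, the child of \<open>Idx\<close> is free and uses
  \<open>V 0\<close>.\<close>

primrec cloop :: "(nat \<Rightarrow> nat \<Rightarrow> nat \<Rightarrow> real) \<Rightarrow> nat \<Rightarrow> nat \<Rightarrow> nat \<Rightarrow> real \<times> nat \<Rightarrow> nat \<Rightarrow> real \<times> nat" where
  "cloop V q i l x 0 = x"
| "cloop V q i l x (Suc j) =
     improve (l mod (j + 2) = 0 \<and> vecc i l (l div (j + 2))) (Kvec K + V q i (l div (j + 2))) (2 * (j + 2))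
      (improve (l mod (j + 2) = 0 \<and> idxc i l (l div (j + 2)))
        (Kidx K + real (j + 2) * Kl + V 0 i (l div (j + 2))) (2 * (j + 2) + 1)
        (cloop V q i l x j))"

text \<open>A start value available for every segment: if no leaf fits, \<open>Idx\<close> over
  \<open>Con 1\<close> lists all entries, and \<open>2 * l + 1\<close> is the code of an
  \<open>Idx\<close> with count \<open>l\<close>.\<close>

definition first :: "nat \<Rightarrow> nat \<Rightarrow> real \<times> nat" where
  "first i l = (if consec i l then (Kcon K, 0) else (Kidx K + real l * Kl + Kcon K, 2 * l + 1))"

text \<open>
  The optimum of the segment itself is not yet known when its partitions are examined. Its initial
  upper bound stands in for it, and \<open>cell2\<close> below corrects the entry.
\<close>

definition split0 :: "(nat \<Rightarrow> nat \<Rightarrow> nat \<Rightarrow> real) \<Rightarrow> nat \<Rightarrow> nat \<Rightarrow> real \<times> nat" where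
  "split0 V i l = ploop V i l (fst (first i l) + 2 * Kl, l) (l - 1)"

definition cell0 :: "(nat \<Rightarrow> nat \<Rightarrow> nat \<Rightarrow> real) \<Rightarrow> nat \<Rightarrow> nat \<Rightarrow> real \<times> nat" where
  "cell0 V i l = cloop V 0 i l (improve True (Kstrc K + fst (split0 V i l)) 1 (first i l)) (l - 1)"

definition cell2 :: "(nat \<Rightarrow> nat \<Rightarrow> nat \<Rightarrow> real) \<Rightarrow> nat \<Rightarrow> nat \<Rightarrow> real \<times> nat" where
  "cell2 V i l = (if fst (split0 V i l) < fst (cell0 V i l) + 2 * Kl then split0 V i l
     else (fst (cell0 V i l) + 2 * Kl, l))"

text \<open>The start value is the \<open>Idx\<close> node with count 1, code 3, over the translate
  that starts at 0. Partitions come from \<open>cell2\<close>, so a \<open>Strc\<close> with a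
  single piece is included; for this \<open>q\<close> it can be the cheapest root.\<close>

definition cell1 :: "(nat \<Rightarrow> nat \<Rightarrow> nat \<Rightarrow> real) \<Rightarrow> nat \<Rightarrow> nat \<Rightarrow> real \<times> nat" where
  "cell1 V i l = cloop V 1 i l
     (improve True (Kstrc K + fst (cell2 V i l)) 1 (Kidx K + Kl + fst (cell0 V i l), 3)) (l - 1)"

definition cell :: "(nat \<Rightarrow> nat \<Rightarrow> nat \<Rightarrow> real) \<Rightarrow> nat \<Rightarrow> nat \<Rightarrow> nat \<Rightarrow> real \<times> nat" where
  "cell V q i l = (if q = 0 then cell0 V i l else if q = 1 then cell1 V i l else cell2 V i l)"

primrec tab :: "nat \<Rightarrow> nat \<Rightarrow> nat \<Rightarrow> nat \<Rightarrow> real \<times> nat" where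
  "tab 0 = (\<lambda>q i l. (0, 0))"
| "tab (Suc L) = (\<lambda>q i l. if l = Suc L then cell (\<lambda>q i l. fst (tab L q i l)) q i l else tab L q i l)"

text \<open>
  \<open>V 0 i l\<close> and \<open>V 1 i l\<close> are the two optima of the segment of length \<open>l\<close> at position \<open>i\<close>, the first
  for the translate that starts at 0; \<open>V 2 i l\<close> is the optimum over the partitions of the segment,
  where each piece is charged \<open>2 * Kl\<close> for its lookups. \<open>C\<close> records the choices: for \<open>q < 2\<close> the root is
  a leaf (0), \<open>Strc\<close> (1), \<open>Vec c\<close> (\<open>2 * c\<close>) or \<open>Idx c\<close> (\<open>2 * c + 1\<close>), and for \<open>q = 2\<close> the number is the
  length of the first piece.
\<close>

definition V :: "nat \<Rightarrow> nat \<Rightarrow> nat \<Rightarrow> real" where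
  "V q i l = fst (tab l q i l)"

definition C :: "nat \<Rightarrow> nat \<Rightarrow> nat \<Rightarrow> nat" where
  "C q i l = snd (tab l q i l)"

section \<open>The recurrences as equations for \<open>V\<close> and \<open>C\<close>\<close>

lemma tab_stable: "l \<le> L \<Longrightarrow> tab L q i l = tab l q i l"
  by (induction L) (auto simp: le_Suc_eq)

lemma ploop_cong:
  assumes "\<And>q i l'. l' < l \<Longrightarrow> V1 q i l' = V2 q i l'" "j \<le> l - 1"
  shows "ploop V1 i l x j = ploop V2 i l x j"
  using assms(2) by (induction j) (auto simp: assms(1))

lemma cloop_cong:
  assumes "\<And>q i l'. l' < l \<Longrightarrow> V1 q i l' = V2 q i l'" "l > 0"
  shows "cloop V1 q i l x j = cloop V2 q i l x j"
proof -
  have "l div Suc (Suc j) < l" for j using assms(2) by (intro div_less_dividend) auto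
  then show ?thesis by (induction j) (auto simp: assms(1))
qed

text \<open>Pieces and blocks are proper, so a cell looks up strictly shorter segments only. This
  allows the table at each stage to be replaced by \<open>V\<close>, which gives the fixed-point
  equation \<open>tab_eq\<close>.\<close>

lemma cell_cong:
  assumes "\<And>q i l'. l' < l \<Longrightarrow> V1 q i l' = V2 q i l'" "l > 0"
  shows "cell V1 q i l = cell V2 q i l"
proof -
  have s: "split0 V1 i l = split0 V2 i l"
    unfolding split0_def by (intro ploop_cong assms) auto
  have c0: "cell0 V1 i l = cell0 V2 i l"
    unfolding cell0_def s by (intro cloop_cong assms)
  have c2: "cell2 V1 i l = cell2 V2 i l"
    unfolding cell2_def s c0 ..
  have "cell1 V1 i l = cell1 V2 i l"
    unfolding cell1_def c0 c2 by (intro cloop_cong assms)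
  then show ?thesis by (simp add: cell_def c0 c2)
qed

lemma tab_eq:
  assumes "l > 0"
  shows "tab l q i l = cell V q i l"
proof (cases l)
  case (Suc L)
  have "tab l q i l = cell (\<lambda>q i l. fst (tab L q i l)) q i l" using Suc by simp
  also have "\<dots> = cell V q i l"
    by (rule cell_cong) (use Suc in \<open>auto simp: V_def intro!: arg_cong[of _ _ fst] tab_stable\<close>)
  finally show ?thesis .
qed (use assms in simp)

lemma V_C_eq: "l > 0 \<Longrightarrow> (V q i l, C q i l) = cell V q i l"
  by (simp add: V_def C_def flip: tab_eq)

lemma V_eq: "l > 0 \<Longrightarrow> V q i l = fst (cell V q i l)"
  using V_C_eq[of l q i] by (metis fst_conv)

section \<open>The minimising loops: bounds and attained candidates\<close>

lemma ploop_le: "fst (ploop U i l x j) \<le> fst x"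
  by (induction j) (auto intro: order_trans[OF improve_le])

lemma ploop_le_new:
  "m < j \<Longrightarrow> fst (ploop U i l x j) \<le> U 0 i (m + 1) + 2 * Kl + U 2 (i + (m + 1)) (l - (m + 1))"
proof (induction j)
  case (Suc j)
  then show ?case
    by (cases "m = j") (auto intro: order_trans[OF improve_le] order_trans[OF improve_le_new])
qed simp

lemma ploop_cases:
  "ploop U i l x j = x \<or>
   (\<exists>m<j. ploop U i l x j = (U 0 i (m + 1) + 2 * Kl + U 2 (i + (m + 1)) (l - (m + 1)), m + 1))"
proof (induction j)
  case (Suc j)
  show ?case
    using improve_cases[of True "U 0 i (j + 1) + 2 * Kl + U 2 (i + (j + 1)) (l - (j + 1))" "j + 1" "ploop U i l x j"]
      Suc by (metis less_Suc_eq ploop.simps(2))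
qed simp

lemma cloop_le: "fst (cloop U q i l x j) \<le> fst x"
  by (induction j) (auto intro: order_trans[OF improve_le] order_trans[OF improve_le[THEN order_trans[OF improve_le]]])

lemma cloop_le_vec:
  "2 \<le> c \<Longrightarrow> c < j + 2 \<Longrightarrow> l mod c = 0 \<Longrightarrow> vecc i l (l div c) \<Longrightarrow>
   fst (cloop U q i l x j) \<le> Kvec K + U q i (l div c)"
proof (induction j)
  case (Suc j)
  show ?case
  proof (cases "c = j + 2")
    case True
    then show ?thesis using Suc.prems by (auto intro: improve_le_new)
  next
    case False
    then show ?thesis using Suc
      by (auto intro: order_trans[OF improve_le[THEN order_trans[OF improve_le]]])
  qed
qed simp

lemma cloop_le_idx:
  "2 \<le> c \<Longrightarrow> c < j + 2 \<Longrightarrow> l mod c = 0 \<Longrightarrow> idxc i l (l div c) \<Longrightarrow>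
   fst (cloop U q i l x j) \<le> Kidx K + real c * Kl + U 0 i (l div c)"
proof (induction j)
  case (Suc j)
  show ?case
  proof (cases "c = j + 2")
    case True
    then show ?thesis using Suc.prems by (auto intro!: order_trans[OF improve_le] improve_le_new)
  next
    case False
    then show ?thesis using Suc
      by (auto intro: order_trans[OF improve_le[THEN order_trans[OF improve_le]]])
  qed
qed simp

lemma cloop_cases:
  "cloop U q i l x j = x \<or>
   (\<exists>c. 2 \<le> c \<and> l mod c = 0 \<and> vecc i l (l div c) \<and> cloop U q i l x j = (Kvec K + U q i (l div c), 2 * c)) \<or>
   (\<exists>c. 2 \<le> c \<and> l mod c = 0 \<and> idxc i l (l div c) \<and>
      cloop U q i l x j = (Kidx K + real c * Kl + U 0 i (l div c), 2 * c + 1))"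
    (is "?P j")
proof (induction j)
  case (Suc j)
  define y where "y = improve (l mod (j + 2) = 0 \<and> idxc i l (l div (j + 2)))
        (Kidx K + real (j + 2) * Kl + U 0 i (l div (j + 2))) (2 * (j + 2) + 1)
        (cloop U q i l x j)"
  have eq: "cloop U q i l x (Suc j) = improve (l mod (j + 2) = 0 \<and> vecc i l (l div (j + 2)))
      (Kvec K + U q i (l div (j + 2))) (2 * (j + 2)) y"
    by (simp add: y_def)
  have a: "cloop U q i l x (Suc j) = y \<or> (l mod (j + 2) = 0 \<and> vecc i l (l div (j + 2))) \<and>
      cloop U q i l x (Suc j) = (Kvec K + U q i (l div (j + 2)), 2 * (j + 2))"
    unfolding eq by (rule improve_cases)
  have b: "y = cloop U q i l x j \<or> (l mod (j + 2) = 0 \<and> idxc i l (l div (j + 2))) \<and>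
      y = (Kidx K + real (j + 2) * Kl + U 0 i (l div (j + 2)), 2 * (j + 2) + 1)"
    unfolding y_def by (rule improve_cases)
  consider "cloop U q i l x (Suc j) = cloop U q i l x j"
    | "cloop U q i l x (Suc j) = y" "l mod (j + 2) = 0 \<and> idxc i l (l div (j + 2))"
        "y = (Kidx K + real (j + 2) * Kl + U 0 i (l div (j + 2)), 2 * (j + 2) + 1)"
    | "l mod (j + 2) = 0 \<and> vecc i l (l div (j + 2))"
        "cloop U q i l x (Suc j) = (Kvec K + U q i (l div (j + 2)), 2 * (j + 2))"
    using a b by argo
  then show ?case
  proof cases
    case 1 then show ?thesis using Suc by simp
  next
    case 2
    then show ?thesis by (intro disjI2[OF disjI2] exI[of _ "j + 2"]) auto
  next
    case 3
    then show ?thesis by (intro disjI2[OF disjI1] exI[of _ "j + 2"]) auto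
  qed
qed simp

section \<open>Bounds on the optima and the meaning of the recorded choices\<close>

lemma consec_1: "consec i (Suc 0)"
  by (simp add: consec_def)

lemma V0_le: "l > 0 \<Longrightarrow> V 0 i l \<le> fst (first i l)"
  unfolding V_eq cell_def cell0_def
  by (simp, intro order_trans[OF cloop_le] improve_le)

lemma V2_le_one: "l > 0 \<Longrightarrow> V 2 i l \<le> V 0 i l + 2 * Kl"
  by (simp add: V_eq cell_def cell2_def)

lemma first_le: "l > 0 \<Longrightarrow> fst (first i l) \<le> Kidx K + real l * Kl + Kcon K"
  using pos by (auto simp: first_def add_nonneg_nonneg)

lemma V2_le_more:
  assumes "0 < m" "m < l"
  shows "V 2 i l \<le> V 0 i m + 2 * Kl + V 2 (i + m) (l - m)"
proof -
  have "fst (split0 V i l) \<le> V 0 i m + 2 * Kl + V 2 (i + m) (l - m)"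
    using ploop_le_new[of "m - 1" "l - 1" V i l] assms by (simp add: split0_def)
  moreover have "V 2 i l \<le> fst (split0 V i l)" using assms by (simp add: V_eq[of l] cell_def cell2_def)
  ultimately show ?thesis by simp
qed

text \<open>\<open>cell0\<close> minimises over \<open>split0\<close> instead of \<open>V 2\<close>.
  The two differ only if \<open>V 2\<close> is the one-piece value \<open>V 0 i l + 2 * Kl\<close>,
  and then positivity of the constants suffices.\<close>

lemma V0_le_strc:
  assumes "l > 0"
  shows "V 0 i l \<le> Kstrc K + V 2 i l"
proof -
  have "V 0 i l \<le> Kstrc K + fst (split0 V i l)"
    using assms by (simp add: V_eq cell_def cell0_def order_trans[OF cloop_le] improve_le_new)
  moreover have "V 2 i l = fst (split0 V i l) \<or> V 2 i l = V 0 i l + 2 * Kl"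
    using assms by (auto simp: V_eq cell_def cell2_def)
  ultimately show ?thesis using pos by auto
qed

lemma V1_le_strc:
  assumes "l > 0"
  shows "V 1 i l \<le> Kstrc K + V 2 i l"
  using assms by (simp add: V_eq cell_def cell1_def order_trans[OF cloop_le] improve_le_new)

lemma V1_le_idx1:
  assumes "l > 0"
  shows "V 1 i l \<le> Kidx K + Kl + V 0 i l"
  using assms order_trans[OF cloop_le improve_le]
  by (simp add: V_eq cell_def cell1_def) (metis fst_conv)

lemma V_le_vec:
  assumes "c > 0" "m > 0" "vecc i (c * m) m" "q < 2"
  shows "V q i (c * m) \<le> Kvec K + V q i m"
\<comment> \<open>The loop only tries counts from 2 up to the length. With count 1 the block is the
  segment itself.\<close>
proof (cases "c = 1")
  case True
  then show ?thesis using pos by simp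
next
  case False
  then have c: "2 \<le> c" using assms by simp
  have "c * 1 \<le> c * m" using assms by (intro mult_le_mono2) simp
  then have "c < (c * m - 1) + 2" unfolding mult_1_right by linarith
  then have "fst (cloop V q i (c * m) x (c * m - 1)) \<le> Kvec K + V q i m" for x
    using cloop_le_vec[of c "c * m - 1" "c * m" i V q x] assms c by simp
  moreover have "c * m > 0" using assms by simp
  moreover have "q = 0 \<or> q = 1" using assms by linarith
  ultimately show ?thesis
    by (elim disjE) (simp_all add: V_eq[of "c * m"] cell_def cell0_def cell1_def)
qed

lemma V_le_idx:
  assumes "c > 0" "m > 0" "idxc i (c * m) m" "q < 2"
  shows "V q i (c * m) \<le> Kidx K + real c * Kl + V 0 i m"
proof (cases "c = 1")
  case True
  then show ?thesis using pos V1_le_idx1[of m i] assms by (cases "q = 0") (auto simp: less_2_cases_iff)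
next
  case False
  then have c: "2 \<le> c" using assms by simp
  have "c * 1 \<le> c * m" using assms by (intro mult_le_mono2) simp
  then have "c < (c * m - 1) + 2" unfolding mult_1_right by linarith
  then have "fst (cloop V q i (c * m) x (c * m - 1)) \<le> Kidx K + real c * Kl + V 0 i m" for x
    using cloop_le_idx[of c "c * m - 1" "c * m" i V q x] assms c by simp
  moreover have "c * m > 0" using assms by simp
  moreover have "q = 0 \<or> q = 1" using assms by linarith
  ultimately show ?thesis
    by (elim disjE) (simp_all add: V_eq[of "c * m"] cell_def cell0_def cell1_def)
qed

lemma V0_one: "V 0 i (Suc 0) = Kcon K"
proof -
  have *: "fst (first i (Suc 0)) = Kcon K" by (simp add: first_def consec_1)
  show ?thesis using pos
    by (simp add: V_eq cell_def cell0_def split0_def * improve_def)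
qed

text \<open>The placeholder in \<open>split0\<close> is at least \<open>V 0 i l + 2 * Kl\<close> by
  \<open>V0_le\<close>, so a smaller value stems from a genuine cut.\<close>

lemma split0_cases:
  assumes "l > 0" "fst (split0 V i l) < V 0 i l + 2 * Kl"
  shows "\<exists>m. 0 < m \<and> m < l \<and> split0 V i l = (V 0 i m + 2 * Kl + V 2 (i + m) (l - m), m)"
proof -
  have "split0 V i l \<noteq> (fst (first i l) + 2 * Kl, l)"
    using V0_le[OF assms(1), of i] assms(2) by auto
  then obtain m where "m < l - 1"
    "split0 V i l = (V 0 i (m + 1) + 2 * Kl + V 2 (i + (m + 1)) (l - (m + 1)), m + 1)"
    using ploop_cases unfolding split0_def by metis
  then show ?thesis by (intro exI[of _ "m + 1"]) auto
qed

lemma cut_cases: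
  assumes "l > 0"
  shows "C 2 i l = l \<and> V 2 i l = V 0 i l + 2 * Kl \<or>
    0 < C 2 i l \<and> C 2 i l < l \<and> V 2 i l = V 0 i (C 2 i l) + 2 * Kl + V 2 (i + C 2 i l) (l - C 2 i l)"
proof (cases "fst (split0 V i l) < V 0 i l + 2 * Kl")
  case True
  then have "(V 2 i l, C 2 i l) = split0 V i l"
    using assms by (simp add: V_C_eq) (simp add: cell_def cell2_def V_eq)
  then show ?thesis using split0_cases[OF assms True] by auto
next
  case False
  then have "(V 2 i l, C 2 i l) = (V 0 i l + 2 * Kl, l)"
    using assms by (simp add: V_C_eq) (simp add: cell_def cell2_def V_eq)
  then show ?thesis by auto
qed

lemma stage_cases:
  assumes "(v, c) = cloop U q i l (improve True p 1 x) j"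
  obtains "(v, c) = x" | "v = p" "c = 1"
    | k where "2 \<le> k" "l mod k = 0" "vecc i l (l div k)" "v = Kvec K + U q i (l div k)" "c = 2 * k"
    | k where "2 \<le> k" "l mod k = 0" "idxc i l (l div k)" "v = Kidx K + real k * Kl + U 0 i (l div k)" "c = 2 * k + 1"
  using cloop_cases[of U q i l "improve True p 1 x" j] improve_cases[of True p 1 x] that
  unfolding assms[symmetric] by (metis prod.inject)

text \<open>The interface between the table and the trees built from it. The condition on
  \<open>c\<close> for \<open>q = 0\<close> makes the child shorter; for \<open>q = 1\<close> a
  count of 1 leads to \<open>q = 0\<close> at the same length.\<close>

lemma code_cases:
  assumes "l > 0" "q < 2"
  shows "C q i l = 0 \<and> q = 0 \<and> consec i l \<and> V q i l = Kcon K \<or>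
    (\<exists>c\<ge>2. l mod c = 0 \<and> C q i l = 2 * c \<and> vecc i l (l div c) \<and> V q i l = Kvec K + V q i (l div c)) \<or>
    (\<exists>c>0. (q = 0 \<longrightarrow> c \<ge> 2) \<and> l mod c = 0 \<and> C q i l = 2 * c + 1 \<and> idxc i l (l div c) \<and>
       V q i l = Kidx K + real c * Kl + V 0 i (l div c)) \<or>
    C q i l = 1 \<and> V q i l = Kstrc K + V 2 i l" (is "?con \<or> ?vec \<or> (\<exists>c. ?idx c) \<or> ?strc")
proof (cases "q = 0")
  case True
  have eq: "(V 0 i l, C 0 i l) = cloop V 0 i l (improve True (Kstrc K + fst (split0 V i l)) 1 (first i l)) (l - 1)"
    using assms by (simp only: V_C_eq) (simp add: cell_def cell0_def)
  from eq show ?thesis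
  proof (cases rule: stage_cases)
    case 1
    show ?thesis
    proof (cases "consec i l")
      \<comment> \<open>The start value is an \<open>Idx\<close> with \<open>l\<close> blocks of
        length 1, and \<open>V 0 i 1\<close> is the cost of a leaf; as one entry is always
        consecutive, \<open>l\<close> is at least 2.\<close>
      case False
      then have "l \<noteq> 1" using consec_1 by auto
      moreover have "V 0 i l = Kidx K + real l * Kl + Kcon K" "C 0 i l = 2 * l + 1"
        using 1 False by (simp_all add: first_def)
      moreover have "l div l = 1" "idxc i l 1" using assms(1) by (simp_all add: idxc_def)
      ultimately have "?idx l" using True V0_one[of i] assms(1) by simp
      then show ?thesis by (rule disjI2[OF disjI2[OF disjI1[OF exI]]])
    qed (use 1 True in \<open>auto simp: first_def\<close>)
  next
    case 2
    \<comment> \<open>A \<open>Strc\<close> root that was chosen has \<open>split0\<close> below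
      \<open>V 0 i l\<close>, so \<open>cell2\<close> does not correct the entry.\<close>
    then have "fst (split0 V i l) < V 0 i l + 2 * Kl" using pos by simp
    then have "V 2 i l = fst (split0 V i l)"
      using assms by (simp add: V_eq[of l] cell_def cell2_def)
    then show ?thesis using 2 True by simp
  next
    case (4 c)
    then have "?idx c" using True by simp
    then show ?thesis by (rule disjI2[OF disjI2[OF disjI1[OF exI]]])
  qed (use True in auto)
next
  case False
  then have q: "q = 1" using assms by simp
  have eq: "(V 1 i l, C 1 i l) = cloop V 1 i l (improve True (Kstrc K + V 2 i l) 1 (Kidx K + Kl + V 0 i l, 3)) (l - 1)"
    using assms by (simp only: V_C_eq) (simp add: cell_def cell1_def V_eq[of l])
  from eq show ?thesis
  proof (cases rule: stage_cases)
    case 1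
    then have "?idx 1" using q by (simp add: idxc_def)
    then show ?thesis by (rule disjI2[OF disjI2[OF disjI1[OF exI]]])
  next
    case (4 c)
    then have "?idx c" using q by simp
    then show ?thesis by (rule disjI2[OF disjI2[OF disjI1[OF exI]]])
  qed (use q in auto)
qed

text \<open>With a single piece, the child of the \<open>Strc\<close> root would be an optimal tree
  of the same segment, and the root would add \<open>Kstrc K + 2 * Kl\<close> to
  \<open>V 0 i l\<close>. A proper cut is what makes the reconstruction terminate.\<close>

lemma code_strc_cut:
  assumes "l > 0" "C 0 i l = 1" shows "C 2 i l < l"
proof -
  have "V 0 i l = Kstrc K + V 2 i l"
    using code_cases[OF assms(1), of 0 i] assms(2) by auto
  then show ?thesis using cut_cases[OF assms(1), of i] pos by auto
qed


section \<open>Segments of \<open>D\<close> as sequences represented by nodes\<close>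

definition seg :: "nat \<Rightarrow> nat \<Rightarrow> int \<Rightarrow> int list" where
  "seg i l y = map (\<lambda>k. D ! (i + k) - y) [0..<l]"

lemma length_seg [simp]: "length (seg i l y) = l"
  and nth_seg [simp]: "k < l \<Longrightarrow> seg i l y ! k = D ! (i + k) - y"
  by (auto simp: seg_def)

lemma shift_seg: "shift (seg i l y) x = seg i l (y - x)"
  by (rule nth_equalityI) auto

lemma seg_append: "m \<le> l \<Longrightarrow> seg i m y @ seg (i + m) (l - m) y = seg i l y"
  by (rule nth_equalityI) (auto simp: nth_append)

lemma index_lt: "a < c \<Longrightarrow> r < m \<Longrightarrow> a * m + r < c * (m::nat)"
proof -
  assume "a < c" "r < m"
  then have "a * m + r < Suc a * m" by simp
  also have "\<dots> \<le> c * m" using \<open>a < c\<close> by (intro mult_le_mono1) simp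
  finally show ?thesis .
qed

lemma flat_Vec_seg:
  assumes "flat T = seg i m y" "m > 0" "vecc i (c * m) m"
  shows "flat (Vec c (D ! (i + m) - D ! i) T) = seg i (c * m) y"
proof (rule nth_equalityI)
  fix j assume "j < length (flat (Vec c (D ! (i + m) - D ! i) T))"
  then have j: "j < c * length (flat T)" by (simp add: length_concat_shift)
  have "D ! (i + j) - D ! (i + j mod m) = int (j div m) * (D ! (i + m) - D ! i)"
    using assms j by (simp add: vecc_def)
  then show "flat (Vec c (D ! (i + m) - D ! i) T) ! j = seg i (c * m) y ! j"
    using nth_concat_shift[OF j, of "\<lambda>k. int k * (D ! (i + m) - D ! i)"] assms j by simp
qed (simp add: length_concat_shift assms)

text \<open>The child is normalised to start at 0; the base \<open>y\<close> enters through the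
  indices alone, which are the translated block starts.\<close>

lemma flat_Idx_seg:
  assumes "flat T = seg i m (D ! i)" "m > 0" "idxc i (c * m) m"
  shows "flat (Idx c (map (\<lambda>k. D ! (i + k * m) - y) [0..<c]) T) = seg i (c * m) y"
proof (rule nth_equalityI)
  fix j assume "j < length (flat (Idx c (map (\<lambda>k. D ! (i + k * m) - y) [0..<c]) T))"
  then have j: "j < c * length (flat T)" by (simp add: length_concat_shift)
  have "D ! (i + j) - D ! (i + (j - j mod m)) = D ! (i + j mod m) - D ! i"
    using assms j by (simp add: idxc_def)
  moreover have "j div m < c" using j assms by (simp add: less_mult_imp_div_less)
  ultimately show "flat (Idx c (map (\<lambda>k. D ! (i + k * m) - y) [0..<c]) T) ! j = seg i (c * m) y ! j"
    using nth_concat_shift[OF j, of "\<lambda>k. map (\<lambda>k. D ! (i + k * m) - y) [0..<c] ! k"] assms j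
    by (simp add: minus_mod_eq_div_mult)
qed (simp add: length_concat_shift assms)

text \<open>Inversion shared by \<open>Vec\<close> and \<open>Idx\<close>: comparing lengths shows
  that the block length divides \<open>l\<close>, and the first block determines the child up to the
  shift \<open>g 0\<close>.\<close>

lemma concat_shift_segD:
  assumes "concat (map (\<lambda>k. shift L (g k)) [0..<c]) = seg i l y" "l > 0"
  shows "0 < length L" "0 < c" "l = c * length L" "length L \<le> l" "L = seg i (length L) (y + g 0)"
    and "j < l \<Longrightarrow> L ! (j mod length L) + g (j div length L) = D ! (i + j) - y"
proof -
  show l: "l = c * length L" using arg_cong[OF assms(1), of length] by (simp add: length_concat_shift)
  then show L: "0 < length L" and c: "0 < c" using assms(2) by (auto intro: gr0I)
  show ml: "length L \<le> l" using l c by (cases c) auto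
  have nth: "L ! (j mod length L) + g (j div length L) = D ! (i + j) - y" if "j < l" for j
    using nth_concat_shift[of j c L g] that assms l by simp
  then show "j < l \<Longrightarrow> L ! (j mod length L) + g (j div length L) = D ! (i + j) - y" .
  have "L ! j = D ! (i + j) - (y + g 0)" if "j < length L" for j
    using nth[of j] ml that by simp
  then show "L = seg i (length L) (y + g 0)" by (intro nth_equalityI) auto
qed

lemma flat_Vec_segD:
  assumes "flat (Vec c d T) = seg i l y" "l > 0"
  obtains m where "m > 0" "c > 0" "l = c * m" "flat T = seg i m y" "c = 1 \<or> vecc i l m"
proof
  define m where "m = length (flat T)"
  note f = concat_shift_segD[OF assms[simplified flat.simps], folded m_def]
  show m: "0 < m" "0 < c" "l = c * m" "flat T = seg i m y" using f by simp_all
  show "c = 1 \<or> vecc i l m"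
  proof (cases "c = 1")
    case False
    then have "2 * m \<le> c * m" using m by (intro mult_le_mono1) simp
    then have "m < l" using m by linarith
    \<comment> \<open>With at least two copies, position \<open>m\<close> lies inside the segment,
      and its entry reveals the stride.\<close>
    then have d: "d = D ! (i + m) - D ! i"
      using f(6)[of m] f(6)[of 0] m by simp
    have "D ! (i + j) - D ! (i + j mod m) = int (j div m) * d" if "j < l" for j
      using f(6)[OF that] f(6)[of "j mod m"] le_less_trans[OF mod_less_eq_dividend that] m by simp
    then show ?thesis by (simp add: vecc_def d)
  qed simp
qed

lemma flat_Idx_segD:
  assumes "flat (Idx c xs T) = seg i l y" "l > 0"
  obtains m where "m > 0" "c > 0" "l = c * m" "\<exists>z. flat T = seg i m z" "idxc i l m"
proof
  define m where "m = length (flat T)"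
  note f = concat_shift_segD[OF assms[simplified flat.simps], folded m_def]
  show m: "0 < m" "0 < c" "l = c * m" "\<exists>z. flat T = seg i m z" using f by blast+
  have "D ! (i + j) - D ! (i + (j - j mod m)) = D ! (i + j mod m) - D ! i" if "j < l" for j
  proof -
    have j: "j mod m < l" "j - j mod m < l" using that le_less_trans[OF mod_less_eq_dividend that] by auto
    have "(j - j mod m) mod m = 0" "(j - j mod m) div m = j div m"
      by (auto simp: minus_mod_eq_div_mult m(1))
    \<comment> \<open>Four entries are compared: at \<open>j\<close>, at its offset within the
      block, at the start of its block and at 0. The child and the indices cancel.\<close>
    then show ?thesis using f(6)[OF that] f(6)[OF j(1)] f(6)[OF j(2)] f(6)[of 0] m(1) that by simp
  qed
  then show "idxc i l m" by (simp add: idxc_def)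
qed

section \<open>No representing tree is cheaper than the table\<close>

lemma strc_lower:
  assumes "\<forall>(T, x)\<in>set ts. \<forall>i l y. 0 < l \<longrightarrow> flat T = seg i l y \<longrightarrow> V 0 i l \<le> cost K T"
    and "\<forall>(T, x)\<in>set ts. 0 \<le> cost K T"
    and "concat (map (\<lambda>(T, x). shift (flat T) x) ts) = seg i l y" "l > 0"
  shows "V 2 i l \<le> (\<Sum>(T, x)\<leftarrow>ts. cost K T + 2 * Kl)"
  using assms
proof (induction ts arbitrary: i l)
  case Nil
  then have "l = 0" by (simp add: seg_def)
  then show ?case using Nil by simp
next
  case (Cons t ts)
  obtain T x where t: "t = (T, x)" by (cases t)
  define m where "m = length (flat T)"
  define rest where "rest = concat (map (\<lambda>(T, x). shift (flat T) x) ts)"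
  have eq: "shift (flat T) x @ rest = seg i l y" using Cons.prems(3) by (simp add: t rest_def)
  have ml: "m \<le> l" using arg_cong[OF eq, of length] by (simp add: m_def)
  have split: "shift (flat T) x = seg i m y" "rest = seg (i + m) (l - m) y"
    using eq unfolding seg_append[OF ml, of i y, symmetric] by (auto simp: m_def)
  have T: "flat T = seg i m (y + x)"
  proof (rule nth_equalityI)
    fix j assume "j < length (flat T)"
    then show "flat T ! j = seg i m (y + x) ! j" using arg_cong[OF split(1), of "\<lambda>z. z ! j"] by (simp add: m_def)
  qed (simp add: m_def)
  have nn: "0 \<le> cost K T" using Cons.prems(2) t by simp
  have IH: "V 2 (i + m) (l - m) \<le> (\<Sum>(T, x)\<leftarrow>ts. cost K T + 2 * Kl)" if "m < l"
    by (rule Cons.IH) (use Cons.prems split that in \<open>auto simp: rest_def\<close>)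
  have "\<forall>i l y. 0 < l \<longrightarrow> flat T = seg i l y \<longrightarrow> V 0 i l \<le> cost K T"
    using Cons.prems(1) t by simp
  then have c: "V 0 i m \<le> cost K T" if "m > 0" using T that by blast
  define R where "R = (\<Sum>(T, x)\<leftarrow>ts. cost K T + 2 * Kl)"
  have R: "R \<ge> 0" unfolding R_def
    using Cons.prems(2) pos by (intro sum_list_nonneg) (auto intro!: add_nonneg_nonneg)
  have sum: "(\<Sum>(T, x)\<leftarrow>t # ts. cost K T + 2 * Kl) = cost K T + 2 * Kl + R"
    by (simp add: t R_def)
  \<comment> \<open>\<open>m = 0\<close> does occur: a child with count 0 may represent the empty
    sequence. It is dropped, which cannot increase the cost.\<close>
  consider "m = 0" | "0 < m" "m < l" | "0 < m" "m = l" using ml by linarith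
  then have "V 2 i l \<le> cost K T + 2 * Kl + R"
  proof cases
    case 1
    then have "V 2 i l \<le> R" using IH Cons.prems(4) by (simp add: R_def)
    then show ?thesis using nn pos(5) by linarith
  next
    case 2
    then show ?thesis using c IH V2_le_more[of m l i] unfolding R_def by linarith
  next
    case 3
    then show ?thesis using c V2_le_one[of l i] R by fastforce
  qed
  then show ?case using sum by simp
qed

lemma cost_nonneg: "0 \<le> cost K T"
proof (induction T)
  case (Strc c xs Cs)
  then have "0 \<le> sum_list (map (cost K) Cs)" by (intro sum_list_nonneg) auto
  then show ?case using pos by (simp add: add_nonneg_nonneg)
qed (use pos in \<open>auto simp: add_nonneg_nonneg\<close>)

text \<open>The base \<open>y\<close> has to be arbitrary because a child of \<open>Idx\<close> or
  \<open>Strc\<close> may be any translate. A leaf forces \<open>y = D ! i\<close>, a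
  \<open>Vec\<close> node keeps \<open>y\<close>, and for the other two kinds both bounds follow
  from \<open>V 0\<close> of the children.\<close>

lemma V_lower:
  assumes "basic_tree T" "flat T = seg i l y" "l > 0"
  shows "V 0 i l \<le> cost K T \<and> (y \<noteq> D ! i \<longrightarrow> V 1 i l \<le> cost K T)"
  using assms
proof (induction T arbitrary: i l y)
  case (Con c)
  have "c = l" using arg_cong[OF Con.prems(2), of length] by simp
  then have *: "D ! (i + k) - y = int k" if "k < l" for k
    using arg_cong[OF Con.prems(2), of "\<lambda>z. z ! k"] that by simp
  have y: "y = D ! i" using *[of 0] Con.prems(3) by simp
  then have "consec i l" using * by (simp add: consec_def)
  then show ?case using y V0_le[OF Con.prems(3), of i] by (simp add: first_def)
next
  case (Vec c d T)
  obtain m where m: "m > 0" "c > 0" "l = c * m" "flat T = seg i m y" "c = 1 \<or> vecc i l m"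
    using flat_Vec_segD Vec.prems by metis
  have IH: "V 0 i m \<le> cost K T \<and> (y \<noteq> D ! i \<longrightarrow> V 1 i m \<le> cost K T)"
    using Vec.IH[of i m y] m Vec.prems by simp
  show ?case
  proof (cases "c = 1")
    case True
    then show ?thesis using IH m pos by auto
  next
    case False
    then have "V 0 i l \<le> Kvec K + V 0 i m" "V 1 i l \<le> Kvec K + V 1 i m"
      using V_le_vec[of c m i 0] V_le_vec[of c m i 1] m by auto
    then show ?thesis using IH by auto
  qed
next
  case (Idx c xs T)
  obtain m z where m: "m > 0" "c > 0" "l = c * m" "flat T = seg i m z" "idxc i l m"
    using flat_Idx_segD Idx.prems by metis
  have "V 0 i m \<le> cost K T"
    using Idx.IH[of i m z] m Idx.prems by simp
  moreover have "V 0 i l \<le> Kidx K + c * Kl + V 0 i m" "V 1 i l \<le> Kidx K + c * Kl + V 0 i m"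
    using V_le_idx[of c m i 0] V_le_idx[of c m i 1] m by auto
  ultimately show ?case by auto
next
  case (Strc c xs Cs)
  have len: "length xs = c" "length Cs = c" using Strc.prems by auto
  have IH: "\<forall>(T, x)\<in>set (zip Cs xs). \<forall>i l y. 0 < l \<longrightarrow> flat T = seg i l y \<longrightarrow> V 0 i l \<le> cost K T"
    using Strc.IH Strc.prems(1) by (auto dest!: set_zip_leftD)
  have "V 2 i l \<le> (\<Sum>(T, x)\<leftarrow>zip Cs xs. cost K T + 2 * Kl)"
    by (rule strc_lower[OF IH]) (use Strc.prems len flat_Strc cost_nonneg in auto)
  also have "\<dots> = (\<Sum>T\<leftarrow>map fst (zip Cs xs). cost K T + 2 * Kl)"
    by (simp add: case_prod_unfold comp_def)
  also have "\<dots> = sum_list (map (cost K) Cs) + 2 * real c * Kl"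
    using len by (simp add: sum_list_addf sum_list_triv)
  finally have "V 2 i l \<le> sum_list (map (cost K) Cs) + 2 * real c * Kl" .
  then show ?case using V0_le_strc[OF Strc.prems(3), of i] V1_le_strc[OF Strc.prems(3), of i] by simp
qed

section \<open>Trees read off the recorded choices\<close>

function starts :: "nat \<Rightarrow> nat \<Rightarrow> nat list" where
  "starts i l = i # (if 0 < C 2 i l \<and> C 2 i l < l then starts (i + C 2 i l) (l - C 2 i l) else [])"
  by auto
termination by (relation "measure snd") auto

declare starts.simps [simp del]

definition base :: "nat \<Rightarrow> nat \<Rightarrow> int" where
  "base q i = (if q = 0 then D ! i else 0)"

text \<open>\<open>rep q i l Ts\<close>: the recorded choices for \<open>(q, i, l)\<close> lead to the trees \<open>Ts\<close>, a single one if \<open>q < 2\<close>.\<close>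

inductive rep :: "nat \<Rightarrow> nat \<Rightarrow> nat \<Rightarrow> btree list \<Rightarrow> bool" where
  con: "C 0 i l = 0 \<Longrightarrow> l > 0 \<Longrightarrow> rep 0 i l [Con l]"
| vec: "q < 2 \<Longrightarrow> c \<ge> 2 \<Longrightarrow> m > 0 \<Longrightarrow> C q i (c * m) = 2 * c \<Longrightarrow> rep q i m [T] \<Longrightarrow>
    rep q i (c * m) [Vec c (D ! (i + m) - D ! i) T]"
| idx: "q < 2 \<Longrightarrow> c > 0 \<Longrightarrow> m > 0 \<Longrightarrow> C q i (c * m) = 2 * c + 1 \<Longrightarrow> rep 0 i m [T] \<Longrightarrow>
    rep q i (c * m) [Idx c (map (\<lambda>k. D ! (i + k * m) - base q i) [0..<c]) T]"
| strc: "q < 2 \<Longrightarrow> l > 0 \<Longrightarrow> C q i l = 1 \<Longrightarrow> rep 2 i l Ts \<Longrightarrow>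
    rep q i l [Strc (length Ts) (map (\<lambda>j. D ! j - base q i) (starts i l)) Ts]"
| one: "l > 0 \<Longrightarrow> C 2 i l = l \<Longrightarrow> rep 0 i l [T] \<Longrightarrow> rep 2 i l [T]"
| more: "m > 0 \<Longrightarrow> m < l \<Longrightarrow> C 2 i l = m \<Longrightarrow> rep 0 i m [T] \<Longrightarrow> rep 2 (i + m) (l - m) Ts \<Longrightarrow>
    rep 2 i l (T # Ts)"

text \<open>A one-piece partition does not shorten the segment, hence the last assumption. In
  \<open>rep_exists_node\<close> it is met by \<open>code_strc_cut\<close> for \<open>q = 0\<close>
  and by the trees for \<open>q = 0\<close> when \<open>q = 1\<close>.\<close>

lemma rep_exists_2:
  assumes "l > 0" "\<And>i m. 0 < m \<Longrightarrow> m < l \<Longrightarrow> \<exists>T. rep 0 i m [T]"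
    and "C 2 i l = l \<Longrightarrow> \<exists>T. rep 0 i l [T]"
  shows "\<exists>Ts. rep 2 i l Ts"
  using assms
proof (induction l arbitrary: i rule: less_induct)
  case (less l)
  show ?case
  proof (cases "C 2 i l = l")
    case True
    then show ?thesis using less.prems rep.one by metis
  next
    case False
    define m where "m = C 2 i l"
    have m: "0 < m" "m < l" using cut_cases[OF less.prems(1), of i] False by (auto simp: m_def)
    obtain T where T: "rep 0 i m [T]" using less.prems(2) m by blast
    have a: "l - m < l" "0 < l - m" using m by auto
    have b: "\<exists>T. rep 0 i' m' [T]" if "0 < m'" "m' < l - m" for i' m'
      by (rule less.prems(2)) (use that in linarith)+
    obtain Ts where Ts: "rep 2 (i + m) (l - m) Ts"
      using less.IH[OF a b less.prems(2)[OF a(2,1)]] by blast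
    show ?thesis using rep.more[OF m m_def[symmetric] T Ts] by blast
  qed
qed

lemma rep_exists_node:
  assumes "l > 0" "q < 2"
    "\<And>i m. 0 < m \<Longrightarrow> m < l \<Longrightarrow> \<exists>T. rep q i m [T]"
    "\<And>i m. 0 < m \<Longrightarrow> m < l \<or> m = l \<and> q = 1 \<Longrightarrow> \<exists>T. rep 0 i m [T]"
  shows "\<exists>T. rep q i l [T]"
proof -
  consider "C q i l = 0" "q = 0"
    | c where "2 \<le> c" "l mod c = 0" "C q i l = 2 * c"
    | c where "c > 0" "q = 0 \<longrightarrow> 2 \<le> c" "l mod c = 0" "C q i l = 2 * c + 1"
    | "C q i l = 1"
    using code_cases[OF assms(1,2), of i] by auto
  then show ?thesis
  proof cases
    case 1
    then show ?thesis using rep.con assms by auto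
  next
    case (2 c)
    define m where "m = l div c"
    have l: "c * m = l" using 2 by (auto simp: m_def)
    have m0: "0 < m" using assms(1) l by (auto intro: gr0I)
    moreover have "1 * m < c * m" using m0 2 by (intro mult_strict_right_mono) auto
    ultimately have m: "0 < m" "m < l" using l by auto
    obtain T where "rep q i m [T]" using assms(3) m by blast
    then show ?thesis using rep.vec[of q c m i T] 2 m assms by (auto simp: l)
  next
    case (3 c)
    define m where "m = l div c"
    have l: "c * m = l" using 3 by (auto simp: m_def)
    have m0: "0 < m" using assms(1) l by (auto intro: gr0I)
    have "m < l \<or> m = l \<and> q = 1"
    proof (cases "c = 1")
      case False
      then have "1 * m < c * m" using m0 3 by (intro mult_strict_right_mono) auto
      then show ?thesis using l by simp
    qed (use 3 assms(2) l in auto)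
    then obtain T where "rep 0 i m [T]" using assms(4) m0 by blast
    then show ?thesis using rep.idx[of q c m i T] 3 m0 assms by (auto simp: l)
  next
    case 4
    have "\<exists>T. rep 0 i l [T]" if "C 2 i l = l"
      using assms code_strc_cut[OF assms(1), of i] 4 that by (cases "q = 0") auto
    then obtain Ts where "rep 2 i l Ts" using rep_exists_2[OF assms(1), of i] assms(4) by blast
    then show ?thesis using rep.strc 4 assms by blast
  qed
qed

lemma rep_exists_0: "l > 0 \<Longrightarrow> \<exists>T. rep 0 i l [T]"
proof (induction l arbitrary: i rule: less_induct)
  case (less l)
  then show ?case using rep_exists_node[of l 0 i] by simp
qed

lemma rep_exists_1: "l > 0 \<Longrightarrow> \<exists>T. rep 1 i l [T]"
proof (induction l arbitrary: i rule: less_induct)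
  case (less l)
  then show ?case using rep_exists_node[of l 1 i] rep_exists_0 by simp
qed

text \<open>The clause for \<open>q = 2\<close> is stated for every \<open>y\<close>, since one
  recorded partition serves \<open>Strc\<close> roots with different bases. The extra
  \<open>2 * Kl\<close> per piece is the lookup cost of that root.\<close>

lemma rep_sound:
  assumes "rep q i l Ts"
  shows "l > 0 \<and> (\<forall>T\<in>set Ts. basic_tree T) \<and>
    (q < 2 \<longrightarrow> flat (hd Ts) = seg i l (base q i) \<and> cost K (hd Ts) = V q i l) \<and>
    (q = 2 \<longrightarrow> length (starts i l) = length Ts \<and>
      (\<forall>y. concat (map (\<lambda>(T, x). shift (flat T) x) (zip Ts (map (\<lambda>j. D ! j - y) (starts i l)))) = seg i l y) \<and>
      sum_list (map (cost K) Ts) + 2 * real (length Ts) * Kl = V 2 i l)"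
  using assms
proof (induction rule: rep.induct)
  case (con i l)
  have "consec i l" "V 0 i l = Kcon K" using code_cases[OF con(2), of 0 i] con by auto
  then show ?case using con
    by (auto simp: base_def consec_def intro!: nth_equalityI)
next
  case (vec q c m i T)
  \<comment> \<open>Parity tells the code of a \<open>Vec\<close> from that of an
    \<open>Idx\<close>.\<close>
  have *: "vecc i (c * m) m" "V q i (c * m) = Kvec K + V q i m"
    using code_cases[of "c * m" q i] vec double_not_eq_Suc_double[of c] by auto
  then show ?case using vec flat_Vec_seg[of T i m _ c] by auto
next
  case (idx q c m i T)
  have *: "idxc i (c * m) m" "V q i (c * m) = Kidx K + real c * Kl + V 0 i m"
    using code_cases[of "c * m" q i] idx Suc_double_not_eq_double[of c] by auto
  then show ?case using idx flat_Idx_seg[of T i m c "base q i"] by (auto simp: base_def[of 0])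
next
  case (strc q l i Ts)
  have *: "V q i l = Kstrc K + V 2 i l"
    using code_cases[of l q i] strc by auto
  have "flat (Strc (length Ts) (map (\<lambda>j. D ! j - base q i) (starts i l)) Ts) = seg i l (base q i)"
    using strc by (subst flat_Strc) auto
  then show ?case using strc * by (auto simp del: flat.simps)
next
  case (one l i T)
  have "V 2 i l = V 0 i l + 2 * Kl" using cut_cases[of l i] one by auto
  moreover have "starts i l = [i]" using one by (simp add: starts.simps)
  ultimately show ?case using one by (auto simp: shift_seg base_def)
next
  case (more m l i T Ts)
  have "V 2 i l = V 0 i m + 2 * Kl + V 2 (i + m) (l - m)" using cut_cases[of l i] more by auto
  moreover have "starts i l = i # starts (i + m) (l - m)"
    using more starts.simps[of i l] by simp
  ultimately show ?case using more
    by (auto simp: shift_seg base_def seg_append algebra_simps)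
qed

text \<open>The root must represent \<open>D\<close> with base 0, and this is the translate that
  starts at 0 exactly if \<open>D ! 0 = 0\<close>.\<close>

theorem rep_optimal:
  assumes "rep q 0 (length D) [T]" "q = (if D ! 0 = 0 then 0 else 1)"
  shows "optimal_tree K D T"
proof -
  have n: "length D > 0" using rep_sound[OF assms(1)] by simp
  have D: "seg 0 (length D) 0 = D" by (intro nth_equalityI) auto
  have "base q 0 = 0" using assms(2) by (auto simp: base_def)
  then have "represents T D" "cost K T = V q 0 (length D)"
    using rep_sound[OF assms(1)] assms(2) D by (auto simp: represents_def)
  moreover have "V q 0 (length D) \<le> cost K T'" if "represents T' D" for T'
    using V_lower[of T' 0 "length D" 0] that D n assms(2) by (auto simp: represents_def)
  ultimately show ?thesis by (simp add: optimal_tree_def)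
qed


section \<open>Bounds on the optimal costs and on the size of the output\<close>

lemma V_nonneg:
  assumes "l > 0" "q \<le> 2"
  shows "0 \<le> V q i l"
proof -
  consider "q = 0" | "q = 1" | "q = 2" using assms(2) by linarith
  then show ?thesis
  proof cases
    case 1
    then show ?thesis using rep_exists_0[OF assms(1), of i] rep_sound cost_nonneg
      by (metis zero_less_numeral)
  next
    case 2
    then show ?thesis using rep_exists_1[OF assms(1), of i] rep_sound cost_nonneg
      by (metis one_less_numeral_iff semiring_norm(76))
  next
    case 3
    obtain Ts where "rep 2 i l Ts" using rep_exists_2[OF assms(1)] rep_exists_0 assms(1) by blast
    then have "sum_list (map (cost K) Ts) + 2 * real (length Ts) * Kl = V 2 i l" using rep_sound by blast
    moreover have "0 \<le> sum_list (map (cost K) Ts)" by (intro sum_list_nonneg) (auto simp: cost_nonneg)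
    ultimately show ?thesis using 3 pos(5) by (metis add_nonneg_nonneg less_imp_le mult_nonneg_nonneg of_nat_0_le_iff zero_le_numeral)
  qed
qed

text \<open>The slope of a linear cost bound: \<open>Idx\<close> over \<open>Con 1\<close>
  represents a segment of length \<open>l\<close> with one lookup per entry.\<close>

definition Ksum :: real where
  "Ksum = Kcon K + Kvec K + Kidx K + Kstrc K + Kl"

lemma Ksum_pos: "Ksum > 0"
  using pos by (simp add: Ksum_def)

lemma first_le_Ksum: "l > 0 \<Longrightarrow> fst (first i l) \<le> (real l + 1) * Ksum"
proof -
  assume "l > 0"
  then have "fst (first i l) \<le> Kidx K + real l * Kl + Kcon K" by (rule first_le)
  also have "\<dots> \<le> Ksum + real l * Ksum"
    using pos mult_left_mono[of Kl Ksum "real l"] by (simp add: Ksum_def)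
  finally show ?thesis by (simp add: algebra_simps)
qed

lemma V_le_Ksum:
  assumes "l > 0" "q \<le> 2"
  shows "V q i l \<le> (real l + 3) * Ksum"
proof -
  have 0: "V 0 i l \<le> (real l + 1) * Ksum"
    using V0_le first_le_Ksum assms(1) order_trans by blast
  have 1: "V 1 i l \<le> (real l + 1) * Ksum + Ksum"
    using V1_le_idx1[OF assms(1), of i] 0 pos by (simp add: Ksum_def)
  have 2: "V 2 i l \<le> (real l + 1) * Ksum + 2 * Ksum"
    using V2_le_one[OF assms(1), of i] 0 pos by (simp add: Ksum_def)
  consider "q = 0" | "q = 1" | "q = 2" using assms(2) by linarith
  then show ?thesis using 0 1 2 Ksum_pos by cases (simp_all add: algebra_simps)
qed

definition Kmin :: real where
  "Kmin = Min {Kcon K, Kvec K, Kidx K, Kstrc K, Kl}"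

lemma Kmin_pos: "Kmin > 0"
  using pos by (simp add: Kmin_def)

text \<open>The longest header, that of \<open>Vec\<close>, has three words, which gives the factor
  3. The indices of \<open>Idx\<close> and \<open>Strc\<close> are paid for by their
  lookups.\<close>

lemma length_encode_cost:
  assumes "basic_tree T"
  shows "real (length (encode T)) * Kmin \<le> 3 * cost K T"
proof -
  have le: "Kmin \<le> Kcon K" "Kmin \<le> Kvec K" "Kmin \<le> Kidx K" "Kmin \<le> Kstrc K" "Kmin \<le> Kl"
    by (auto simp: Kmin_def)
  have leaf: "real c * Kmin \<le> real c * Kl" for c using le by (simp add: mult_left_mono)
  show ?thesis using assms
  proof (induction T)
    case (Con c)
    then show ?case using le Kmin_pos by simp
  next
    case (Vec c d T)
    then show ?case using le by (simp add: algebra_simps)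
  next
    case (Idx c xs T)
    have "real c * Kmin \<le> real c * Kl" "0 \<le> real c * Kl" using leaf pos by auto
    moreover have "real (length (encode (Idx c xs T))) * Kmin =
        2 * Kmin + real c * Kmin + real (length (encode T)) * Kmin"
      using Idx.prems by (simp add: algebra_simps)
    moreover have "real (length (encode T)) * Kmin \<le> 3 * cost K T" using Idx by simp
    moreover have "cost K (Idx c xs T) = Kidx K + real c * Kl + cost K T" by simp
    ultimately show ?case using le Kmin_pos by linarith
  next
    case (Strc c xs Cs)
    have "\<forall>T\<in>set Cs. real (length (encode T)) * Kmin \<le> 3 * cost K T" using Strc by simp
    then have "real (length (concat (map encode Cs))) * Kmin \<le> 3 * sum_list (map (cost K) Cs)"
      by (induction Cs) (simp_all add: algebra_simps)
    moreover have "real c * Kmin \<le> real c * Kl" "0 \<le> real c * Kl" using leaf pos by auto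
    moreover have "real (length (encode (Strc c xs Cs))) * Kmin =
        2 * Kmin + real c * Kmin + real (length (concat (map encode Cs))) * Kmin"
      using Strc.prems by (simp add: algebra_simps)
    moreover have "cost K (Strc c xs Cs) = Kstrc K + 2 * (real c * Kl) + sum_list (map (cost K) Cs)"
      by simp
    ultimately show ?case using le Kmin_pos by linarith
  qed
qed

text \<open>The 12 comes from \<open>3 * (l + 3) \<le> 12 * (l + 1)\<close>, where 3 is the factor
  of \<open>length_encode_cost\<close> and \<open>l + 3\<close> that of
  \<open>V_le_Ksum\<close>.\<close>

definition Q :: nat where
  "Q = nat \<lceil>12 * Ksum / Kmin\<rceil>"

lemma rep_encode_bound:
  assumes "rep q i l [T]" "q < 2"
  shows "length (encode T) \<le> Q * (l + 1)"
proof -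
  have T: "basic_tree T" "cost K T = V q i l" "l > 0" using rep_sound[OF assms(1)] assms(2) by auto
  have "real (length (encode T)) * Kmin \<le> 3 * ((real l + 3) * Ksum)"
    using length_encode_cost[OF T(1)] V_le_Ksum[OF T(3), of q i] T(2) assms(2) by linarith
  also have "\<dots> \<le> 12 * Ksum * (real l + 1)" using Ksum_pos by (simp add: algebra_simps)
  finally have "real (length (encode T)) \<le> 12 * Ksum / Kmin * (real l + 1)"
    using Kmin_pos by (simp add: field_simps)
  also have "\<dots> \<le> real Q * (real l + 1)"
    unfolding Q_def by (intro mult_right_mono real_nat_ceiling_ge) auto
  finally have "real (length (encode T)) \<le> real (Q * (l + 1))" by (simp add: algebra_simps)
  then show ?thesis using of_nat_le_iff by blast
qed

end

section \<open>Execution of programs with a time bound\<close>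

text \<open>Since \<open>fits W\<close> is carried along from state to state, only the number newly
  written by an instruction has to be bounded. A state that does not fit makes the claim vacuous, so
  the initial state is checked at the end.\<close>

definition run :: "nat \<Rightarrow> nat \<Rightarrow> prog \<Rightarrow> state \<Rightarrow> nat \<Rightarrow> (state \<Rightarrow> bool) \<Rightarrow> bool" where
  "run S W P s t R \<longleftrightarrow>
     (fits W s \<longrightarrow> (\<exists>t' s'. exec S W P s t' s' \<and> t' \<le> t \<and> fits W s' \<and> R s'))"

lemma run_cons:
  assumes "run S W P s t R" "t \<le> t'" "\<And>s'. R s' \<Longrightarrow> R' s'"
  shows "run S W P s t' R'"
  using assms unfolding run_def by (meson order_trans)

lemma run_Skip: "R s \<Longrightarrow> 1 \<le> t \<Longrightarrow> run S W Skip s t R"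
  unfolding run_def using exec.Skip by blast

lemma run_Seq:
  assumes "run S W P s t1 (\<lambda>s'. run S W P' s' t2 R)" "t1 + t2 \<le> t"
  shows "run S W (Seq P P') s t R"
  unfolding run_def
proof
  assume "fits W s"
  then obtain t' s' where 1: "exec S W P s t' s'" "t' \<le> t1" "fits W s'" "run S W P' s' t2 R"
    using assms(1) unfolding run_def by blast
  then obtain t'' s'' where 2: "exec S W P' s' t'' s''" "t'' \<le> t2" "fits W s''" "R s''"
    unfolding run_def by blast
  have "exec S W (Seq P P') s (t' + t'') s''" using 1 2 exec.Seq by blast
  moreover have "t' + t'' \<le> t" using 1 2 assms(2) by simp
  ultimately show "\<exists>t' s'. exec S W (Seq P P') s t' s' \<and> t' \<le> t \<and> fits W s' \<and> R s'"
    using 2 by blast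
qed

lemma run_seq:
  assumes "run S W P s t1 R1" "\<And>s'. R1 s' \<Longrightarrow> run S W P' s' t2 R" "t1 + t2 \<le> t"
  shows "run S W (Seq P P') s t R"
  using run_Seq[OF run_cons[OF assms(1) order_refl assms(2)] assms(3)] by blast

lemma run_If:
  assumes "holds b s \<Longrightarrow> run S W P s t0 R" "\<not> holds b s \<Longrightarrow> run S W P' s t0 R" "1 + t0 \<le> t"
  shows "run S W (If b P P') s t R"
  unfolding run_def
proof
  assume f: "fits W s"
  show "\<exists>t' s'. exec S W (If b P P') s t' s' \<and> t' \<le> t \<and> fits W s' \<and> R s'"
  proof (cases "holds b s")
    case True
    then obtain t' s' where 1: "exec S W P s t' s'" "t' \<le> t0" "fits W s'" "R s'"
      using assms(1) f unfolding run_def by blast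
    then have "exec S W (If b P P') s (1 + t') s'" using exec.IfTrue True by blast
    moreover have "1 + t' \<le> t" using 1 assms(3) by simp
    ultimately show ?thesis using 1 by blast
  next
    case False
    then obtain t' s' where 1: "exec S W P' s t' s'" "t' \<le> t0" "fits W s'" "R s'"
      using assms(2) f unfolding run_def by blast
    then have "exec S W (If b P P') s (1 + t') s'" using exec.IfFalse False by blast
    moreover have "1 + t' \<le> t" using 1 assms(3) by simp
    ultimately show ?thesis using 1 by blast
  qed
qed

text \<open>\<open>j\<close> bounds the number of remaining rounds. Each round costs one test
  besides its body, and the failing test costs one more step.\<close>

lemma run_While:
  assumes "I j s"
    and "\<And>j s. I j s \<Longrightarrow> holds b s \<Longrightarrow> run S W P s tb (\<lambda>s'. \<exists>j'<j. I j' s')"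
    and "j * (tb + 1) + 1 \<le> t"
  shows "run S W (While b P) s t (\<lambda>s'. (\<exists>j. I j s') \<and> \<not> holds b s')"
  using assms(1,3)
proof (induction j arbitrary: s t rule: less_induct)
  case (less j)
  show ?case
    unfolding run_def
  proof
    assume f: "fits W s"
    show "\<exists>t' s'. exec S W (While b P) s t' s' \<and> t' \<le> t \<and> fits W s' \<and> (\<exists>j. I j s') \<and> \<not> holds b s'"
    proof (cases "holds b s")
      case False
      then show ?thesis using exec.WhileFalse[OF False] f less.prems
        by (intro exI[of _ 1] exI[of _ s]) auto
    next
      case True
      then obtain t1 s1 j1 where 1: "exec S W P s t1 s1" "t1 \<le> tb" "fits W s1" "j1 < j" "I j1 s1"
        using assms(2)[OF less.prems(1) True] f unfolding run_def by blast
      obtain t2 s2 where 2: "exec S W (While b P) s1 t2 s2" "t2 \<le> j1 * (tb + 1) + 1" "fits W s2"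
        "\<exists>j. I j s2" "\<not> holds b s2"
        using less.IH[OF 1(4,5) order_refl] 1(3) unfolding run_def by blast
      have "exec S W (While b P) s (1 + t1 + t2) s2" using exec.WhileTrue True 1 2 by blast
      moreover have "1 + t1 + t2 \<le> t"
      proof -
        have "Suc j1 * (tb + 1) \<le> j * (tb + 1)" using 1(4) by (intro mult_le_mono1) simp
        then show ?thesis using 1(2) 2(2) less.prems(2) by simp
      qed
      ultimately show ?thesis using 2 by blast
    qed
  qed
qed

lemma run_for:
  assumes "I a s" "a \<le> e"
    and "\<And>j s. a \<le> j \<Longrightarrow> j < e \<Longrightarrow> I j s \<Longrightarrow> run S W P s tb (I (Suc j))"
    and "\<And>j s. a \<le> j \<Longrightarrow> j \<le> e \<Longrightarrow> I j s \<Longrightarrow> holds b s \<longleftrightarrow> j < e"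
    and "(e - a) * (tb + 1) + 1 \<le> t"
  shows "run S W (While b P) s t (I e)"
proof (rule run_cons)
  show "run S W (While b P) s t (\<lambda>s'. (\<exists>j. j \<le> e - a \<and> I (e - j) s') \<and> \<not> holds b s')"
  \<comment> \<open>The measure is the number of rounds left, so the invariant is read backwards
    from \<open>e\<close>.\<close>
  proof (rule run_While[where I = "\<lambda>j s. j \<le> e - a \<and> I (e - j) s"])
    show "e - a \<le> e - a \<and> I (e - (e - a)) s" using assms by simp
    show "run S W P s tb (\<lambda>s'. \<exists>j'<j. j' \<le> e - a \<and> I (e - j') s')"
      if "j \<le> e - a \<and> I (e - j) s" "holds b s" for j s
    proof -
      have j: "e - j < e" "a \<le> e - j" using assms(4)[of "e - j" s] assms(2) that by auto
      have "run S W P s tb (I (Suc (e - j)))" using assms(3) j that by simp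
      then show ?thesis
      proof (rule run_cons)
        fix s' assume "I (Suc (e - j)) s'"
        then show "\<exists>j'<j. j' \<le> e - a \<and> I (e - j') s'"
          using j that by (intro exI[of _ "j - 1"]) (auto simp: Suc_diff_le)
      qed simp
    qed
  qed (use assms in simp)
  fix s' assume *: "(\<exists>j\<le>e - a. I (e - j) s') \<and> \<not> holds b s'"
  then obtain j where j: "j \<le> e - a" "I (e - j) s'" by blast
  then have "\<not> e - j < e" using assms(2) assms(4)[of "e - j" s'] * by auto
  then show "I e s'" using j by (cases "j = 0") (auto simp: not_less)
qed simp

section \<open>Straight-line code and its verification conditions\<close>

fun safe :: "nat \<Rightarrow> nat \<Rightarrow> instr \<Rightarrow> state \<Rightarrow> bool" where
  "safe S W (IConst r z) s \<longleftrightarrow> \<bar>z\<bar> \<le> int W"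
| "safe S W (IAdd r a b) s \<longleftrightarrow> \<bar>ireg s a + ireg s b\<bar> \<le> int W"
| "safe S W (ISub r a b) s \<longleftrightarrow> \<bar>ireg s a - ireg s b\<bar> \<le> int W"
| "safe S W (IMul r a b) s \<longleftrightarrow> \<bar>ireg s a * ireg s b\<bar> \<le> int W"
| "safe S W (IDiv r a b) s \<longleftrightarrow> \<bar>ireg s a div ireg s b\<bar> \<le> int W"
| "safe S W (IMod r a b) s \<longleftrightarrow> \<bar>ireg s a mod ireg s b\<bar> \<le> int W"
| "safe S W (CAdd r a b) s \<longleftrightarrow> \<bar>creg s a + creg s b\<bar> \<le> real W"
| "safe S W (ILoad r a) s \<longleftrightarrow> 0 \<le> ireg s a \<and> ireg s a < int S"
| "safe S W (IStore a b) s \<longleftrightarrow> 0 \<le> ireg s a \<and> ireg s a < int S"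
| "safe S W (CLoad r a) s \<longleftrightarrow> 0 \<le> ireg s a \<and> ireg s a < int S"
| "safe S W (CStore a b) s \<longleftrightarrow> 0 \<le> ireg s a \<and> ireg s a < int S"

lemma safe_exec:
  assumes "safe S W i s" "fits W s"
  shows "exec S W (Do i) s 1 (effect i s)" "fits W (effect i s)"
proof -
  show f: "fits W (effect i s)" using assms unfolding fits_def by (cases i) (simp_all only: effect.simps safe.simps, simp_all)
  show "exec S W (Do i) s 1 (effect i s)"
    by (rule exec.Do) (use assms(1) f in \<open>cases i; auto\<close>)+
qed

primrec block :: "instr list \<Rightarrow> prog" where
  "block [] = Skip"
| "block (i # is) = Seq (Do i) (block is)"

text \<open>The weakest precondition of straight-line code; unfolding it executes the code
  symbolically.\<close>

primrec vc :: "nat \<Rightarrow> nat \<Rightarrow> instr list \<Rightarrow> (state \<Rightarrow> bool) \<Rightarrow> state \<Rightarrow> bool" where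
  "vc S W [] R s \<longleftrightarrow> R s"
| "vc S W (i # is) R s \<longleftrightarrow> safe S W i s \<and> vc S W is R (effect i s)"

lemma run_block:
  assumes "vc S W is R s" "length is + 1 \<le> t"
  shows "run S W (block is) s t R"
  using assms
proof (induction "is" arbitrary: s t)
  case Nil
  then show ?case by (simp add: run_Skip)
next
  case (Cons i "is")
  have "run S W (Do i) s 1 (\<lambda>s'. run S W (block is) s' (t - 1) R)"
    unfolding run_def[of S W "Do i"]
  proof (intro impI exI conjI)
    assume f: "fits W s"
    have i: "safe S W i s" and v: "vc S W is R (effect i s)" using Cons.prems(1) by simp_all
    show "exec S W (Do i) s 1 (effect i s)" "fits W (effect i s)" using safe_exec[OF i f] by blast+
    show "run S W (block is) (effect i s) (t - 1) R" by (rule Cons.IH[OF v]) (use Cons.prems(2) in simp)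
  qed simp
  then show ?case unfolding block.simps by (rule run_Seq) (use Cons.prems(2) in simp)
qed

definition frame :: "reg set \<Rightarrow> reg set \<Rightarrow> state \<Rightarrow> state \<Rightarrow> bool" where
  "frame A B s s' \<longleftrightarrow> imem s' = imem s \<and> cmem s' = cmem s \<and>
     (\<forall>r. r \<notin> A \<longrightarrow> ireg s' r = ireg s r) \<and> (\<forall>r. r \<notin> B \<longrightarrow> creg s' r = creg s r)"

lemma frame_refl: "frame A B s s"
  by (simp add: frame_def)

lemma frame_trans: "frame A B s s' \<Longrightarrow> frame A' B' s' s'' \<Longrightarrow> A \<subseteq> A2 \<Longrightarrow> A' \<subseteq> A2 \<Longrightarrow>
    B \<subseteq> B2 \<Longrightarrow> B' \<subseteq> B2 \<Longrightarrow> frame A2 B2 s s''"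
  unfolding frame_def by (metis subsetD)

lemma frame_mono: "frame A B s s' \<Longrightarrow> A \<subseteq> A2 \<Longrightarrow> B \<subseteq> B2 \<Longrightarrow> frame A2 B2 s s'"
  unfolding frame_def by blast

lemma frameD:
  assumes "frame A B s s'"
  shows "imem s' = imem s" "cmem s' = cmem s" "r \<notin> A \<Longrightarrow> ireg s' r = ireg s r"
    "r \<notin> B \<Longrightarrow> creg s' r = creg s r"
  using assms by (auto simp: frame_def)

text \<open>Register 31 receives the truth value of a condition on all k below register 25; the body decides
  the condition for the k in register 30 by comparing registers 10 and 11.\<close>

abbreviation (input) check_regs :: "reg set" where
  "check_regs \<equiv> insert 30 (insert 31 {10..<20})"

definition check :: "instr list \<Rightarrow> prog" where
  "check body = Seq (block [IConst 31 1, IConst 30 0])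
     (While (ILess 30 25)
       (Seq (block body) (Seq (If (IEq 10 11) Skip (block [IConst 31 0])) (block [IAdd 30 30 21]))))"

text \<open>A round takes \<open>length body + 1\<close> steps for the body, at most 4 for the
  comparison, 2 for the counter and 1 for the test; the initialisation and the last test take
  4.\<close>

lemma run_check:
  assumes "ireg s 25 = int l" "ireg s 21 = 1" "int l < int W"
    and body: "\<And>k s'. k < l \<Longrightarrow> frame check_regs {} s s' \<Longrightarrow> ireg s' 30 = int k \<Longrightarrow>
      vc S W body (\<lambda>s''. frame {10..<20} {} s' s'' \<and> (ireg s'' 10 = ireg s'' 11 \<longleftrightarrow> \<phi> k)) s'"
    and t: "l * (length body + 8) + 4 \<le> t"
  shows "run S W (check body) s t (\<lambda>s'. frame check_regs {} s s' \<and>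
    ireg s' 31 = (if \<forall>k<l. \<phi> k then 1 else 0))"
proof -
  let ?I = "\<lambda>k s'. frame check_regs {} s s' \<and> ireg s' 30 = int k \<and>
      ireg s' 31 = (if \<forall>j<k. \<phi> j then 1 else 0)"
  let ?loop = "While (ILess 30 25)
       (Seq (block body) (Seq (If (IEq 10 11) Skip (block [IConst 31 0])) (block [IAdd 30 30 21])))"
  have W: "1 \<le> W" using assms(3) by simp
  show ?thesis
    unfolding check_def
  proof (rule run_seq)
    show "run S W (block [IConst 31 1, IConst 30 0]) s 3 (?I 0)"
      using W by (intro run_block) (auto simp: frame_def)
    show "run S W ?loop s' (t - 3)
      (\<lambda>s'. frame check_regs {} s s' \<and> ireg s' 31 = (if \<forall>k<l. \<phi> k then 1 else 0))"
      if "?I 0 s'" for s'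
    proof (rule run_cons[OF run_for[where I = ?I and a = 0 and e = l and tb = "length body + 7", OF that]])
      fix j s1 assume j: "j < l" and I: "?I j s1"
      have s1: "ireg s1 25 = int l" "ireg s1 21 = 1" using I assms(1,2) by (auto simp: frameD)
      show "run S W (Seq (block body) (Seq (If (IEq 10 11) Skip (block [IConst 31 0])) (block [IAdd 30 30 21])))
        s1 (length body + 7) (?I (Suc j))"
      proof (rule run_seq[OF run_block[OF body]])
        show "j < l" "frame check_regs {} s s1" "ireg s1 30 = int j" using j I by auto
        show "length body + 1 \<le> length body + 1" by simp
        show "length body + 1 + 6 \<le> length body + 7" by simp
        fix s2 assume a: "frame {10..<20} {} s1 s2 \<and> (ireg s2 10 = ireg s2 11) = \<phi> j"
        have f: "frame check_regs {} s s2"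
          by (rule frame_trans[where s'=s1]) (use a I in auto)
        have r: "ireg s2 30 = int j" "ireg s2 21 = 1" "ireg s2 31 = ireg s1 31"
          using a s1 I by (auto simp: frameD)
        let ?R = "\<lambda>s'. frame check_regs {} s s' \<and> ireg s' 30 = int j \<and>
          ireg s' 21 = 1 \<and> ireg s' 31 = (if \<forall>k<Suc j. \<phi> k then 1 else 0)"
        have "run S W (If (IEq 10 11) Skip (block [IConst 31 0])) s2 4 ?R"
          by (intro run_If[where ?t0.0 = 3] run_Skip run_block;
              use f r a I W in \<open>auto simp: frame_def less_Suc_eq\<close>)
        then show "run S W (Seq (If (IEq 10 11) Skip (block [IConst 31 0])) (block [IAdd 30 30 21])) s2 6 (?I (Suc j))"
          by (rule run_seq[where ?t2.0 = 2]) ((intro run_block; use j assms(3) in \<open>auto simp: frame_def\<close>)+, simp)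
      qed
    qed (use t assms in \<open>auto simp: frame_def algebra_simps\<close>)
  qed (use t in simp_all)
qed

section \<open>The machine state of the dynamic program\<close>

text \<open>
  Integer registers: 0, 20, 36, 37 hold the length \<open>n\<close> of \<open>D\<close>, \<open>N = n + 1\<close>, \<open>N * N\<close> and \<open>2 * N * N\<close>;
  21, 23, 24 the constants 1, 0, 2; 25, 26, 35 the length \<open>l\<close> and the position \<open>i\<close> of the current
  segment and \<open>l + 1\<close>; 28 and 29 the count and the block length of a candidate; 32 and 33 the best
  choice for the segment and for its partitions, with costs in cost registers 6 and 7. Cost
  registers 5, 8, 9, 10 hold 0, \<open>c * Kl\<close>, \<open>l * Kl\<close> and \<open>2 * Kl\<close>. Registers 10 to 19 are scratch.
\<close>

definition body_con :: "instr list" where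
  "body_con = [IAdd 10 26 30, ILoad 10 10, ILoad 11 26, ISub 10 10 11, IAdd 11 30 23]"

definition body_idx :: "instr list" where
  "body_idx = [IMod 12 30 29, IAdd 10 26 30, ILoad 10 10, ISub 11 30 12, IAdd 11 26 11, ILoad 11 11,
     ISub 10 10 11, IAdd 11 26 12, ILoad 11 11, ILoad 12 26, ISub 11 11 12]"

definition body_vec :: "instr list" where
  "body_vec = [IMod 12 30 29, IAdd 10 26 30, ILoad 10 10, IAdd 11 26 12, ILoad 11 11, ISub 10 10 11,
     IAdd 11 26 29, ILoad 11 11, ILoad 12 26, ISub 11 11 12, IDiv 12 30 29, IMul 11 11 12]"

text \<open>With \<open>N = length D + 1\<close>, the memory holds three tables of
  \<open>N * N\<close> cells, a stack of \<open>N\<close> cells and an output of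
  \<open>Q * N\<close> cells, plus a reserve. \<open>4 * N * M\<close> covers the products in the
  test for \<open>Vec\<close>, a difference of at most \<open>2 * M\<close> times a block number;
  \<open>10 * N * Ksum\<close> covers the sum of two table entries and a few constants.\<close>

locale ram = reconstruction +
  fixes S W M :: nat
  assumes nonempty: "D \<noteq> []"
    and S_ge: "(3 * (length D + 1) + 2 + Q) * (length D + 1) + 8 \<le> S"
    and W_S: "S \<le> W"
    and M: "\<And>j. j < length D \<Longrightarrow> \<bar>D ! j\<bar> \<le> int M"
    and W_M: "4 * (length D + 1) * M \<le> W"
    and W_Ksum: "10 * real (length D + 1) * Ksum \<le> real W"
begin

definition N :: nat where "N = length D + 1"
definition NN :: nat where "NN = N * N"

abbreviation n :: nat where "n \<equiv> length D"

text \<open>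
  The numbers \<open>q\<close>, \<open>l\<close>, \<open>i\<close> are the digits of the address to base \<open>N\<close>. The same address is used in both
  memory banks, and it also serves as the stack item for \<open>(q, i, l)\<close> in the second phase.
\<close>

definition addr :: "nat \<Rightarrow> nat \<Rightarrow> nat \<Rightarrow> nat" where
  "addr q i l = l * N + i + q * NN"

lemma n_less_N: "n < N" by (simp add: N_def)
lemma n_pos: "0 < n" using nonempty by simp

lemma S_bounds: "3 * NN + 2 * N + Q * N + 8 \<le> S"
  using S_ge by (simp add: NN_def N_def algebra_simps)

lemma N_le_NN: "N \<le> NN" by (simp add: NN_def N_def)

lemma row_less: "l < N \<Longrightarrow> i < N \<Longrightarrow> l * N + i < NN"
proof -
  assume "l < N" "i < N"
  then show ?thesis unfolding NN_def by (rule index_lt)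
qed

lemma addr_less: "l < N \<Longrightarrow> i < N \<Longrightarrow> q \<le> 2 \<Longrightarrow> addr q i l < 3 * NN"
proof -
  assume a: "l < N" "i < N" "q \<le> 2"
  then have "q * NN \<le> 2 * NN" by (intro mult_le_mono1)
  then show ?thesis using row_less[OF a(1,2)] unfolding addr_def by linarith
qed

text \<open>The input occupies cells that the first table would use for length 0, so filling the
  table leaves it intact.\<close>

lemma addr_ge: "0 < l \<Longrightarrow> n < addr q i l"
proof -
  assume "0 < l"
  then have "N \<le> l * N" by (cases l) auto
  then show ?thesis by (simp add: addr_def N_def)
qed

lemma addr_decode:
  assumes "l < N" "i < N"
  shows "addr q i l mod N = i" "addr q i l div N mod N = l" "addr q i l div N div N = q"
proof -
  have e: "addr q i l = (q * N + l) * N + i" by (simp add: addr_def NN_def algebra_simps)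
  have N: "N > 0" by (simp add: N_def)
  have d: "addr q i l div N = q * N + l" using assms N unfolding e by simp
  show "addr q i l mod N = i" using assms unfolding e by simp
  show "addr q i l div N mod N = l" using assms unfolding d by simp
  show "addr q i l div N div N = q" using assms N unfolding d by simp
qed

lemma addr_inj:
  assumes "l < N" "i < N" "l' < N" "i' < N"
  shows "addr q i l = addr q' i' l' \<longleftrightarrow> q = q' \<and> i = i' \<and> l = l'"
  using addr_decode[OF assms(1,2), of q] addr_decode[OF assms(3,4), of q'] by metis

definition env :: "state \<Rightarrow> bool" where
  "env s \<longleftrightarrow> ireg s 0 = int n \<and> ireg s 20 = int N \<and> ireg s 21 = 1 \<and> ireg s 23 = 0 \<and> ireg s 24 = 2 \<and>
     ireg s 36 = int NN \<and> ireg s 37 = int (2 * NN) \<and>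
     creg s 0 = Kcon K \<and> creg s (Suc 0) = Kvec K \<and> creg s 2 = Kidx K \<and> creg s 3 = Kstrc K \<and>
     creg s 4 = Kl \<and> creg s 5 = 0 \<and> creg s 10 = 2 * Kl \<and> (\<forall>j<n. imem s j = D ! j)"

lemma envD:
  assumes "env s"
  shows "ireg s 0 = int n" "ireg s 20 = int N" "ireg s 21 = 1" "ireg s 23 = 0" "ireg s 24 = 2"
     "ireg s 36 = int NN" "ireg s 37 = int (2 * NN)"
     "creg s 0 = Kcon K" "creg s (Suc 0) = Kvec K" "creg s 2 = Kidx K" "creg s 3 = Kstrc K"
     "creg s 4 = Kl" "creg s 5 = 0" "creg s 10 = 2 * Kl" "j < n \<Longrightarrow> imem s j = D ! j"
  using assms by (auto simp: env_def)

lemma env_frame: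
  assumes "env s" "frame A B s s'"
    "A \<inter> {0, 20, 21, 23, 24, 36, 37} = {}" "B \<inter> {0, Suc 0, 2, 3, 4, 5, 10} = {}"
  shows "env s'"
proof -
  have "ireg s' r = ireg s r" if "r \<in> {0, 20, 21, 23, 24, 36, 37}" for r
    using that assms(2,3) by (auto simp: frame_def)
  moreover have "creg s' r = creg s r" if "r \<in> {0, Suc 0, 2, 3, 4, 5, 10}" for r
    using that assms(2,4) by (auto simp: frame_def)
  ultimately show ?thesis using assms(1) frameD(1)[OF assms(2)] by (simp add: env_def)
qed

lemma D_diff: "i < n \<Longrightarrow> j < n \<Longrightarrow> \<bar>D ! i - D ! j\<bar> \<le> 2 * int M"
  using M[of i] M[of j] by linarith

lemma M_W: "2 * int M \<le> int W"
proof -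
  have "4 * M \<le> 4 * N * M" by (simp add: N_def)
  also have "\<dots> \<le> W" using W_M by (simp add: N_def)
  finally show ?thesis by linarith
qed

lemma N_W: "N < W" "n < S" "n < W"
  using S_bounds W_S n_less_N by auto

lemma D_diff_W: "i < n \<Longrightarrow> j < n \<Longrightarrow> \<bar>D ! i - D ! j\<bar> \<le> int W"
  using D_diff M_W by fastforce

lemma D_mult_W:
  assumes "i < n" "j < n" "k \<le> n"
  shows "\<bar>(D ! i - D ! j) * int k\<bar> \<le> int W"
proof -
  have "\<bar>(D ! i - D ! j) * int k\<bar> = \<bar>D ! i - D ! j\<bar> * int k" by (simp add: abs_mult)
  also have "\<dots> \<le> (2 * int M) * int N"
    using D_diff[OF assms(1,2)] assms(3) n_less_N by (intro mult_mono) auto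
  also have "\<dots> \<le> int (4 * N * M)" by simp
  also have "\<dots> \<le> int W" using W_M unfolding N_def of_nat_le_iff .
  finally show ?thesis .
qed

lemma vc_body_con:
  assumes "env s" "ireg s 26 = int i" "ireg s 30 = int k" "i + k < n"
  shows "vc S W body_con (\<lambda>s'. frame {10..<20} {} s s' \<and>
    (ireg s' 10 = ireg s' 11 \<longleftrightarrow> D ! (i + k) - D ! i = int k)) s"
  using assms D_diff_W[of "i + k" i] N_W
  by (simp add: body_con_def envD nat_int_add frame_def)

lemma vc_body_idx:
  assumes "env s" "ireg s 26 = int i" "ireg s 30 = int k" "ireg s 29 = int m" "i + k < n" "m > 0"
  shows "vc S W body_idx (\<lambda>s'. frame {10..<20} {} s s' \<and>
    (ireg s' 10 = ireg s' 11 \<longleftrightarrow> D ! (i + k) - D ! (i + (k - k mod m)) = D ! (i + k mod m) - D ! i)) s"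
proof -
  \<comment> \<open>With \<open>k = u + r\<close>, where \<open>u\<close> is the start of the block,
    all addresses become sums and no truncated subtraction is left.\<close>
  define r where "r = k mod m"
  define u where "u = k - r"
  have k: "k = u + r" by (simp add: u_def r_def)
  have r: "(int u + int r) mod int m = int r" "(u + r) mod m = r"
    using r_def unfolding k by (simp_all flip: of_nat_add of_nat_mod)
  have "nat (int i + (int u + int r)) = i + (u + r)" by (simp flip: of_nat_add)
  note r = r this
  show ?thesis
    using assms D_diff_W[of "i + (u + r)" "i + u"] D_diff_W[of "i + r" "i"] N_W r unfolding k
    by (simp add: body_idx_def envD nat_int_add frame_def add.assoc)
qed

lemma vc_body_vec:
  assumes "env s" "ireg s 26 = int i" "ireg s 30 = int k" "ireg s 29 = int m" "i + k < n" "m > 0" "i + m < n"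
  shows "vc S W body_vec (\<lambda>s'. frame {10..<20} {} s s' \<and>
    (ireg s' 10 = ireg s' 11 \<longleftrightarrow> D ! (i + k) - D ! (i + k mod m) = int (k div m) * (D ! (i + m) - D ! i))) s"
proof -
  define r where "r = k mod m"
  define u where "u = k div m"
  have r: "int k mod int m = int r" "int k div int m = int u" "r \<le> k" "u \<le> k"
    by (simp_all add: r_def u_def zmod_int zdiv_int)
  show ?thesis
    unfolding r_def[symmetric] u_def[symmetric]
    using assms D_diff_W[of "i + k" "i + r"] D_diff_W[of "i + m" "i"] N_W r D_mult_W[of "i + m" i u]
    by (simp add: body_vec_def envD nat_int_add frame_def mult.commute)
qed

end

section \<open>Candidates for a cell of the table\<close>

text \<open>Makes the bounds of the current state available: a number that is merely copied is
  bounded whatever its value.\<close>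

lemma run_fits: "(fits W s \<Longrightarrow> run S W P s t R) \<Longrightarrow> run S W P s t R"
  by (simp add: run_def)

text \<open>Registers 23, 36 and 37 hold 0, \<open>NN\<close> and \<open>2 * NN\<close>, so this is
  the register with the value \<open>q * NN\<close>.\<close>

definition off :: "nat \<Rightarrow> reg" where
  "off q = (if q = 0 then 23 else if q = 1 then 36 else 37)"

definition addr_code :: "reg \<Rightarrow> nat \<Rightarrow> instr list" where
  "addr_code m q = [IMul 10 m 20, IAdd 10 10 26, IAdd 10 10 (off q)]"

text \<open>There is no move instruction; adding the zero in cost register 5 or in integer register
  23 copies a number. The candidate has its cost in cost register 11 and its code in integer
  register 10.\<close>

definition update_best :: prog where
  "update_best = If (CLess 11 6) (block [CAdd 6 11 5, IAdd 32 10 23]) Skip"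

definition try_candidate :: "instr list \<Rightarrow> prog" where
  "try_candidate is = If (IEq 31 21) (Seq (block is) update_best) Skip"

definition idx_code :: "instr list" where
  "idx_code = addr_code 29 0 @ [CLoad 11 10, CAdd 11 11 8, CAdd 11 11 2, IMul 10 28 24, IAdd 10 10 21]"

definition vec_code :: "nat \<Rightarrow> instr list" where
  "vec_code q = addr_code 29 q @ [CLoad 11 10, CAdd 11 11 1, IMul 10 28 24]"

definition candidates :: "nat \<Rightarrow> prog" where
  "candidates q = Seq (block [IDiv 29 25 28]) (Seq (check body_idx) (Seq (try_candidate idx_code)
     (Seq (check body_vec) (try_candidate (vec_code q)))))"

text \<open>A cost cannot be multiplied by a count. Cost register 8 starts at \<open>2 * Kl\<close>
  and gains \<open>Kl\<close> per round, so it holds \<open>c * Kl\<close> for the count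
  \<open>c\<close> under test.\<close>

definition cand_loop :: "nat \<Rightarrow> prog" where
  "cand_loop q = Seq (block [IConst 28 2, CAdd 8 10 5]) (While (ILess 28 35)
     (Seq (block [IMod 10 25 28]) (Seq (If (IEq 10 23) (candidates q) Skip)
       (block [CAdd 8 8 4, IAdd 28 28 21]))))"

definition stage :: "nat \<Rightarrow> prog" where
  "stage q = Seq (Seq (block [CAdd 11 3 7, IConst 10 1]) update_best) (cand_loop q)"

context ram
begin

text \<open>The unit for cost bounds: table entries are at most \<open>3 * U\<close>, single
  constants and \<open>c * Kl\<close> at most \<open>U\<close>, and every sum that is formed stays
  below \<open>10 * U\<close>.\<close>

definition U :: real where "U = real N * Ksum"

lemma U_W: "10 * U \<le> real W"
  using W_Ksum by (simp add: U_def N_def algebra_simps)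

lemma Ksum_U: "Ksum \<le> U"
  using Ksum_pos by (simp add: U_def N_def)

lemma K_U: "Kcon K \<le> U" "Kvec K \<le> U" "Kidx K \<le> U" "Kstrc K \<le> U" "Kl \<le> U" "0 < U"
  using Ksum_U pos by (simp_all add: Ksum_def)

lemma mult_Kl_U: "c \<le> N \<Longrightarrow> real c * Kl \<le> U"
  unfolding U_def using pos by (intro mult_mono) (auto simp: Ksum_def)

lemma V_U:
  assumes "0 < l" "l \<le> n" "q \<le> 2"
  shows "0 \<le> V q i l" "V q i l \<le> 3 * U"
proof -
  have "V q i l \<le> (real l + 3) * Ksum" using V_le_Ksum assms by simp
  also have "\<dots> \<le> (3 * real N) * Ksum"
    using Ksum_pos assms n_less_N by (intro mult_right_mono) auto
  finally show "V q i l \<le> 3 * U" by (simp add: U_def)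
  show "0 \<le> V q i l" using V_nonneg assms by simp
qed

lemma first_U:
  assumes "0 < l" "l \<le> n"
  shows "0 \<le> fst (first i l)" "fst (first i l) \<le> U"
proof -
  have "fst (first i l) \<le> (real l + 1) * Ksum" using first_le_Ksum assms by simp
  also have "\<dots> \<le> real N * Ksum" using Ksum_pos assms n_less_N by (intro mult_right_mono) auto
  finally show "fst (first i l) \<le> U" by (simp add: U_def)
  show "0 \<le> fst (first i l)" using pos by (simp add: first_def)
qed

text \<open>\<open>P\<close> describes which cells have been filled so far.\<close>

definition tables :: "(nat \<Rightarrow> nat \<Rightarrow> nat \<Rightarrow> bool) \<Rightarrow> state \<Rightarrow> bool" where
  "tables P s \<longleftrightarrow> (\<forall>q\<le>2. \<forall>i l. 0 < l \<longrightarrow> i + l \<le> n \<longrightarrow> P q i l \<longrightarrow>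
     cmem s (addr q i l) = V q i l \<and> imem s (addr q i l) = int (C q i l))"

definition cellenv :: "nat \<Rightarrow> nat \<Rightarrow> state \<Rightarrow> bool" where
  "cellenv i l s \<longleftrightarrow> env s \<and> ireg s 25 = int l \<and> ireg s 26 = int i \<and> ireg s 35 = int l + 1 \<and>
     0 < l \<and> i + l \<le> n \<and> tables (\<lambda>q' i' l'. l' < l) s"

lemma cellenvD:
  assumes "cellenv i l s"
  shows "env s" "ireg s 25 = int l" "ireg s 26 = int i" "ireg s 35 = int l + 1" "0 < l" "i + l \<le> n"
    "i < N" "l < N" "q \<le> 2 \<Longrightarrow> 0 < l' \<Longrightarrow> l' < l \<Longrightarrow> i' + l' \<le> n \<Longrightarrow> cmem s (addr q i' l') = V q i' l'"
  using assms by (auto simp: cellenv_def tables_def N_def)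

lemma cellenv_frame:
  assumes "cellenv i l s" "frame A B s s'"
    "A \<inter> {0, 20, 21, 23, 24, 36, 37, 25, 26, 35} = {}" "B \<inter> {0, Suc 0, 2, 3, 4, 5, 10} = {}"
  shows "cellenv i l s'"
proof -
  have "env s'" by (rule env_frame[OF cellenvD(1)[OF assms(1)] assms(2)]) (use assms(3,4) in auto)
  moreover have "ireg s' r = ireg s r" if "r \<in> {25, 26, 35}" for r
    using that assms(2,3) by (auto simp: frame_def)
  ultimately show ?thesis using assms(1) frameD(1,2)[OF assms(2)] by (auto simp: cellenv_def tables_def)
qed

lemma vc_addr:
  assumes "env s" "ireg s 26 = int i" "ireg s m = int l" "l < N" "i < N" "q \<le> 2"
    and "vc S W is R (s\<lparr>ireg := (ireg s)(10 := int (addr q i l))\<rparr>)"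
  shows "vc S W (addr_code m q @ is) R s"
proof -
  have a: "int l * int N + int i + int (q * NN) = int (addr q i l)" by (simp add: addr_def)
  have "addr q i l < S" using addr_less[OF assms(4,5,6)] S_bounds by simp
  then have "int (addr q i l) \<le> int W" using W_S by simp
  then have "int (l * N) \<le> int W" "int (l * N + i) \<le> int W"
    unfolding addr_def of_nat_le_iff by linarith+
  then have b: "int l * int N \<le> int W" "int l * int N + int i \<le> int W" by simp_all
  have o: "ireg (s\<lparr>ireg := (ireg s)(10 := x)\<rparr>) (off q) = int (q * NN)" for x
    using assms(1,6) by (cases q) (auto simp: off_def envD numeral_2_eq_2 le_Suc_eq)
  show ?thesis
    using assms a b \<open>int (addr q i l) \<le> int W\<close> o
    by (simp add: addr_code_def envD)
qed

definition best :: "real \<times> nat \<Rightarrow> state \<Rightarrow> bool" where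
  "best x s \<longleftrightarrow> creg s 6 = fst x \<and> ireg s 32 = int (snd x)"

lemma best_frame:
  "best x s \<Longrightarrow> frame A B s s' \<Longrightarrow> 32 \<notin> A \<Longrightarrow> 6 \<notin> B \<Longrightarrow> best x s'"
  by (simp add: best_def frameD)

lemma run_update_best:
  assumes "env s" "creg s 11 = v" "ireg s 10 = int c" "best x s"
  shows "run S W update_best s 4 (\<lambda>s'. frame {32} {6} s s' \<and> best (improve True v c x) s')"
proof (rule run_fits)
  assume "fits W s"
  then have "\<bar>creg s 11\<bar> \<le> real W" "\<bar>ireg s 10\<bar> \<le> int W" by (auto simp: fits_def)
  then show ?thesis
    unfolding update_best_def
    by (intro run_If[where ?t0.0 = 3] run_block run_Skip;
        use assms in \<open>simp add: envD best_def frame_def improve_def\<close>)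
qed

lemma run_try:
  assumes "env s" "ireg s 31 = (if b then 1 else 0)" "best x s" "length is \<le> 8"
    "vc S W is (\<lambda>s'. frame {10..<20} {11} s s' \<and> creg s' 11 = v \<and> ireg s' 10 = int c) s"
  shows "run S W (try_candidate is) s 15 (\<lambda>s'. frame (insert 32 {10..<20}) {6, 11} s s' \<and>
    best (improve b v c x) s')" (is "run _ _ _ _ _ ?R")
  unfolding try_candidate_def
proof (rule run_If[where ?t0.0 = 14])
  assume "holds (IEq 31 21) s"
  then have b: b using assms(1,2) by (simp add: envD split: if_splits)
  show "run S W (Seq (block is) update_best) s 14 ?R"
  proof (rule run_seq[OF run_block[OF assms(5) order_refl], where ?t2.0 = 4])
    fix s' assume s': "frame {10..<20} {11} s s' \<and> creg s' 11 = v \<and> ireg s' 10 = int c"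
    have "run S W update_best s' 4 (\<lambda>s''. frame {32} {6} s' s'' \<and> best (improve True v c x) s'')"
      by (rule run_update_best) (use s' env_frame[OF assms(1)] best_frame[OF assms(3)] in auto)
    then show "run S W update_best s' 4 ?R"
      by (rule run_cons) (use s' b in \<open>auto intro: frame_trans[of _ _ s s']\<close>)
  qed (use assms(4) in simp)
next
  assume "\<not> holds (IEq 31 21) s"
  then show "run S W Skip s 14 ?R"
    using assms by (intro run_Skip) (auto simp: envD improve_def frame_refl split: if_splits)
qed simp

lemma run_try_idx:
  assumes "cellenv i l s" "ireg s 28 = int c" "ireg s 29 = int m" "creg s 8 = real c * Kl" "0 < m" "m < l"
    "c \<le> l" "ireg s 31 = (if b then 1 else 0)" "best x s"
  shows "run S W (try_candidate idx_code) s 15 (\<lambda>s'. frame (insert 32 {10..<20}) {6, 11} s s' \<and>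
    best (improve b (Kidx K + real c * Kl + V 0 i m) (2 * c + 1) x) s')"
proof (rule run_try)
  note e = cellenvD[OF assms(1)]
  have le: "V 0 i m + (real c * Kl + Kidx K) \<le> W" "V 0 i m + real c * Kl \<le> W" "0 \<le> real c * Kl" "0 \<le> V 0 i m"
    using V_U[of m 0 i] K_U U_W mult_Kl_U[of c] pos assms e by auto
  have cW: "2 * int c + 1 \<le> int W" using S_bounds W_S assms(7) e(8) by linarith
  have "addr 0 i m < S" using addr_less[of m i 0] S_bounds assms e by simp
  then show "vc S W idx_code (\<lambda>s'. frame {10..<20} {11} s s' \<and>
      creg s' 11 = Kidx K + real c * Kl + V 0 i m \<and> ireg s' 10 = int (2 * c + 1)) s"
    unfolding idx_code_def using assms e le cW pos
    by (intro vc_addr[where l = m and i = i]) (auto simp: envD frame_def algebra_simps)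
qed (use assms cellenvD in \<open>auto simp: idx_code_def addr_code_def\<close>)

lemma run_try_vec:
  assumes "cellenv i l s" "ireg s 28 = int c" "ireg s 29 = int m" "0 < m" "m < l"
    "c \<le> l" "ireg s 31 = (if b then 1 else 0)" "best x s" "q < 2"
  shows "run S W (try_candidate (vec_code q)) s 15 (\<lambda>s'. frame (insert 32 {10..<20}) {6, 11} s s' \<and>
    best (improve b (Kvec K + V q i m) (2 * c) x) s')"
proof (rule run_try)
  note e = cellenvD[OF assms(1)]
  have le: "V q i m + Kvec K \<le> W" "0 \<le> V q i m"
    using V_U[of m q i] K_U U_W pos assms e by auto
  have cW: "2 * int c \<le> int W" using S_bounds W_S assms(6) e(8) by linarith
  have "addr q i m < S" using addr_less[of m i q] S_bounds assms e by simp
  then show "vc S W (vec_code q) (\<lambda>s'. frame {10..<20} {11} s s' \<and>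
      creg s' 11 = Kvec K + V q i m \<and> ireg s' 10 = int (2 * c)) s"
    unfolding vec_code_def using assms e le cW pos
    by (intro vc_addr[where l = m and i = i]) (auto simp: envD frame_def algebra_simps)
qed (use assms cellenvD in \<open>auto simp: vec_code_def addr_code_def\<close>)

lemma run_cell_check:
  assumes "cellenv i l s" "length body \<le> 15"
    and "\<And>k s'. k < l \<Longrightarrow> env s' \<Longrightarrow> ireg s' 26 = int i \<Longrightarrow> ireg s' 30 = int k \<Longrightarrow> ireg s' 29 = ireg s 29 \<Longrightarrow>
      vc S W body (\<lambda>s''. frame {10..<20} {} s' s'' \<and> (ireg s'' 10 = ireg s'' 11 \<longleftrightarrow> \<phi> k)) s'"
  shows "run S W (check body) s (24 * N) (\<lambda>s'. frame check_regs {} s s' \<and>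
    ireg s' 31 = (if \<forall>k<l. \<phi> k then 1 else 0))"
proof (rule run_check)
  note e = cellenvD[OF assms(1)]
  show "ireg s 25 = int l" "ireg s 21 = 1" "int l < int W" using e N_W by (auto simp: envD)
  have "l * (length body + 8) \<le> l * 23" using assms(2) by (intro mult_le_mono2) simp
  then show "l * (length body + 8) + 4 \<le> 24 * N" using e(8) by linarith
  fix k s' assume k: "k < l" and f: "frame check_regs {} s s'" "ireg s' 30 = int k"
  show "vc S W body (\<lambda>s''. frame {10..<20} {} s' s'' \<and> (ireg s'' 10 = ireg s'' 11 \<longleftrightarrow> \<phi> k)) s'"
    by (rule assms(3)[OF k]) (use e f env_frame[OF e(1) f(1)] in \<open>auto simp: frameD(3)[OF f(1)]\<close>)
qed

lemma run_check_idx: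
  assumes "cellenv i l s" "ireg s 29 = int m" "0 < m" "m < l"
  shows "run S W (check body_idx) s (24 * N) (\<lambda>s'. frame check_regs {} s s' \<and>
    ireg s' 31 = (if idxc i l m then 1 else 0))"
  unfolding idxc_def using assms cellenvD(6)[OF assms(1)]
  by (intro run_cell_check vc_body_idx) (auto simp: body_idx_def)

lemma run_check_vec:
  assumes "cellenv i l s" "ireg s 29 = int m" "0 < m" "m < l"
  shows "run S W (check body_vec) s (24 * N) (\<lambda>s'. frame check_regs {} s s' \<and>
    ireg s' 31 = (if vecc i l m then 1 else 0))"
  unfolding vecc_def using assms cellenvD(6)[OF assms(1)]
  by (intro run_cell_check vc_body_vec) (auto simp: body_vec_def)

lemma run_check_con:
  assumes "cellenv i l s"
  shows "run S W (check body_con) s (24 * N) (\<lambda>s'. frame check_regs {} s s' \<and>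
    ireg s' 31 = (if consec i l then 1 else 0))"
  unfolding consec_def using assms cellenvD(6)[OF assms]
  by (intro run_cell_check vc_body_con) (auto simp: body_con_def)

end

section \<open>Filling one cell\<close>

definition split_loop :: prog where
  "split_loop = While (ILess 29 25) (Seq (block (addr_code 29 0 @
     [CLoad 11 10, CAdd 11 11 10, ISub 12 25 29, IMul 12 12 20, IAdd 12 12 26, IAdd 12 12 29,
      IAdd 12 12 37, CLoad 12 12, CAdd 11 11 12]))
     (Seq (If (CLess 11 7) (block [CAdd 7 11 5, IAdd 33 29 23]) Skip) (block [IAdd 29 29 21])))"

definition store :: "nat \<Rightarrow> reg \<Rightarrow> reg \<Rightarrow> prog" where
  "store q rc ri = block (addr_code 25 q @ [CStore 10 rc, IStore 10 ri])"

text \<open>The counterpart of \<open>frame\<close> for code that writes to memory.\<close>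

definition rframe :: "reg set \<Rightarrow> reg set \<Rightarrow> state \<Rightarrow> state \<Rightarrow> bool" where
  "rframe A B s s' \<longleftrightarrow>
     (\<forall>r. r \<notin> A \<longrightarrow> ireg s' r = ireg s r) \<and> (\<forall>r. r \<notin> B \<longrightarrow> creg s' r = creg s r)"

lemma frame_rframe: "frame A B s s' \<Longrightarrow> rframe A B s s'"
  by (simp add: frame_def rframe_def)

lemma rframe_trans: "rframe A B s s' \<Longrightarrow> rframe A' B' s' s'' \<Longrightarrow> A \<subseteq> A2 \<Longrightarrow> A' \<subseteq> A2 \<Longrightarrow>
    B \<subseteq> B2 \<Longrightarrow> B' \<subseteq> B2 \<Longrightarrow> rframe A2 B2 s s''"
  unfolding rframe_def by (metis subsetD)

lemma rframeD:
  assumes "rframe A B s s'"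
  shows "r \<notin> A \<Longrightarrow> ireg s' r = ireg s r" "r \<notin> B \<Longrightarrow> creg s' r = creg s r"
  using assms by (auto simp: rframe_def)

definition cell_first :: prog where
  "cell_first = Seq (check body_con)
     (Seq (block [CAdd 6 2 9, CAdd 6 6 0, IMul 32 24 25, IAdd 32 32 21])
     (If (IEq 31 21) (block [CAdd 6 0 5, IConst 32 0]) Skip))"

definition cell_split :: prog where
  "cell_split = Seq (block [CAdd 7 6 10, IAdd 33 25 23, IConst 29 1]) split_loop"

definition cell_split_end :: prog where
  "cell_split_end = Seq (block [CAdd 11 6 10])
     (If (CLess 7 11) Skip (block [CAdd 7 11 5, IAdd 33 25 23]))"

text \<open>The order follows the dependencies within a cell: \<open>V 0\<close>, the corrected
  \<open>V 2\<close>, then \<open>V 1\<close>. After the second store cost register 6 still holds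
  \<open>V 0 i l\<close>; adding \<open>Kidx K\<close> and \<open>Kl\<close> turns it into the start
  value for \<open>V 1\<close>.\<close>

definition cell_prog :: prog where
  "cell_prog = Seq cell_first (Seq cell_split (Seq (stage 0) (Seq (store 0 6 32)
     (Seq cell_split_end (Seq (store 2 7 33)
     (Seq (block [CAdd 6 6 2, CAdd 6 6 4, IConst 32 3])
     (Seq (stage 1) (store 1 6 32))))))))"

context ram
begin

lemma run_candidates:
  assumes "cellenv i l s" "ireg s 28 = int c" "creg s 8 = real c * Kl" "2 \<le> c" "c \<le> l" "l mod c = 0"
    "best x s" "q < 2"
  shows "run S W (candidates q) s (80 * N) (\<lambda>s'. frame ({10..<20} \<union> {29..<33}) {6, 11} s s' \<and>
    best (improve (l mod c = 0 \<and> vecc i l (l div c)) (Kvec K + V q i (l div c)) (2 * c)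
      (improve (l mod c = 0 \<and> idxc i l (l div c)) (Kidx K + real c * Kl + V 0 i (l div c)) (2 * c + 1) x)) s')"
proof -
  define m where "m = l div c"
  have "c * m = l" using assms(6) by (auto simp: m_def)
  then have m0: "0 < m" using assms(1) by (auto simp: cellenv_def intro: gr0I)
  have "1 * m < c * m" using m0 assms(4) by (intro mult_strict_right_mono) auto
  then have ml: "m < l" using \<open>c * m = l\<close> by simp
  note e = cellenvD[OF assms(1)]
  have N: "2 \<le> N" using e by (simp add: N_def)
  have lm: "l mod c = 0" using assms by simp
  let ?x1 = "improve (idxc i l m) (Kidx K + real c * Kl + V 0 i m) (2 * c + 1) x"
  let ?x2 = "improve (vecc i l m) (Kvec K + V q i m) (2 * c) ?x1"
  let ?F = "frame ({10..<20} \<union> {29..<33}) {6, 11}"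
  have cm: "int l div int c = int m" by (simp add: m_def zdiv_int)
  show ?thesis
    unfolding candidates_def m_def[symmetric] lm simp_thms
  proof (rule run_seq[where ?t1.0 = 2 and ?t2.0 = "79 * N"])
    show "run S W (block [IDiv 29 25 28]) s 2 (\<lambda>s'. frame {29} {} s s' \<and> ireg s' 29 = int m)"
      by (rule run_block) (use assms(2) e ml N_W cm in \<open>auto simp: frame_def\<close>)
    fix s1 assume s1: "frame {29} {} s s1 \<and> ireg s1 29 = int m"
    have c1: "cellenv i l s1" using cellenv_frame[OF assms(1)] s1 by auto
    have b1: "best x s1" using best_frame[OF assms(7)] s1 by auto
    show "run S W (Seq (check body_idx) (Seq (try_candidate idx_code) (Seq (check body_vec) (try_candidate (vec_code q))))) s1 (79 * N)
        (\<lambda>s'. ?F s s' \<and> best ?x2 s')"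
    proof (rule run_seq[OF run_check_idx[OF c1 _ m0 ml]])
      fix s2 assume s2: "frame check_regs {} s1 s2 \<and>
        ireg s2 31 = (if idxc i l m then 1 else 0)"
      have c2: "cellenv i l s2" using cellenv_frame[OF c1] s2 by auto
      have b2: "best x s2" using best_frame[OF b1] s2 by auto
      have r2: "ireg s2 28 = int c" "ireg s2 29 = int m" "creg s2 8 = real c * Kl"
        using s1 s2 assms(2,3) by (auto simp: frameD)
      have f2: "?F s s2" by (rule frame_trans[of _ _ s s1]) (use s1 s2 in auto)
      show "run S W (Seq (try_candidate idx_code) (Seq (check body_vec) (try_candidate (vec_code q)))) s2 (55 * N)
        (\<lambda>s'. ?F s s' \<and> best ?x2 s')"
      proof (rule run_seq[OF run_try_idx[OF c2 r2 m0 ml assms(5) _ b2]])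
        show "ireg s2 31 = (if idxc i l m then 1 else 0)" using s2 by simp
        fix s3 assume s3: "frame (insert 32 {10..<20}) {6, 11} s2 s3 \<and> best ?x1 s3"
        have c3: "cellenv i l s3" using cellenv_frame[OF c2] s3 by auto
        have r3: "ireg s3 28 = int c" "ireg s3 29 = int m" using s3 r2 by (auto simp: frameD)
        have f3: "?F s s3" by (rule frame_trans[of _ _ s s2]) (use s3 f2 in auto)
        show "run S W (Seq (check body_vec) (try_candidate (vec_code q))) s3 (40 * N) (\<lambda>s'. ?F s s' \<and> best ?x2 s')"
        proof (rule run_seq[OF run_check_vec[OF c3 r3(2) m0 ml]])
          fix s4 assume s4: "frame check_regs {} s3 s4 \<and>
            ireg s4 31 = (if vecc i l m then 1 else 0)"
          have c4: "cellenv i l s4" using cellenv_frame[OF c3] s4 by auto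
          have b4: "best ?x1 s4" using best_frame[of ?x1 s3] s3 s4 by auto
          have r4: "ireg s4 28 = int c" "ireg s4 29 = int m" using s4 r3 by (auto simp: frameD)
          have f4: "?F s s4" by (rule frame_trans[of _ _ s s3]) (use s4 f3 in auto)
          have v4: "ireg s4 31 = (if vecc i l m then 1 else 0)" using s4 by simp
          show "run S W (try_candidate (vec_code q)) s4 15 (\<lambda>s'. ?F s s' \<and> best ?x2 s')"
          proof (rule run_cons[OF run_try_vec[OF c4 r4 m0 ml assms(5) v4 b4 assms(8)]])
            fix s5 assume s5: "frame (insert 32 {10..<20}) {6, 11} s4 s5 \<and> best ?x2 s5"
            have "?F s s5" by (rule frame_trans[of _ _ s s4]) (use s5 f4 in auto)
            then show "?F s s5 \<and> best ?x2 s5" using s5 by simp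
          qed simp
        qed (use N in simp)
      qed (use N in simp)
    qed (use s1 N in auto)
  qed (use N in simp)
qed

lemma run_cand_loop:
  assumes "cellenv i l s" "best x s" "q < 2"
  shows "run S W (cand_loop q) s (90 * N * N) (\<lambda>s'. frame ({10..<20} \<union> {28..<33}) {6, 8, 11} s s' \<and>
    best (cloop V q i l x (l - 1)) s')"
proof -
  note e = cellenvD[OF assms(1)]
  have N: "2 \<le> N" using e by (simp add: N_def)
  let ?F = "frame ({10..<20} \<union> {28..<33}) {6, 8, 11}"
  \<comment> \<open>Counts start at 2, so \<open>c - 2\<close> steps of \<open>cloop\<close> are
    done before count \<open>c\<close> is tried.\<close>
  let ?I = "\<lambda>c s'. ?F s s' \<and> ireg s' 28 = int c \<and> creg s' 8 = real c * Kl \<and> best (cloop V q i l x (c - 2)) s'"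
  let ?body = "Seq (block [IMod 10 25 28]) (Seq (If (IEq 10 23) (candidates q) Skip)
       (block [CAdd 8 8 4, IAdd 28 28 21]))"
  have "N * 2 \<le> N * N" "4 \<le> N * N" using N mult_le_mono[OF N N] by auto
  moreover have "N * (80 * N + 7) = 80 * (N * N) + 7 * N" "90 * N * N = 90 * (N * N)"
    by (simp_all add: algebra_simps)
  ultimately have arith: "3 + (N * (80 * N + 7) + 1) \<le> 90 * N * N" by linarith
  show ?thesis
    unfolding cand_loop_def
  proof (rule run_seq[where ?R1.0 = "?I 2" and ?t1.0 = 3])
    show "run S W (block [IConst 28 2, CAdd 8 10 5]) s 3 (?I 2)"
      using K_U U_W N N_W assms e pos by (intro run_block) (auto simp: envD frame_def best_def)
    fix s1 assume I: "?I 2 s1"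
    show "run S W (While (ILess 28 35) ?body) s1 (N * (80 * N + 7) + 1)
       (\<lambda>s'. ?F s s' \<and> best (cloop V q i l x (l - 1)) s')"
    proof (rule run_cons[OF run_for[where I = ?I and a = 2 and e = "l + 1" and tb = "80 * N + 6", OF I]])
      show "2 \<le> l + 1" using e by simp
      show "(l + 1 - 2) * (80 * N + 6 + 1) + 1 \<le> N * (80 * N + 7) + 1"
        by (intro add_le_mono1 mult_le_mono) (use e in auto)
      show "holds (ILess 28 35) s'  \<longleftrightarrow> c < l + 1" if "?I c s'" for c s'
        using that e by (auto simp: frameD)
      show "?F s s' \<and> best (cloop V q i l x (l - 1)) s'" if "?I (l + 1) s'" for s'
        using that by simp
      fix c s1 assume c: "2 \<le> c" "c < l + 1" and I: "?I c s1"
      let ?x = "cloop V q i l x (c - 2)" and ?y = "cloop V q i l x (Suc c - 2)"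
      have y: "?y = improve (l mod c = 0 \<and> vecc i l (l div c)) (Kvec K + V q i (l div c)) (2 * c)
        (improve (l mod c = 0 \<and> idxc i l (l div c)) (Kidx K + real c * Kl + V 0 i (l div c)) (2 * c + 1) ?x)"
        using c(1) by (cases c; cases "c - 1") (auto simp: algebra_simps)
      have c1: "cellenv i l s1" using cellenv_frame[OF assms(1)] I by auto
      note e1 = cellenvD[OF c1]
      show "run S W ?body s1 (80 * N + 6) (?I (Suc c))"
      proof (rule run_seq[where ?t1.0 = 2 and ?t2.0 = "80 * N + 4"])
        have "int l mod int c = int (l mod c)" by (simp add: zmod_int)
        moreover have "l mod c \<le> W" using le_trans[OF mod_less_eq_dividend[of l c]] e N_W by simp
        ultimately show "run S W (block [IMod 10 25 28]) s1 2 (\<lambda>s'. frame {10} {} s1 s' \<and> ireg s' 10 = int (l mod c))"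
          using I e1 N_W by (intro run_block) (auto simp: frame_def)
        fix s2 assume s2: "frame {10} {} s1 s2 \<and> ireg s2 10 = int (l mod c)"
        have c2: "cellenv i l s2" using cellenv_frame[OF c1] s2 by auto
        have b2: "best ?x s2" using best_frame[of ?x s1] I s2 by auto
        have r2: "ireg s2 28 = int c" "creg s2 8 = real c * Kl"
          using I s2 by (auto simp: frameD)
        have f2: "?F s s2" by (rule frame_trans[of _ _ s s1]) (use s2 I in auto)
        show "run S W (Seq (If (IEq 10 23) (candidates q) Skip) (block [CAdd 8 8 4, IAdd 28 28 21])) s2
          (80 * N + 4) (?I (Suc c))"
        proof (rule run_seq[where ?t1.0 = "80 * N + 1" and ?t2.0 = 3])
          show "run S W (If (IEq 10 23) (candidates q) Skip) s2 (80 * N + 1)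
            (\<lambda>s'. frame ({10..<20} \<union> {29..<33}) {6, 11} s2 s' \<and> best ?y s')"
          proof (rule run_If[where ?t0.0 = "80 * N"])
            assume "holds (IEq 10 23) s2"
            then have "l mod c = 0" using s2 cellenvD(1)[OF c2] by (simp add: envD)
            then show "run S W (candidates q) s2 (80 * N) (\<lambda>s'. frame ({10..<20} \<union> {29..<33}) {6, 11} s2 s' \<and> best ?y s')"
              unfolding y using c by (intro run_candidates c2 r2 b2 assms(3)) auto
          next
            assume "\<not> holds (IEq 10 23) s2"
            then have "l mod c \<noteq> 0" using s2 cellenvD(1)[OF c2] by (simp add: envD)
            then have "?y = ?x" unfolding y by (simp add: improve_def)
            then show "run S W Skip s2 (80 * N) (\<lambda>s'. frame ({10..<20} \<union> {29..<33}) {6, 11} s2 s' \<and> best ?y s')"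
              using b2 N by (intro run_Skip) (auto simp: frame_refl)
          qed simp
          fix s3 assume s3: "frame ({10..<20} \<union> {29..<33}) {6, 11} s2 s3 \<and> best ?y s3"
          have f3: "?F s s3" by (rule frame_trans[of _ _ s s2]) (use s3 f2 in auto)
          have c3: "cellenv i l s3" using cellenv_frame[OF assms(1)] f3 by auto
          have r3: "ireg s3 28 = int c" "creg s3 8 = real c * Kl"
            using r2 s3 by (auto simp: frameD)
          have "real (Suc c) * Kl \<le> U" using mult_Kl_U[of "Suc c"] c e by simp
          then have u: "real c * Kl + Kl \<le> U" "0 \<le> real c * Kl + Kl" using pos by (auto simp: algebra_simps)
          have "int c + 1 \<le> int W" using c e N_W by linarith
          then show "run S W (block [CAdd 8 8 4, IAdd 28 28 21]) s3 3 (?I (Suc c))"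
            using u U_W K_U s3 f3 r3 cellenvD(1)[OF c3]
            by (intro run_block) (auto simp: frame_def best_def envD algebra_simps)
        qed simp
      qed simp
    qed simp
  qed (use arith in linarith)
qed

lemma run_stage:
  assumes "cellenv i l s" "best x s" "q < 2" "creg s 7 = p" "0 \<le> p" "p \<le> 3 * U"
  shows "run S W (stage q) s (100 * N * N) (\<lambda>s'. frame ({10..<20} \<union> {28..<33}) {6, 8, 11} s s' \<and>
    best (cloop V q i l (improve True (Kstrc K + p) 1 x) (l - 1)) s')"
proof -
  note e = cellenvD[OF assms(1)]
  have N: "2 \<le> N" using e by (simp add: N_def)
  let ?F = "frame ({10..<20} \<union> {28..<33}) {6, 8, 11}"
  let ?y = "improve True (Kstrc K + p) 1 x"
  have N4: "4 \<le> N * N" using mult_le_mono[OF N N] by auto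
  show ?thesis
    unfolding stage_def
  proof (rule run_seq[where ?t1.0 = 7 and ?t2.0 = "90 * N * N"])
    show "run S W (Seq (block [CAdd 11 3 7, IConst 10 1]) update_best) s 7
      (\<lambda>s'. frame {10, 32} {6, 11} s s' \<and> best ?y s')"
    proof (rule run_seq[where ?t1.0 = 3 and ?t2.0 = 4])
      show "run S W (block [CAdd 11 3 7, IConst 10 1]) s 3
        (\<lambda>s'. frame {10} {11} s s' \<and> creg s' 11 = Kstrc K + p \<and> ireg s' 10 = int 1)"
        using assms K_U U_W N_W pos e by (intro run_block) (auto simp: envD frame_def)
      fix s1 assume s1: "frame {10} {11} s s1 \<and> creg s1 11 = Kstrc K + p \<and> ireg s1 10 = int 1"
      have "cellenv i l s1" using cellenv_frame[OF assms(1)] s1 by auto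
      moreover have "best x s1" using best_frame[OF assms(2)] s1 by auto
      ultimately have "run S W update_best s1 4 (\<lambda>s'. frame {32} {6} s1 s' \<and> best ?y s')"
        using s1 cellenvD(1) by (intro run_update_best) auto
      then show "run S W update_best s1 4 (\<lambda>s'. frame {10, 32} {6, 11} s s' \<and> best ?y s')"
        by (rule run_cons) (use s1 in \<open>auto intro: frame_trans[of _ _ s s1]\<close>)
    qed simp
    fix s2 assume s2: "frame {10, 32} {6, 11} s s2 \<and> best ?y s2"
    have c2: "cellenv i l s2" using cellenv_frame[OF assms(1)] s2 by auto
    show "run S W (cand_loop q) s2 (90 * N * N) (\<lambda>s'. ?F s s' \<and> best (cloop V q i l ?y (l - 1)) s')"
    proof (rule run_cons[OF run_cand_loop[OF c2 conjunct2[OF s2] assms(3)]])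
      fix s3 assume s3: "?F s2 s3 \<and> best (cloop V q i l ?y (l - 1)) s3"
      have "?F s s3" by (rule frame_trans[of _ _ s s2]) (use s2 s3 in auto)
      then show "?F s s3 \<and> best (cloop V q i l ?y (l - 1)) s3" using s3 by simp
    qed simp
  qed (use N4 in \<open>simp add: algebra_simps\<close>)
qed

definition best2 :: "real \<times> nat \<Rightarrow> state \<Rightarrow> bool" where
  "best2 x s \<longleftrightarrow> creg s 7 = fst x \<and> ireg s 33 = int (snd x)"

lemma best2_frame:
  "best2 x s \<Longrightarrow> frame A B s s' \<Longrightarrow> 33 \<notin> A \<Longrightarrow> 7 \<notin> B \<Longrightarrow> best2 x s'"
  by (simp add: best2_def frameD)

lemma run_split_loop:
  assumes "cellenv i l s" "best2 x s" "ireg s 29 = 1"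
  shows "run S W split_loop s (30 * N) (\<lambda>s'. frame (insert 29 (insert 33 {10..<20})) {7, 11, 12} s s' \<and>
    best2 (ploop V i l x (l - 1)) s')"
proof -
  note e = cellenvD[OF assms(1)]
  let ?F = "frame (insert 29 (insert 33 {10..<20})) {7, 11, 12}"
  let ?I = "\<lambda>j s'. ?F s s' \<and> ireg s' 29 = int (j + 1) \<and> best2 (ploop V i l x j) s'"
  show ?thesis
    unfolding split_loop_def
  proof (rule run_cons[OF run_for[where I = ?I and a = 0 and e = "l - 1" and tb = 20]])
    show "?I 0 s" using assms by (simp add: frame_refl)
    show "(l - 1 - 0) * (20 + 1) + 1 \<le> 30 * N" using e by simp
    show "holds (ILess 29 25) s' \<longleftrightarrow> j < l - 1" if "?I j s'" for j s'
      using that e by (auto simp: frameD)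
    fix j s1 assume j: "j < l - 1" and I: "?I j s1"
    define m where "m = j + 1"
    have m: "0 < m" "m < l" using j by (auto simp: m_def)
    have c1: "cellenv i l s1" using cellenv_frame[OF assms(1)] I by auto
    note e1 = cellenvD[OF c1]
    let ?v = "V 0 i m + 2 * Kl + V 2 (i + m) (l - m)"
    let ?code = "addr_code 29 0 @
     [CLoad 11 10, CAdd 11 11 10, ISub 12 25 29, IMul 12 12 20, IAdd 12 12 26, IAdd 12 12 29,
      IAdd 12 12 37, CLoad 12 12, CAdd 11 11 12]"
    show "run S W (Seq (block ?code) (Seq (If (CLess 11 7) (block [CAdd 7 11 5, IAdd 33 29 23]) Skip)
        (block [IAdd 29 29 21]))) s1 20 (?I (Suc j))"
    proof (rule run_seq[where ?t1.0 = 13 and ?t2.0 = 6])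
      define d where "d = l - m"
      have d: "int l - int m = int d" "0 < d" "d < l" "d < N" using m e by (auto simp: d_def)
      have "addr 0 i m < S" "addr 2 (i + m) d < S"
        using addr_less[of m i 0] addr_less[of d "i + m" 2] S_bounds m d e by (auto simp: N_def d_def)
      \<comment> \<open>All summands are nonnegative, so the final address bounds each partial
        sum.\<close>
      then have "int (d * N) \<le> int W" "int (d * N + i) \<le> int W" "int (d * N + i + m) \<le> int W"
        "int (d * N + i + m + 2 * NN) < int S" "int (d * N + i + m + 2 * NN) \<le> int W" "addr 0 i m < S"
        using W_S unfolding addr_def of_nat_le_iff of_nat_less_iff by linarith+
      then have ad: "int d * int N \<le> int W" "int d * int N + int i \<le> int W" "int d * int N + int i + int m \<le> int W"
        "int d * int N + int i + int m + 2 * int NN \<le> int W"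
        "int d * int N + int i + int m + 2 * int NN < int S" "addr 0 i m < S" by simp_all
      have "int d * int N + int i + int m + 2 * int NN = int (addr 2 (i + m) d)"
        by (simp add: addr_def)
      then have eq: "nat (int d * int N + int i + int m + 2 * int NN) = addr 2 (i + m) d" by simp
      have nn: "0 \<le> int d * int N" by simp
      have le: "V 0 i m + 2 * Kl \<le> W" "V 0 i m + 2 * Kl + V 2 (i + m) d \<le> W"
        "0 \<le> V 0 i m" "0 \<le> V 2 (i + m) d"
        using V_U[of m 0 i] V_U[of d 2 "i + m"] K_U U_W pos e m d by auto
      have dW: "d \<le> W" using d N_W by simp
      have mem: "cmem s1 (addr 0 i m) = V 0 i m" "cmem s1 (addr 2 (i + m) d) = V 2 (i + m) d"
        using e1(9)[of 0 m i] e1(9)[of 2 d "i + m"] m d e by (auto simp: d_def)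
      show "run S W (block ?code) s1 13 (\<lambda>s'. frame {10..<20} {11, 12} s1 s' \<and> creg s' 11 = ?v)"
      proof (rule run_block[OF vc_addr[where l = m and i = i]])
        show "vc S W [CLoad 11 10, CAdd 11 11 10, ISub 12 25 29, IMul 12 12 20, IAdd 12 12 26, IAdd 12 12 29,
            IAdd 12 12 37, CLoad 12 12, CAdd 11 11 12]
          (\<lambda>s'. frame {10..<20} {11, 12} s1 s' \<and> creg s' 11 = ?v) (s1\<lparr>ireg := (ireg s1)(10 := int (addr 0 i m))\<rparr>)"
          using e1 I le ad mem dW d(1) nn pos unfolding d_def[symmetric] m_def[symmetric]
          by (simp add: envD frame_def eq)
      qed (use e1 I m in \<open>auto simp: m_def addr_code_def\<close>)
      fix s2 assume s2: "frame {10..<20} {11, 12} s1 s2 \<and> creg s2 11 = ?v"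
      have c2: "cellenv i l s2" using cellenv_frame[OF c1] s2 by auto
      note e2 = cellenvD[OF c2]
      have b2: "best2 (ploop V i l x j) s2" using best2_frame[of "ploop V i l x j" s1] I s2 by auto
      have f2: "?F s s2" by (rule frame_trans[of _ _ s s1]) (use s2 I in auto)
      have r2: "ireg s2 29 = int m" using I s2 by (auto simp: frameD m_def)
      have mW: "int m + 1 \<le> int W" using m e N_W by linarith
      show "run S W (Seq (If (CLess 11 7) (block [CAdd 7 11 5, IAdd 33 29 23]) Skip)
        (block [IAdd 29 29 21])) s2 6 (?I (Suc j))"
      proof (rule run_seq[where ?t1.0 = 4 and ?t2.0 = 2])
        show "run S W (If (CLess 11 7) (block [CAdd 7 11 5, IAdd 33 29 23]) Skip) s2 4
          (\<lambda>s'. frame {33} {7} s2 s' \<and> best2 (ploop V i l x (Suc j)) s')"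
        proof (rule run_fits)
          assume "fits W s2"
          then have "\<bar>creg s2 11\<bar> \<le> real W" "\<bar>ireg s2 29\<bar> \<le> int W" by (auto simp: fits_def)
          then show "run S W (If (CLess 11 7) (block [CAdd 7 11 5, IAdd 33 29 23]) Skip) s2 4
            (\<lambda>s'. frame {33} {7} s2 s' \<and> best2 (ploop V i l x (Suc j)) s')"
            by (intro run_If[where ?t0.0 = 3] run_block run_Skip;
                use e2 b2 s2 r2 in \<open>simp add: envD best2_def frame_def improve_def m_def\<close>)
        qed
        fix s3 assume s3: "frame {33} {7} s2 s3 \<and> best2 (ploop V i l x (Suc j)) s3"
        have f3: "?F s s3" by (rule frame_trans[of _ _ s s2]) (use s3 f2 in auto)
        have "cellenv i l s3" using cellenv_frame[OF c2] s3 by auto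
        note e3 = cellenvD[OF this]
        have "ireg s3 29 = int m" using r2 s3 by (auto simp: frameD)
        then show "run S W (block [IAdd 29 29 21]) s3 2 (?I (Suc j))"
          using f3 s3 mW e3 by (intro run_block) (auto simp: frame_def best2_def envD m_def)
      qed simp
    qed simp
  qed simp_all
qed


lemma env_rframe:
  assumes "env s" "rframe A B s s'" "\<And>j. j < n \<Longrightarrow> imem s' j = imem s j"
    "A \<inter> {0, 20, 21, 23, 24, 36, 37} = {}" "B \<inter> {0, Suc 0, 2, 3, 4, 5, 10} = {}"
  shows "env s'"
proof -
  have "ireg s' r = ireg s r" if "r \<in> {0, 20, 21, 23, 24, 36, 37}" for r
    using that assms(2,4) by (auto simp: rframe_def)
  moreover have "creg s' r = creg s r" if "r \<in> {0, Suc 0, 2, 3, 4, 5, 10}" for r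
    using that assms(2,5) by (auto simp: rframe_def)
  ultimately show ?thesis using assms(1,3) by (simp add: env_def)
qed

lemma tables_frame: "tables P s \<Longrightarrow> frame A B s s' \<Longrightarrow> tables P s'"
  by (simp add: tables_def frameD)

lemma tables_mono: "tables P s \<Longrightarrow> (\<And>q i l. q \<le> 2 \<Longrightarrow> 0 < l \<Longrightarrow> i + l \<le> n \<Longrightarrow> P' q i l \<Longrightarrow> P q i l) \<Longrightarrow> tables P' s"
  by (simp add: tables_def)

lemma run_store:
  assumes "cellenv i l s" "tables P s" "creg s rc = V q i l" "ireg s ri = int (C q i l)" "q \<le> 2" "ri \<noteq> 10"
    "\<And>q i' l'. l' < l \<Longrightarrow> P q i' l'"
  shows "run S W (store q rc ri) s 6 (\<lambda>s'. cellenv i l s' \<and> rframe {10} {} s s' \<and>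
    tables (\<lambda>q' i' l'. P q' i' l' \<or> (q', i', l') = (q, i, l)) s')"
  unfolding store_def
proof (rule run_block)
  note e = cellenvD[OF assms(1)]
  let ?P = "\<lambda>q' i' l'. P q' i' l' \<or> (q', i', l') = (q, i, l)"
  let ?s = "s\<lparr>ireg := (ireg s)(10 := int (addr q i l))\<rparr>"
  let ?s' = "effect (IStore 10 ri) (effect (CStore 10 rc) ?s)"
  have "addr q i l < S" using addr_less[of l i q] e S_bounds assms by simp
  moreover have t: "tables ?P ?s'"
    using assms e by (auto simp: tables_def addr_inj N_def)
  moreover have r: "rframe {10} {} s ?s'" using assms by (simp add: rframe_def)
  moreover have env: "env ?s'"
    by (rule env_rframe[OF e(1) r]) (use addr_ge[of l q i] e in auto)
  moreover have "cellenv i l ?s'"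
    using env r tables_mono[OF t, of "\<lambda>q' i' l'. l' < l"] assms(7) e
    by (simp add: cellenv_def rframeD)
  ultimately show "vc S W (addr_code 25 q @ [CStore 10 rc, IStore 10 ri]) (\<lambda>s'. cellenv i l s' \<and> rframe {10} {} s s' \<and> tables ?P s') s"
    using e assms by (intro vc_addr[where l = l and i = i]) auto
qed (simp add: addr_code_def)

lemma V_C_0: "0 < l \<Longrightarrow> (V 0 i l, C 0 i l) = cell0 V i l"
  and V_C_1: "0 < l \<Longrightarrow> (V 1 i l, C 1 i l) = cell1 V i l"
  and V_C_2: "0 < l \<Longrightarrow> (V 2 i l, C 2 i l) = cell2 V i l"
  by (simp_all only: V_C_eq) (simp_all add: cell_def)

lemma run_cell_first:
  assumes "cellenv i l s" "creg s 9 = real l * Kl"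
  shows "run S W cell_first s (40 * N) (\<lambda>s'. frame ({10..<20} \<union> {30..<33}) {6} s s' \<and> best (first i l) s')"
  unfolding cell_first_def
proof (rule run_seq[OF run_check_con[OF assms(1)]])
  fix s1 assume s1: "frame check_regs {} s s1 \<and>
        ireg s1 31 = (if consec i l then 1 else 0)"
  have "cellenv i l s1" using cellenv_frame[OF assms(1)] s1 by auto
  note e = cellenvD[OF this]
  have r9: "creg s1 9 = real l * Kl" using s1 assms(2) by (auto simp: frameD)
  have N: "2 \<le> N" using e by (simp add: N_def)
  have lW: "2 * int l + 1 \<le> int W" using S_bounds W_S e(8) by linarith
  have cW: "real l * Kl + (Kcon K + Kidx K) \<le> W" "0 \<le> real l * Kl" "real l * Kl + Kidx K \<le> W"
    using mult_Kl_U[of l] K_U U_W e pos by auto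
  show "run S W (Seq (block [CAdd 6 2 9, CAdd 6 6 0, IMul 32 24 25, IAdd 32 32 21])
     (If (IEq 31 21) (block [CAdd 6 0 5, IConst 32 0]) Skip)) s1 10
     (\<lambda>s'. frame ({10..<20} \<union> {30..<33}) {6} s s' \<and> best (first i l) s')"
  proof (rule run_seq[where ?t1.0 = 5 and ?t2.0 = 4])
    show "run S W (block [CAdd 6 2 9, CAdd 6 6 0, IMul 32 24 25, IAdd 32 32 21]) s1 5
      (\<lambda>s'. frame {32} {6} s1 s' \<and> best (Kidx K + real l * Kl + Kcon K, 2 * l + 1) s')"
      using e r9 lW cW pos by (intro run_block) (auto simp: envD frame_def best_def algebra_simps)
    fix s2 assume s2: "frame {32} {6} s1 s2 \<and> best (Kidx K + real l * Kl + Kcon K, 2 * l + 1) s2"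
    have f2: "frame ({10..<20} \<union> {30..<33}) {6} s s2" by (rule frame_trans[of _ _ s s1]) (use s1 s2 in auto)
    have "cellenv i l s2" using cellenv_frame[OF assms(1)] f2 by auto
    note e2 = cellenvD[OF this]
    have "Kcon K \<le> W" using K_U U_W by auto
    moreover have "ireg s2 31 = (if consec i l then 1 else 0)" using s1 s2 by (auto simp: frameD)
    ultimately show "run S W (If (IEq 31 21) (block [CAdd 6 0 5, IConst 32 0]) Skip) s2 4
       (\<lambda>s'. frame ({10..<20} \<union> {30..<33}) {6} s s' \<and> best (first i l) s')"
      by (intro run_If[where ?t0.0 = 3] run_block run_Skip;
          use e2 conjunct2[OF s2] f2 pos in \<open>simp add: envD best_def frame_def first_def split: if_splits\<close>)
  qed simp
qed (use n_pos n_less_N in linarith)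

lemma run_cell_split:
  assumes "cellenv i l s" "best (first i l) s"
  shows "run S W cell_split s (40 * N) (\<lambda>s'. frame (insert 29 (insert 33 {10..<20})) {7, 11, 12} s s' \<and>
    best2 (split0 V i l) s')"
  unfolding cell_split_def split0_def
proof (rule run_seq[where ?t1.0 = 4 and ?t2.0 = "30 * N"])
  note e = cellenvD[OF assms(1)]
  let ?x = "(fst (first i l) + 2 * Kl, l)"
  have "0 \<le> fst (first i l)" "fst (first i l) + 2 * Kl \<le> W" "int l \<le> W" "1 \<le> W"
    using first_U[of l i] K_U U_W e N_W by auto
  then show "run S W (block [CAdd 7 6 10, IAdd 33 25 23, IConst 29 1]) s 4
    (\<lambda>s'. frame {29, 33} {7} s s' \<and> ireg s' 29 = 1 \<and> best2 ?x s')"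
    using assms e pos by (intro run_block) (auto simp: envD frame_def best_def best2_def)
  fix s1 assume s1: "frame {29, 33} {7} s s1 \<and> ireg s1 29 = 1 \<and> best2 ?x s1"
  have c1: "cellenv i l s1" using cellenv_frame[OF assms(1)] s1 by auto
  have b1: "best2 ?x s1" "ireg s1 29 = 1" using s1 by auto
  show "run S W split_loop s1 (30 * N) (\<lambda>s'. frame (insert 29 (insert 33 {10..<20})) {7, 11, 12} s s' \<and>
    best2 (ploop V i l ?x (l - 1)) s')"
    by (rule run_cons[OF run_split_loop[OF c1 b1]]) (use s1 in \<open>auto intro: frame_trans[of _ _ s s1]\<close>)
qed (use nonempty in \<open>simp add: N_def\<close>)

lemma run_cell_split_end:
  assumes "cellenv i l s" "best2 (split0 V i l) s" "creg s 6 = V 0 i l"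
  shows "run S W cell_split_end s 6 (\<lambda>s'. frame {33} {7, 11} s s' \<and> best2 (V 2 i l, C 2 i l) s')"
  unfolding cell_split_end_def
proof (rule run_seq[where ?t1.0 = 2 and ?t2.0 = 4])
  note e = cellenvD[OF assms(1)]
  have le: "0 \<le> V 0 i l" "V 0 i l + 2 * Kl \<le> W" "int l \<le> W"
    using V_U[of l 0 i] K_U U_W e N_W by auto
  then show "run S W (block [CAdd 11 6 10]) s 2 (\<lambda>s'. frame {} {11} s s' \<and> creg s' 11 = V 0 i l + 2 * Kl)"
    using assms e pos by (intro run_block) (auto simp: envD frame_def)
  fix s1 assume s1: "frame {} {11} s s1 \<and> creg s1 11 = V 0 i l + 2 * Kl"
  have "cellenv i l s1" using cellenv_frame[OF assms(1)] s1 by auto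
  note e1 = cellenvD[OF this]
  have b1: "best2 (split0 V i l) s1" using best2_frame[OF assms(2)] s1 by auto
  have v: "fst (cell0 V i l) = V 0 i l" using V_C_0[OF e(5), of i] by (metis fst_conv)
  show "run S W (If (CLess 7 11) Skip (block [CAdd 7 11 5, IAdd 33 25 23])) s1 4
    (\<lambda>s'. frame {33} {7, 11} s s' \<and> best2 (V 2 i l, C 2 i l) s')"
    by (intro run_If[where ?t0.0 = 3] run_block run_Skip;
        use e e1 b1 s1 le pos v in \<open>simp add: envD best2_def frame_def V_C_2 cell2_def\<close>)
qed simp

lemma ploop_nonneg:
  assumes "0 \<le> fst x" "j < l" "i + l \<le> n"
  shows "0 \<le> fst (ploop V i l x j)"
  using assms(2)
proof (induction j)
  case (Suc j)
  have "0 \<le> V 0 i (j + 1)" "0 \<le> V 2 (i + (j + 1)) (l - (j + 1))"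
    using V_U(1) Suc.prems assms(3) by auto
  then show ?case using Suc pos by (auto intro!: improve_ge)
qed (use assms in simp)

text \<open>In \<open>stage 0\<close> the cost \<open>Kstrc K\<close> is added to
  \<open>split0\<close>, which need not be a table entry, so \<open>V_U\<close> does not cover that
  sum.\<close>

lemma split0_U:
  assumes "0 < l" "i + l \<le> n"
  shows "0 \<le> fst (split0 V i l)" "fst (split0 V i l) \<le> 3 * U"
proof -
  show "0 \<le> fst (split0 V i l)"
    unfolding split0_def using first_U[of l i] assms pos by (intro ploop_nonneg) auto
  have "fst (split0 V i l) \<le> fst (first i l) + 2 * Kl"
    using ploop_le[of V i l "(fst (first i l) + 2 * Kl, l)"] by (simp add: split0_def)
  then show "fst (split0 V i l) \<le> 3 * U" using first_U[of l i] K_U assms by simp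
qed

lemma run_cell:
  assumes "cellenv i l s" "creg s 9 = real l * Kl" "tables P s" "\<And>q i' l'. l' < l \<Longrightarrow> P q i' l'"
  shows "run S W cell_prog s (400 * N * N) (\<lambda>s'. cellenv i l s' \<and> rframe ({10..<20} \<union> {28..<34}) {6, 7, 8, 11, 12} s s' \<and>
    tables (\<lambda>q' i' l'. P q' i' l' \<or> (i', l') = (i, l)) s')"
proof -
  note e = cellenvD[OF assms(1)]
  have N: "2 \<le> N" using e by (simp add: N_def)
  have NN: "N * 2 \<le> N * N" "4 \<le> N * N" using N mult_le_mono[OF N N] by auto
  let ?F = "frame ({10..<20} \<union> {28..<34}) {6, 7, 8, 11, 12}"
  let ?R = "rframe ({10..<20} \<union> {28..<34}) {6, 7, 8, 11, 12}"
  let ?P1 = "\<lambda>q' i' l'. P q' i' l' \<or> (q', i', l') = (0, i, l)"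
  let ?P2 = "\<lambda>q' i' l'. ?P1 q' i' l' \<or> (q', i', l') = (2, i, l)"
  let ?P3 = "\<lambda>q' i' l'. ?P2 q' i' l' \<or> (q', i', l') = (1, i, l)"
  let ?G = "\<lambda>s'. cellenv i l s' \<and> ?R s s' \<and> tables (\<lambda>q' i' l'. P q' i' l' \<or> (i', l') = (i, l)) s'"
  let ?p = "split0 V i l"
  let ?p1 = "Seq (stage 1) (store 1 6 32)"
  let ?p2 = "Seq (block [CAdd 6 6 2, CAdd 6 6 4, IConst 32 3]) ?p1"
  let ?p3 = "Seq (store 2 7 33) ?p2"
  let ?p4 = "Seq cell_split_end ?p3"
  let ?p5 = "Seq (store 0 6 32) ?p4"
  let ?p6 = "Seq (stage 0) ?p5"
  let ?p7 = "Seq cell_split ?p6"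
  have fst0: "cloop V 0 i l (improve True (Kstrc K + fst ?p) 1 (first i l)) (l - 1) = (V 0 i l, C 0 i l)"
    using V_C_0[OF e(5), of i] by (simp only: cell0_def)
  have fst1: "cloop V 1 i l (improve True (Kstrc K + V 2 i l) 1 (Kidx K + Kl + V 0 i l, 3)) (l - 1) = (V 1 i l, C 1 i l)"
    using V_C_1[OF e(5), of i] V_C_0[OF e(5), of i] V_C_2[OF e(5), of i] unfolding cell1_def by (metis fst_conv)
  show ?thesis
    unfolding cell_prog_def
  proof (rule run_seq[OF run_cell_first[OF assms(1,2)], where ?t2.0 = "350 * N * N"])
    fix s1 assume s1: "frame ({10..<20} \<union> {30..<33}) {6} s s1 \<and> best (first i l) s1"
    have c1: "cellenv i l s1" using cellenv_frame[OF assms(1)] s1 by auto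
    have f1: "?F s s1" by (rule frame_mono) (use s1 in auto)
    show "run S W ?p7 s1 (350 * N * N) ?G"
    proof (rule run_seq[OF run_cell_split[OF c1 conjunct2[OF s1]], where ?t2.0 = "300 * N * N"])
      fix s2 assume s2: "frame (insert 29 (insert 33 {10..<20})) {7, 11, 12} s1 s2 \<and> best2 ?p s2"
      have c2: "cellenv i l s2" using cellenv_frame[OF c1] s2 by auto
      have f2: "?F s s2" by (rule frame_trans[of _ _ s s1]) (use f1 s2 in auto)
      have b2: "best (first i l) s2" using best_frame[of "first i l" s1] s1 s2 by auto
      have p2: "creg s2 7 = fst ?p" using s2 by (simp add: best2_def)
      show "run S W ?p6 s2 (300 * N * N) ?G"
      proof (rule run_seq[OF run_stage[OF c2 b2 _ p2 split0_U[OF e(5,6)]], where ?t2.0 = "200 * N * N"])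
        show "(0::nat) < 2" by simp
        fix s3 assume s3': "frame ({10..<20} \<union> {28..<33}) {6, 8, 11} s2 s3 \<and>
          best (cloop V 0 i l (improve True (Kstrc K + fst ?p) 1 (first i l)) (l - 1)) s3"
        then have s3: "frame ({10..<20} \<union> {28..<33}) {6, 8, 11} s2 s3" "best (V 0 i l, C 0 i l) s3"
          unfolding fst0 by auto
        have c3: "cellenv i l s3" using cellenv_frame[OF c2] s3 by auto
        have f3: "?F s s3" by (rule frame_trans[of _ _ s s2]) (use f2 s3 in auto)
        have b3: "creg s3 6 = V 0 i l" "ireg s3 32 = int (C 0 i l)" using s3 by (auto simp: best_def)
        have p3: "best2 ?p s3" using best2_frame[of ?p s2] s2 s3 by auto
        show "run S W ?p5 s3 (200 * N * N) ?G"
        proof (rule run_seq[OF run_store[OF c3 tables_frame[OF assms(3) f3] b3], where ?t2.0 = "150 * N * N"])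
          fix s4 assume s4: "cellenv i l s4 \<and> rframe {10} {} s3 s4 \<and> tables ?P1 s4"
          have c4: "cellenv i l s4" using s4 by simp
          have f4: "?R s s4" by (rule rframe_trans[of _ _ s s3]) (use frame_rframe[OF f3] s4 in auto)
          have p4: "best2 ?p s4" "creg s4 6 = V 0 i l" using s4 p3 b3 by (auto simp: best2_def rframeD)
          show "run S W ?p4 s4 (150 * N * N) ?G"
          proof (rule run_seq[OF run_cell_split_end[OF c4 p4], where ?t2.0 = "140 * N * N"])
            fix s5 assume s5: "frame {33} {7, 11} s4 s5 \<and> best2 (V 2 i l, C 2 i l) s5"
            have c5: "cellenv i l s5" using cellenv_frame[OF c4] s5 by auto
            have f5: "?R s s5" by (rule rframe_trans[of _ _ s s4]) (use f4 frame_rframe s5 in auto)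
            have t5: "tables ?P1 s5" using tables_frame s4 s5 by blast
            have p5: "creg s5 7 = V 2 i l" "ireg s5 33 = int (C 2 i l)" "creg s5 6 = V 0 i l"
              using s5 p4 by (auto simp: best2_def frameD)
            show "run S W ?p3 s5 (140 * N * N) ?G"
            proof (rule run_seq[OF run_store[OF c5 t5 p5(1,2)], where ?t2.0 = "130 * N * N"])
              fix s6 assume s6: "cellenv i l s6 \<and> rframe {10} {} s5 s6 \<and> tables ?P2 s6"
              have c6: "cellenv i l s6" using s6 by simp
              note e6 = cellenvD[OF c6]
              have f6: "?R s s6" by (rule rframe_trans[of _ _ s s5]) (use f5 s6 in auto)
              have p6: "creg s6 6 = V 0 i l" "creg s6 7 = V 2 i l" using s6 p5 by (auto simp: rframeD)
              let ?x = "(Kidx K + Kl + V 0 i l, 3)"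
              show "run S W ?p2 s6 (130 * N * N) ?G"
              proof (rule run_seq[where ?t1.0 = 4 and ?t2.0 = "120 * N * N"])
                have "0 \<le> V 0 i l" "V 0 i l + Kidx K + Kl \<le> W" "3 \<le> W" "V 0 i l + Kidx K \<le> W"
                  using V_U[of l 0 i] K_U U_W e pos S_bounds W_S by auto
                then show "run S W (block [CAdd 6 6 2, CAdd 6 6 4, IConst 32 3]) s6 4
                  (\<lambda>s'. frame {32} {6} s6 s' \<and> best ?x s')"
                  using e6 p6 pos by (intro run_block) (auto simp: envD frame_def best_def)
                fix s7 assume s7: "frame {32} {6} s6 s7 \<and> best ?x s7"
                have c7: "cellenv i l s7" using cellenv_frame[OF c6] s7 by auto
                have f7: "?R s s7" by (rule rframe_trans[of _ _ s s6]) (use f6 frame_rframe s7 in auto)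
                have t7: "tables ?P2 s7" using tables_frame s6 s7 by blast
                have p7: "creg s7 7 = V 2 i l" using s7 p6 by (auto simp: frameD)
                have V2: "0 \<le> V 2 i l" "V 2 i l \<le> 3 * U" using V_U[of l 2 i] e by auto
                show "run S W ?p1 s7 (120 * N * N) ?G"
                proof (rule run_seq[OF run_stage[OF c7 conjunct2[OF s7] _ p7 V2], where ?t2.0 = "20 * N * N"])
                  show "(1::nat) < 2" by simp
                  fix s8 assume s8': "frame ({10..<20} \<union> {28..<33}) {6, 8, 11} s7 s8 \<and>
                    best (cloop V 1 i l (improve True (Kstrc K + V 2 i l) 1 ?x) (l - 1)) s8"
                  then have s8: "frame ({10..<20} \<union> {28..<33}) {6, 8, 11} s7 s8" "best (V 1 i l, C 1 i l) s8"
                    unfolding fst1 by auto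
                  have c8: "cellenv i l s8" using cellenv_frame[OF c7] s8 by auto
                  have f8: "?R s s8" by (rule rframe_trans[of _ _ s s7]) (use f7 frame_rframe s8 in auto)
                  have t8: "tables ?P2 s8" using tables_frame s8 t7 by blast
                  have b8: "creg s8 6 = V 1 i l" "ireg s8 32 = int (C 1 i l)" using s8 by (auto simp: best_def)
                  show "run S W (store 1 6 32) s8 (20 * N * N) ?G"
                  proof (rule run_cons[OF run_store[OF c8 t8 b8]])
                    fix s9 assume s9: "cellenv i l s9 \<and> rframe {10} {} s8 s9 \<and> tables ?P3 s9"
                    have "?R s s9" by (rule rframe_trans[of _ _ s s8]) (use f8 s9 in auto)
                    moreover have "tables (\<lambda>q' i' l'. P q' i' l' \<or> (i', l') = (i, l)) s9"
                    proof (rule tables_mono)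
                      show "tables ?P3 s9" using s9 by simp
                      fix q' i' l' :: nat assume "q' \<le> 2" "P q' i' l' \<or> (i', l') = (i, l)"
                      then show "?P3 q' i' l'" by auto
                    qed
                    ultimately show "?G s9" using s9 by simp
                  qed (use assms(4) NN in auto)
                qed (use NN in auto)
              qed (use NN in auto)
            qed (use assms(4) NN in auto)
          qed (use NN in auto)
        qed (use assms(4) NN in auto)
      qed (use NN in auto)
    qed (use NN in auto)
  qed (use NN in auto)
qed

end

section \<open>Filling the table\<close>

text \<open>Integer register 23 and cost register 5 are zero initially. Cost register 9 holds
  \<open>l * Kl\<close> for the current row, here \<open>l = 1\<close>, and gains \<open>Kl\<close>
  with each row.\<close>

definition setup_code :: "instr list" where
  "setup_code = [IConst 21 1, IAdd 20 0 21, IMul 36 20 20, IAdd 37 36 36, IConst 24 2,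
     CAdd 10 4 4, CAdd 9 4 5, IConst 25 1, IConst 35 2]"

text \<open>A row consists of the segments of one length \<open>l\<close>; there are
  \<open>N - l\<close> positions for them. Increasing lengths ensure that all shorter segments are
  ready.\<close>

definition row_prog :: prog where
  "row_prog = Seq (block [ISub 27 20 25, IConst 26 0])
     (Seq (While (ILess 26 27) (Seq cell_prog (block [IAdd 26 26 21])))
     (block [IAdd 25 25 21, IAdd 35 35 21, CAdd 9 9 4]))"

definition fill_prog :: prog where
  "fill_prog = Seq (block setup_code) (While (ILess 25 20) row_prog)"

context ram
begin

definition row :: "nat \<Rightarrow> state \<Rightarrow> bool" where
  "row l s \<longleftrightarrow> env s \<and> ireg s 25 = int l \<and> ireg s 35 = int l + 1 \<and> creg s 9 = real l * Kl \<and>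
     tables (\<lambda>q i' l'. l' < l) s"

lemma N_ge_2: "2 \<le> N"
  using n_pos n_less_N by linarith

lemma N_sq: "N * 2 \<le> N * N" "4 \<le> N * N"
  using N_ge_2 mult_le_mono[OF N_ge_2 N_ge_2] by auto

lemma run_row:
  assumes "row l s" "0 < l" "l \<le> n"
  shows "run S W row_prog s (410 * N * N * N) (row (Suc l))"
proof -
  let ?I = "\<lambda>i s. row l s \<and> ireg s 26 = int i \<and> ireg s 27 = int N - int l \<and>
    tables (\<lambda>q i' l'. l' < l \<or> l' = l \<and> i' < i) s"
  have lN: "l < N" using assms n_less_N by simp
  have N4: "4 \<le> N * N" using N_sq by auto
  have *: "4 * N \<le> N * N * N" "8 \<le> N * N * N"
    using mult_le_mono1[OF N4, of N] mult_le_mono[OF N4 N_ge_2] by auto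
  have r: "N * (400 * N * N + 3) = 400 * (N * N * N) + 3 * N" "405 * N * N * N = 405 * (N * N * N)"
    "410 * N * N * N = 410 * (N * N * N)"
    by (simp_all add: algebra_simps)
  show ?thesis
    unfolding row_prog_def
  proof (rule run_seq[where ?t1.0 = 3 and ?t2.0 = "405 * N * N * N + 8"])
    show "run S W (block [ISub 27 20 25, IConst 26 0]) s 3 (?I 0)"
      using assms lN N_W
      by (intro run_block) (auto simp: row_def env_def tables_def)
    fix s1 assume I: "?I 0 s1"
    show "run S W (Seq (While (ILess 26 27) (Seq cell_prog (block [IAdd 26 26 21])))
        (block [IAdd 25 25 21, IAdd 35 35 21, CAdd 9 9 4])) s1 (405 * N * N * N + 8) (row (Suc l))"
    proof (rule run_seq[where ?t1.0 = "N * (400 * N * N + 3) + 1" and ?t2.0 = 4 and ?R1.0 = "?I (N - l)"])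
      show "run S W (While (ILess 26 27) (Seq cell_prog (block [IAdd 26 26 21]))) s1 (N * (400 * N * N + 3) + 1) (?I (N - l))"
      proof (rule run_for[where I = ?I and tb = "400 * N * N + 2", OF I])
        show "(N - l - 0) * (400 * N * N + 2 + 1) + 1 \<le> N * (400 * N * N + 3) + 1"
          by (intro add_le_mono1 mult_le_mono) auto
        show "holds (ILess 26 27) s' \<longleftrightarrow> i < N - l" if "?I i s'" for i s'
          using that lN by (auto simp: less_diff_conv)
        fix i s1 assume i: "i < N - l" and I: "?I i s1"
        have il: "i + l \<le> n" using i by (simp add: N_def)
        have c1: "cellenv i l s1" using I il assms(2) by (auto simp: cellenv_def row_def)
        have r9: "creg s1 9 = real l * Kl" using I by (simp add: row_def)
        let ?P = "\<lambda>q i' l'. l' < l \<or> l' = l \<and> i' < i"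
        have t1: "tables ?P s1" using I by simp
        show "run S W (Seq cell_prog (block [IAdd 26 26 21])) s1 (400 * N * N + 2) (?I (Suc i))"
        proof (rule run_seq[OF run_cell[OF c1 r9 t1]])
          fix s2 assume s2: "cellenv i l s2 \<and> rframe ({10..<20} \<union> {28..<34}) {6, 7, 8, 11, 12} s1 s2 \<and>
            tables (\<lambda>q' i' l'. ?P q' i' l' \<or> (i', l') = (i, l)) s2"
          note e = cellenvD[OF conjunct1[OF s2]]
          have t2: "tables (\<lambda>q i' l'. l' < l \<or> l' = l \<and> i' < Suc i) s2"
            using s2 by (auto elim: tables_mono)
          have r2: "ireg s2 27 = int N - int l" "creg s2 9 = real l * Kl" using s2 I r9 by (auto simp: rframeD)
          have "int i + 1 \<le> int W" using e(7) N_W by linarith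
          then show "run S W (block [IAdd 26 26 21]) s2 2 (?I (Suc i))"
            using e t2 r2 conjunct1[OF s2]
            by (intro run_block) (auto simp: row_def env_def tables_def cellenv_def)
        qed auto
      qed simp
      fix s3 assume I: "?I (N - l) s3"
      have t: "tables (\<lambda>q i' l'. l' < Suc l) s3"
        by (rule tables_mono[OF conjunct2[OF conjunct2[OF conjunct2[OF I]]]]) (auto simp: N_def)
      have "real (Suc l) * Kl \<le> U" using mult_Kl_U[of "Suc l"] assms n_less_N by simp
      then have u: "real l * Kl + Kl \<le> W" "0 \<le> real l * Kl + Kl" using pos U_W K_U by (auto simp: algebra_simps)
      have "int l + 2 \<le> int W" using assms n_less_N S_bounds W_S by linarith
      then show "run S W (block [IAdd 25 25 21, IAdd 35 35 21, CAdd 9 9 4]) s3 4 (row (Suc l))"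
        using I t u by (intro run_block) (auto simp: row_def env_def tables_def algebra_simps)
    qed (use * r in linarith)
  qed (use * r in linarith)
qed

lemma run_fill:
  assumes "ireg s 0 = int n" "ireg s 23 = 0"
    "creg s 0 = Kcon K" "creg s (Suc 0) = Kvec K" "creg s 2 = Kidx K" "creg s 3 = Kstrc K"
    "creg s 4 = Kl" "creg s 5 = 0" "\<And>j. j < n \<Longrightarrow> imem s j = D ! j"
  shows "run S W fill_prog s (420 * N * N * N * N) (\<lambda>s'. env s' \<and> tables (\<lambda>_ _ _. True) s')"
  unfolding fill_prog_def
proof (rule run_seq[where ?t1.0 = 10 and ?t2.0 = "N * (410 * N * N * N + 1) + 1" and ?R1.0 = "row 1"])
  have "int (N * N) \<le> int W" "int (2 * (N * N)) \<le> int W" "N \<le> W" "2 \<le> W"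
    using S_bounds W_S N_W N_ge_2 unfolding of_nat_le_iff NN_def by linarith+
  then have b: "int N * int N \<le> int W" "2 * (int N * int N) \<le> int W" "int n + 1 \<le> int W" "2 \<le> W" "1 \<le> W"
    "int n + 1 = int N" "1 + int n = int N"
    by (simp_all, simp_all add: N_def)
  have "2 * Kl \<le> W" "Kl \<le> W" using K_U U_W by auto
  then show "run S W (block setup_code) s 10 (row 1)"
    using assms b pos
    by (intro run_block) (auto simp: setup_code_def row_def env_def tables_def NN_def algebra_simps)
  fix s1 assume I: "row 1 s1"
  show "run S W (While (ILess 25 20) row_prog) s1 (N * (410 * N * N * N + 1) + 1) (\<lambda>s'. env s' \<and> tables (\<lambda>_ _ _. True) s')"
  proof (rule run_cons[OF run_for[where I = row and a = 1 and e = N and tb = "410 * N * N * N", OF I]])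
    show "1 \<le> N" using N_ge_2 by simp
    show "run S W row_prog s (410 * N * N * N) (row (Suc l))" if "1 \<le> l" "l < N" "row l s" for l s
      by (rule run_row) (use that in \<open>auto simp: N_def\<close>)
    show "holds (ILess 25 20) s \<longleftrightarrow> l < N" if "row l s" for l s
      using that by (simp add: row_def envD)
    show "env s' \<and> tables (\<lambda>_ _ _. True) s'" if "row N s'" for s'
      using that by (auto simp: row_def N_def elim: tables_mono)
    show "(N - 1) * (410 * N * N * N + 1) + 1 \<le> N * (410 * N * N * N + 1) + 1"
      by (intro add_le_mono1 mult_le_mono1) auto
  qed simp
next
  have "4 * 4 \<le> N * N * N * N" using mult_le_mono[OF N_sq(2) N_sq(2)] by (simp add: mult.assoc)
  moreover have "4 * N \<le> N * N * N" using mult_le_mono1[OF N_sq(2), of N] .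
  then have "4 * N * 2 \<le> N * N * N * N" using mult_le_mono[OF _ N_ge_2] by blast
  moreover have "N * (410 * N * N * N + 1) = 410 * (N * N * N * N) + N"
    "420 * N * N * N * N = 420 * (N * N * N * N)"
    by (simp_all add: algebra_simps)
  ultimately show "10 + (N * (410 * N * N * N + 1) + 1) \<le> 420 * N * N * N * N"
    by linarith
qed

end

section \<open>Writing the optimal tree\<close>

definition emit :: "reg \<Rightarrow> instr list" where
  "emit r = [IStore 42 r, IAdd 42 42 21]"

definition emits :: "reg list \<Rightarrow> instr list" where
  "emits rs = concat (map emit rs)"

definition push :: "reg \<Rightarrow> instr list" where
  "push r = [IStore 40 r, IAdd 40 40 21]"

text \<open>
  Registers 40 and 42 point to the first free cell of the stack and of the output; 41 and 54 hold
  the start of these areas. Registers 44 to 47 hold the item \<open>(q, i, l)\<close> and its recorded choice, and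
  51 the value that is subtracted from the entries of \<open>D\<close>.
\<close>

definition con_prog :: prog where
  "con_prog = block (emits [23, 46])"

text \<open>The child keeps \<open>q\<close>, so \<open>q * NN\<close> is part of its stack item;
  the child of an \<open>Idx\<close> and the pieces of a partition are pushed with
  \<open>q = 0\<close>.\<close>

definition vec_prog :: prog where
  "vec_prog = block ([IAdd 10 45 50, ILoad 10 10, ILoad 11 45, ISub 10 10 11, IMul 12 50 20, IAdd 12 12 45,
     IMul 11 44 36, IAdd 12 12 11] @ emits [21, 49, 10] @ push 12)"

definition idx_prog :: prog where
  "idx_prog = Seq (block ([IConst 52 0, IAdd 12 45 23] @ emits [24, 49]))
     (Seq (While (ILess 52 49) (block ([ILoad 10 12, ISub 10 10 51] @ emit 10 @ [IAdd 12 12 50, IAdd 52 52 21])))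
     (block ([IMul 10 50 20, IAdd 10 10 45] @ push 10)))"

text \<open>The count of the node is known only after its indices are written: 0 is emitted first and patched.\<close>

definition strc_prog :: prog where
  "strc_prog = Seq (block ([IConst 10 3, IAdd 53 42 21, IConst 52 0, IAdd 12 45 23, IAdd 13 46 23] @ emits [10, 23]))
     (Seq (While (ILess 23 13) (block ([ILoad 10 12, ISub 10 10 51] @ emit 10 @
        [IAdd 52 52 21, IMul 10 13 20, IAdd 10 10 12, IAdd 10 10 37, ILoad 10 10, IAdd 12 12 10, ISub 13 13 10])))
     (block ([IStore 53 52, IMul 10 46 20, IAdd 10 10 45, IAdd 10 10 37] @ push 10)))"

text \<open>The rest of the partition is pushed below its first piece, so that the pieces are
  written from left to right.\<close>

definition rest_prog :: prog where
  "rest_prog = Seq (If (ILess 47 46) (block ([ISub 10 46 47, IMul 10 10 20, IAdd 10 10 45, IAdd 10 10 47,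
       IAdd 10 10 37] @ push 10)) Skip)
     (block ([IMul 10 47 20, IAdd 10 10 45] @ push 10))"

text \<open>Registers 49 and 48 hold the quotient and the remainder of the recorded choice modulo 2.
  Quotient 0 leaves leaf and \<open>Strc\<close>; any other quotient is a count, and the remainder
  separates \<open>Vec\<close> from \<open>Idx\<close>.\<close>

definition dispatch_prog :: prog where
  "dispatch_prog = If (IEq 49 23) (If (IEq 48 23) con_prog strc_prog)
     (Seq (block [IDiv 50 46 49]) (If (IEq 48 23) vec_prog idx_prog))"

definition node_prog :: prog where
  "node_prog = Seq (block [IConst 51 0, IDiv 49 47 24, IMod 48 47 24])
     (Seq (If (IEq 44 23) (block [ILoad 51 45]) Skip) dispatch_prog)"

definition item_prog :: prog where
  "item_prog = Seq (block [ISub 40 40 21, ILoad 43 40, ILoad 47 43, IMod 45 43 20, IDiv 10 43 20,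
       IMod 46 10 20, IDiv 44 10 20])
     (If (IEq 44 24) rest_prog node_prog)"

lemma vc_append: "vc S W (is1 @ is2) R s \<longleftrightarrow> vc S W is1 (vc S W is2 R) s"
  by (induction is1 arbitrary: s) auto

lemma vc_mono: "vc S W is R1 s \<Longrightarrow> (\<And>s'. R1 s' \<Longrightarrow> R2 s') \<Longrightarrow> vc S W is R2 s"
  by (induction "is" arbitrary: s) auto

context ram
begin

section \<open>The stack and the output in memory\<close>

definition SB :: nat where "SB = 3 * NN"
definition OB :: nat where "OB = 3 * NN + N"

lemma SB_OB: "SB + N = OB" "OB + Q * N + N + 8 \<le> S"
  using S_bounds by (auto simp: SB_def OB_def)

text \<open>The tables belong to the invariant because the choices are looked up throughout; the
  bound on \<open>stk\<close> keeps the stack away from the output area.\<close>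

definition rel :: "nat list \<Rightarrow> int list \<Rightarrow> state \<Rightarrow> bool" where
  "rel stk out s \<longleftrightarrow> env s \<and> tables (\<lambda>_ _ _. True) s \<and> length stk \<le> N \<and>
     ireg s 41 = int SB \<and> ireg s 54 = int OB \<and>
     ireg s 40 = int (SB + length stk) \<and> ireg s 42 = int (OB + length out) \<and>
     (\<forall>j<length stk. imem s (SB + j) = int (stk ! j)) \<and> (\<forall>j<length out. imem s (OB + j) = out ! j)"

lemma relD:
  assumes "rel stk out s"
  shows "env s" "length stk \<le> N" "ireg s 41 = int SB" "ireg s 54 = int OB"
    "ireg s 40 = int (SB + length stk)" "ireg s 42 = int (OB + length out)"
    "j < length stk \<Longrightarrow> imem s (SB + j) = int (stk ! j)"
    "q \<le> 2 \<Longrightarrow> 0 < l \<Longrightarrow> i + l \<le> n \<Longrightarrow> imem s (addr q i l) = int (C q i l)"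
  using assms by (auto simp: rel_def tables_def)

lemma rel_frame:
  assumes "rel stk out s" "frame A B s s'"
    "A \<inter> {0, 20, 21, 23, 24, 36, 37, 40, 41, 42, 54} = {}" "B \<inter> {0, Suc 0, 2, 3, 4, 5, 10} = {}"
  shows "rel stk out s'"
proof -
  have "env s'" by (rule env_frame[OF relD(1)[OF assms(1)] assms(2)]) (use assms(3,4) in auto)
  moreover have "ireg s' r = ireg s r" if "r \<in> {40, 41, 42, 54}" for r
    using that assms(2,3) by (auto simp: frame_def)
  ultimately show ?thesis
    using assms(1) frameD(1,2)[OF assms(2)] tables_frame[OF _ assms(2)] by (auto simp: rel_def)
qed

lemma tables_imem:
  assumes "tables P s" "cmem s' = cmem s" "\<And>a. a < 3 * NN \<Longrightarrow> imem s' a = imem s a"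
  shows "tables P s'"
  unfolding tables_def
proof (intro allI impI)
  fix q i l assume a: "q \<le> 2" "0 < l" "i + l \<le> n" "P q i l"
  then have "addr q i l < 3 * NN" by (intro addr_less) (auto simp: N_def)
  then show "cmem s' (addr q i l) = V q i l \<and> imem s' (addr q i l) = int (C q i l)"
    using assms a by (simp add: tables_def)
qed

lemma n_less_NN: "n < 3 * NN"
  using n_less_N N_le_NN by simp

lemma vc_emit:
  assumes "rel stk out s" "OB + length out < S" "r \<noteq> 42"
    and "\<And>s'. rel stk (out @ [ireg s r]) s' \<Longrightarrow> rframe {42} {} s s' \<Longrightarrow> vc S W is R s'"
  shows "vc S W (emit r @ is) R s"
proof -
  let ?s' = "effect (IAdd 42 42 21) (effect (IStore 42 r) s)"
  note e = envD[OF relD(1)[OF assms(1)]] relD[OF assms(1)]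
  have o: "nat (int OB + int (length out)) = OB + length out" by simp
  have rf: "rframe {42} {} s ?s'" by (simp add: rframe_def)
  have m: "imem ?s' = (imem s)(OB + length out := ireg s r)" using e o by simp
  have env: "env ?s'"
    by (rule env_rframe[OF relD(1)[OF assms(1)] rf]) (use m n_less_NN in \<open>auto simp: OB_def\<close>)
  have tab: "tables (\<lambda>_ _ _. True) ?s'"
    by (rule tables_imem[of _ s]) (use assms(1) m in \<open>auto simp: OB_def rel_def\<close>)
  have "rel stk (out @ [ireg s r]) ?s'"
    using env tab e assms(1) SB_OB(1) unfolding rel_def m
    by (auto simp: nth_append less_Suc_eq)
  then have "vc S W is R ?s'" using assms(4) rf by blast
  moreover have "int OB + int (length out) + 1 \<le> int W" "int OB + int (length out) < int S"
    using assms(2) W_S by linarith+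
  ultimately show ?thesis using e by (simp add: emit_def)
qed

lemma vc_emits:
  assumes "rel stk out s" "OB + length out + length rs \<le> S" "42 \<notin> set rs"
    and "\<And>s'. rel stk (out @ map (ireg s) rs) s' \<Longrightarrow> rframe {42} {} s s' \<Longrightarrow> vc S W is R s'"
  shows "vc S W (emits rs @ is) R s"
  using assms
proof (induction rs arbitrary: out s)
  case Nil
  then show ?case by (simp add: emits_def rframe_def)
next
  case (Cons r rs)
  have "vc S W (emit r @ (emits rs @ is)) R s"
  proof (rule vc_emit[OF Cons.prems(1)])
    fix s1 assume s1: "rel stk (out @ [ireg s r]) s1" "rframe {42} {} s s1"
    have eq: "map (ireg s1) rs = map (ireg s) rs"
      by (intro map_cong refl rframeD(1)[OF s1(2)]) (use Cons.prems(3) in auto)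
    show "vc S W (emits rs @ is) R s1"
    proof (rule Cons.IH[OF s1(1)])
      fix s2 assume s2: "rel stk ((out @ [ireg s r]) @ map (ireg s1) rs) s2" "rframe {42} {} s1 s2"
      show "vc S W is R s2"
        by (rule Cons.prems(4)) (use s2 eq rframe_trans[OF s1(2) s2(2), of "{42}" "{}"] in auto)
    qed (use Cons.prems in auto)
  qed (use Cons.prems in auto)
  then show ?case by (simp add: emits_def)
qed

lemma vc_push:
  assumes "rel stk out s" "length stk < N" "r \<noteq> 40" "ireg s r = int e"
    and "\<And>s'. rel (stk @ [e]) out s' \<Longrightarrow> rframe {40} {} s s' \<Longrightarrow> vc S W is R s'"
  shows "vc S W (push r @ is) R s"
proof -
  let ?s' = "effect (IAdd 40 40 21) (effect (IStore 40 r) s)"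
  note e = envD[OF relD(1)[OF assms(1)]] relD[OF assms(1)]
  have o: "nat (int SB + int (length stk)) = SB + length stk" by simp
  have rf: "rframe {40} {} s ?s'" by (simp add: rframe_def)
  have m: "imem ?s' = (imem s)(SB + length stk := ireg s r)" using e o by simp
  have env: "env ?s'"
    by (rule env_rframe[OF relD(1)[OF assms(1)] rf]) (use m n_less_NN in \<open>auto simp: SB_def\<close>)
  have tab: "tables (\<lambda>_ _ _. True) ?s'"
    by (rule tables_imem[of _ s]) (use assms(1) m in \<open>auto simp: SB_def rel_def\<close>)
  have "rel (stk @ [e]) out ?s'"
    using env tab e assms(1,2,4) SB_OB(1) unfolding rel_def m
    by (auto simp: nth_append less_Suc_eq)
  then have "vc S W is R ?s'" using assms(5) rf by blast
  moreover have "int SB + int (length stk) + 1 \<le> int W" "int SB + int (length stk) < int S"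
    using assms(2) W_S SB_OB by linarith+
  ultimately show ?thesis using e by (simp add: push_def)
qed

text \<open>Used for the count of a \<open>Strc\<close> node, which overwrites the 0 emitted in its
  place.\<close>

lemma rel_patch:
  assumes "rel stk (out1 @ x # out2) s"
  shows "rel stk (out1 @ v # out2) (s\<lparr>imem := (imem s)(OB + length out1 := v)\<rparr>)"
proof -
  let ?s' = "s\<lparr>imem := (imem s)(OB + length out1 := v)\<rparr>"
  have env: "env ?s'"
    by (rule env_rframe[OF relD(1)[OF assms(1)], where A = "{}" and B = "{}"])
       (use n_less_NN in \<open>auto simp: OB_def rframe_def\<close>)
  have tab: "tables (\<lambda>_ _ _. True) ?s'"
    by (rule tables_imem[of _ s]) (use assms(1) in \<open>auto simp: OB_def rel_def\<close>)
  show ?thesis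
    using env tab assms SB_OB(1) unfolding rel_def
    by (auto simp: nth_append nth_Cons' split: if_splits)
qed

lemma vc_regs:
  assumes "rel stk out s" "vc S W is1 (\<lambda>s'. frame A {} s s' \<and> P s') s"
    and "A \<inter> {0, 20, 21, 23, 24, 36, 37, 40, 41, 42, 54} = {}"
    and "\<And>s'. frame A {} s s' \<Longrightarrow> rel stk out s' \<Longrightarrow> P s' \<Longrightarrow> vc S W is2 R s'"
  shows "vc S W (is1 @ is2) R s"
  unfolding vc_append
  by (rule vc_mono[OF assms(2)]) (use rel_frame[OF assms(1) _ assms(3)] assms(4) in blast)

lemma addr_W:
  assumes "l < N" "i < N" "q \<le> 2"
  shows "int l * int N \<le> int W" "int l * int N + int i \<le> int W"
    "int l * int N + int i + int q * int NN \<le> int W" "int l * int N + int i + int q * int NN < int S"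
    "0 \<le> int l * int N" "int q * int NN \<le> int W"
proof -
  have "addr q i l < S" using addr_less[OF assms] S_bounds by simp
  moreover have "addr q i l \<le> W" using calculation W_S by simp
  ultimately have "int (l * N) \<le> int W" "int (l * N + i) \<le> int W" "int (q * NN) \<le> int W"
    "int (addr q i l) \<le> int W" "int (addr q i l) < int S"
    unfolding addr_def of_nat_le_iff of_nat_less_iff by linarith+
  then show "int l * int N \<le> int W" "int l * int N + int i \<le> int W"
    "int l * int N + int i + int q * int NN \<le> int W" "int l * int N + int i + int q * int NN < int S"
    "0 \<le> int l * int N" "int q * int NN \<le> int W" by (simp_all add: addr_def)
qed

lemma base_W: "i < n \<Longrightarrow> j < n \<Longrightarrow> \<bar>D ! j - base q i\<bar> \<le> int W"
  using D_diff_W[of j i] M[of j] M_W by (auto simp: base_def)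

lemma run_con:
  assumes "rel stk out s" "ireg s 46 = int l" "OB + length out + 2 \<le> S"
  shows "run S W con_prog s 5 (rel stk (out @ [0, int l]))"
  unfolding con_prog_def
  using vc_emits[OF assms(1), of "[23, 46]" "[]" "rel stk (out @ [0, int l])"] assms envD(4)[OF relD(1)[OF assms(1)]]
  by (intro run_block) (auto simp: emits_def emit_def)

lemma run_vec:
  assumes "rel stk out s" "ireg s 49 = int c" "ireg s 50 = int m" "ireg s 45 = int i" "ireg s 44 = int q"
    "i + m < n" "q \<le> 2" "OB + length out + 3 \<le> S" "length stk < N"
  shows "run S W vec_prog s 20 (rel (stk @ [addr q i m]) (out @ [1, int c, D ! (i + m) - D ! i]))"
  unfolding vec_prog_def
proof (rule run_block[OF vc_regs[OF assms(1), where A = "{10, 11, 12}"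
      and P = "\<lambda>s'. ireg s' 10 = D ! (i + m) - D ! i \<and> ireg s' 12 = int (addr q i m)"]])
  let ?R = "rel (stk @ [addr q i m]) (out @ [1, int c, D ! (i + m) - D ! i])"
  have iN: "i < N" "m < N" using assms(6) by (auto simp: N_def)
  show "vc S W [IAdd 10 45 50, ILoad 10 10, ILoad 11 45, ISub 10 10 11, IMul 12 50 20, IAdd 12 12 45,
      IMul 11 44 36, IAdd 12 12 11]
    (\<lambda>s'. frame {10, 11, 12} {} s s' \<and> ireg s' 10 = D ! (i + m) - D ! i \<and> ireg s' 12 = int (addr q i m)) s"
    using assms D_diff_W[of "i + m" i] N_W addr_W[OF iN(2,1) assms(7)] relD(1)[OF assms(1)]
    by (simp add: envD frame_def nat_int_add addr_def)
  fix s1 assume s1: "frame {10, 11, 12} {} s s1" "rel stk out s1"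
    "ireg s1 10 = D ! (i + m) - D ! i \<and> ireg s1 12 = int (addr q i m)"
  show "vc S W (emits [21, 49, 10] @ push 12) ?R s1"
  proof (rule vc_emits[OF s1(2)])
    fix s2 assume s2: "rel stk (out @ map (ireg s1) [21, 49, 10]) s2" "rframe {42} {} s1 s2"
    have R2: "rel stk (out @ [1, int c, D ! (i + m) - D ! i]) s2"
      using s2(1) s1(3) envD(3)[OF relD(1)[OF s1(2)]] assms(2) by (simp add: frameD(3)[OF s1(1)])
    have "ireg s2 12 = int (addr q i m)" using s1(3) by (simp add: rframeD[OF s2(2)])
    from vc_push[OF R2 assms(9) _ this, of "[]" ?R] show "vc S W (push 12) ?R s2" by simp
  qed (use assms(8) in auto)
qed (auto simp: emits_def emit_def push_def)

lemma vc_push_addr: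
  assumes "rel stk out s" "ireg s r = int l" "ireg s 45 = int i" "l < N" "i < N" "length stk < N" "r \<notin> {10}"
  shows "vc S W ([IMul 10 r 20, IAdd 10 10 45] @ push 10) (\<lambda>s'. rel (stk @ [addr 0 i l]) out s' \<and> rframe {10, 40} {} s s') s"
proof (rule vc_regs[OF assms(1), where A = "{10}"])
  show "vc S W [IMul 10 r 20, IAdd 10 10 45] (\<lambda>s'. frame {10} {} s s' \<and> ireg s' 10 = int (addr 0 i l)) s"
    using assms addr_W[OF assms(4,5), of 0] relD(1)[OF assms(1)]
    by (simp add: envD frame_def addr_def)
  fix s1 assume s1: "frame {10} {} s s1" "rel stk out s1" "ireg s1 10 = int (addr 0 i l)"
  show "vc S W (push 10) (\<lambda>s'. rel (stk @ [addr 0 i l]) out s' \<and> rframe {10, 40} {} s s') s1"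
  proof -
    have "vc S W (push 10 @ []) (\<lambda>s'. rel (stk @ [addr 0 i l]) out s' \<and> rframe {10, 40} {} s s') s1"
    proof (rule vc_push[OF s1(2) assms(6) _ s1(3)])
      fix s2 assume "rel (stk @ [addr 0 i l]) out s2" "rframe {40} {} s1 s2"
      then show "vc S W [] (\<lambda>s'. rel (stk @ [addr 0 i l]) out s' \<and> rframe {10, 40} {} s s') s2"
        using rframe_trans[OF frame_rframe[OF s1(1)], of "{40}" "{}" s2 "{10, 40}" "{}"] by simp
    qed simp
    then show ?thesis by simp
  qed
qed auto

lemma run_idx:
  assumes "rel stk out s" "ireg s 49 = int c" "ireg s 50 = int m" "ireg s 45 = int i" "ireg s 51 = base q i"
    "0 < m" "0 < c" "i + c * m \<le> n" "OB + length out + 2 + c \<le> S" "length stk < N"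
  shows "run S W idx_prog s (20 * N) (rel (stk @ [addr 0 i m])
    (out @ [2, int c] @ map (\<lambda>k. D ! (i + k * m) - base q i) [0..<c]))"
  unfolding idx_prog_def
proof -
  let ?xs = "\<lambda>k. map (\<lambda>k. D ! (i + k * m) - base q i) [0..<k]"
  let ?I = "\<lambda>k s'. rel stk (out @ [2, int c] @ ?xs k) s' \<and> ireg s' 52 = int k \<and> ireg s' 12 = int (i + k * m) \<and>
    ireg s' 49 = int c \<and> ireg s' 50 = int m \<and> ireg s' 45 = int i \<and> ireg s' 51 = base q i"
  note e = envD[OF relD(1)[OF assms(1)]]
  have "1 * m \<le> c * m" using assms(7) by (intro mult_le_mono1) simp
  then have mn: "m \<le> n" "m < N" using assms(8) n_less_N by linarith+
  have "c * 1 \<le> c * m" using assms(6) by (intro mult_le_mono2) simp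
  then have cN: "c < N" using assms(8) n_less_N unfolding mult_1_right by linarith
  have iN: "i < N" "i < n" using assms(8) \<open>1 * m \<le> c * m\<close> assms(6) n_less_N by linarith+
  let ?c0 = "[IConst 52 0, IAdd 12 45 23]"
  let ?body = "[ILoad 10 12, ISub 10 10 51] @ emit 10 @ [IAdd 12 12 50, IAdd 52 52 21]"
  show "run S W (Seq (block (?c0 @ emits [24, 49])) (Seq (While (ILess 52 49) (block ?body))
     (block ([IMul 10 50 20, IAdd 10 10 45] @ push 10)))) s (20 * N) (rel (stk @ [addr 0 i m]) (out @ [2, int c] @ ?xs c))"
  proof (rule run_seq[where ?t1.0 = 7 and ?t2.0 = "8 * N + 6" and ?R1.0 = "?I 0"])
    show "run S W (block (?c0 @ emits [24, 49])) s 7 (?I 0)"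
    proof (rule run_block[OF vc_regs[OF assms(1), where A = "{52, 12}"
          and P = "\<lambda>s'. ireg s' 52 = 0 \<and> ireg s' 12 = int i"]])
      show "vc S W ?c0 (\<lambda>s'. frame {52, 12} {} s s' \<and> ireg s' 52 = 0 \<and> ireg s' 12 = int i) s"
        using assms(4) iN N_W e by (simp add: frame_def)
      fix s1 assume s1: "frame {52, 12} {} s s1" "rel stk out s1" "ireg s1 52 = 0 \<and> ireg s1 12 = int i"
      have "vc S W (emits [24, 49] @ []) (?I 0) s1"
      proof (rule vc_emits[OF s1(2)])
        fix s2 assume s2: "rel stk (out @ map (ireg s1) [24, 49]) s2" "rframe {42} {} s1 s2"
        show "vc S W [] (?I 0) s2"
          using s2(1) s1(3) e assms(2-5) by (simp add: frameD[OF s1(1)] rframeD[OF s2(2)])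
      qed (use assms(9) in auto)
      then show "vc S W (emits [24, 49]) (?I 0) s1" by simp
    qed (auto simp: emits_def emit_def)
    fix s1 assume I: "?I 0 s1"
    show "run S W (Seq (While (ILess 52 49) (block ?body)) (block ([IMul 10 50 20, IAdd 10 10 45] @ push 10))) s1
      (8 * N + 6) (rel (stk @ [addr 0 i m]) (out @ [2, int c] @ ?xs c))"
    proof (rule run_seq[OF run_for[where I = ?I, OF I]])
      show "holds (ILess 52 49) s' \<longleftrightarrow> k < c" if "?I k s'" for k s' using that by simp
      fix k s2 assume k: "k < c" and I: "?I k s2"
      have ik: "i + k * m < n" "i + Suc k * m \<le> n"
      proof -
        have "Suc k * m \<le> c * m" using k by (intro mult_le_mono1) simp
        then show "i + Suc k * m \<le> n" using assms(8) by simp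
        then show "i + k * m < n" using assms(6) by simp
      qed
      note e2 = envD[OF relD(1)[OF conjunct1[OF I]]]
      show "run S W (block ?body) s2 7 (?I (Suc k))"
      proof (rule run_block)
        let ?P = "\<lambda>s'. ireg s' 10 = D ! (i + k * m) - base q i"
        have l: "int i + int k * int m = int (i + k * m)" by simp
        have v: "vc S W [ILoad 10 12, ISub 10 10 51] (\<lambda>s'. frame {10} {} s2 s' \<and> ?P s') s2"
          using I base_W[of i "i + k * m" q] ik iN N_W
          by (simp add: e2 frame_def l del: of_nat_add of_nat_mult)
        show "vc S W ?body (?I (Suc k)) s2"
        proof (rule vc_regs[OF conjunct1[OF I] v])
          fix s3 assume s3: "frame {10} {} s2 s3" "rel stk (out @ [2, int c] @ ?xs k) s3" "?P s3"
          show "vc S W (emit 10 @ [IAdd 12 12 50, IAdd 52 52 21]) (?I (Suc k)) s3"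
          proof (rule vc_emit[OF s3(2)])
            fix s4 assume s4: "rel stk ((out @ [2, int c] @ ?xs k) @ [ireg s3 10]) s4" "rframe {42} {} s3 s4"
            have s4': "rel stk (out @ [2, int c] @ ?xs (Suc k)) s4" using s4(1) s3(3) by simp
            have r4: "ireg s4 52 = int k" "ireg s4 12 = int (i + k * m)" "ireg s4 49 = int c"
              "ireg s4 50 = int m" "ireg s4 45 = int i" "ireg s4 51 = base q i"
              using I by (simp_all add: frameD[OF s3(1)] rframeD[OF s4(2)])
            have "int (i + Suc k * m) \<le> int W" "int k + 1 \<le> int W" using ik N_W k cN by linarith+
            then have "vc S W [IAdd 12 12 50, IAdd 52 52 21] (\<lambda>s'. frame {12, 52} {} s4 s' \<and>
                ireg s' 52 = int (Suc k) \<and> ireg s' 12 = int (i + Suc k * m)) s4"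
              using r4 envD[OF relD(1)[OF s4']] by (simp add: frame_def algebra_simps)
            then show "vc S W [IAdd 12 12 50, IAdd 52 52 21] (?I (Suc k)) s4"
            proof (rule vc_mono)
              fix s5 assume s5: "frame {12, 52} {} s4 s5 \<and> ireg s5 52 = int (Suc k) \<and> ireg s5 12 = int (i + Suc k * m)"
              have "rel stk (out @ [2, int c] @ ?xs (Suc k)) s5" by (rule rel_frame[OF s4' conjunct1[OF s5]]) auto
              then show "?I (Suc k) s5" using s5 r4(3-6) by (simp add: frameD(3)[OF conjunct1[OF s5]])
            qed
          qed (use assms(9) k in auto)
        qed auto
      qed (simp add: emit_def)
    next
      fix s2 assume I: "?I c s2"
      have r: "ireg s2 50 = int m" "ireg s2 45 = int i" using I by auto
      show "run S W (block ([IMul 10 50 20, IAdd 10 10 45] @ push 10)) s2 5 (rel (stk @ [addr 0 i m]) (out @ [2, int c] @ ?xs c))"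
      proof (rule run_block[OF vc_mono[OF vc_push_addr[OF conjunct1[OF I] r mn(2) iN(1) assms(10)]]])
      qed (auto simp: push_def)
    next
      show "(c - 0) * (7 + 1) + 1 \<le> 8 * N + 1" using cN by simp
    qed auto
  qed (use N_ge_2 in simp)
qed

lemma cut_le: "0 < l \<Longrightarrow> 0 < C 2 i l \<and> C 2 i l \<le> l"
  using cut_cases[of l i] by auto

lemma run_strc:
  assumes "rel stk out s" "ireg s 45 = int i" "ireg s 46 = int l" "ireg s 51 = base q i"
    "0 < l" "i + l \<le> n" "OB + length out + 2 + length (starts i l) \<le> S" "length stk < N"
  shows "run S W strc_prog s (40 * N) (rel (stk @ [addr 2 i l])
    (out @ [3, int (length (starts i l))] @ map (\<lambda>j. D ! j - base q i) (starts i l)))"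
  unfolding strc_prog_def
proof -
  let ?f = "\<lambda>j. D ! j - base q i"
  \<comment> \<open>\<open>starts pos 0\<close> is \<open>[pos]\<close>, not \<open>[]\<close>,
    hence the case distinction. The remaining length \<open>rem\<close> also serves as the measure,
    since pieces differ in length.\<close>
  let ?I = "\<lambda>rem s'. \<exists>done pos. starts i l = done @ (if rem = 0 then [] else starts pos rem) \<and> pos + rem = i + l \<and>
    rel stk (out @ 3 # 0 # map ?f done) s' \<and> ireg s' 52 = int (length done) \<and> ireg s' 12 = int pos \<and> ireg s' 13 = int rem \<and>
    ireg s' 53 = int (OB + length (out @ [3])) \<and> ireg s' 45 = int i \<and> ireg s' 46 = int l \<and> ireg s' 51 = base q i"
  note e = envD[OF relD(1)[OF assms(1)]]
  have iN: "i < N" "i < n" "l < N" using assms(5,6) by (auto simp: N_def)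
  let ?c0 = "[IConst 10 3, IAdd 53 42 21, IConst 52 0, IAdd 12 45 23, IAdd 13 46 23]"
  let ?c1 = "[IAdd 52 52 21, IMul 10 13 20, IAdd 10 10 12, IAdd 10 10 37, ILoad 10 10, IAdd 12 12 10, ISub 13 13 10]"
  let ?body = "[ILoad 10 12, ISub 10 10 51] @ emit 10 @ ?c1"
  let ?fin = "[IStore 53 52, IMul 10 46 20, IAdd 10 10 45, IAdd 10 10 37] @ push 10"
  let ?P = "\<lambda>s'. ireg s' 10 = 3 \<and> ireg s' 53 = int (OB + length (out @ [3])) \<and>
    ireg s' 52 = 0 \<and> ireg s' 12 = int i \<and> ireg s' 13 = int l"
  let ?R = "rel (stk @ [addr 2 i l]) (out @ [3, int (length (starts i l))] @ map ?f (starts i l))"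
  show "run S W (Seq (block (?c0 @ emits [10, 23])) (Seq (While (ILess 23 13) (block ?body)) (block ?fin))) s (40 * N) ?R"
  proof (rule run_seq[where ?t1.0 = 10 and ?t2.0 = "13 * N + 10" and ?R1.0 = "?I l"])
    show "run S W (block (?c0 @ emits [10, 23])) s 10 (?I l)"
    proof (rule run_block[OF vc_regs[OF assms(1), where A = "{10, 53, 52, 12, 13}" and P = ?P]])
      have "3 \<le> W" "int (OB + length (out @ [3])) \<le> int W" using S_bounds assms(7) W_S by auto
      then show "vc S W ?c0 (\<lambda>s'. frame {10, 53, 52, 12, 13} {} s s' \<and> ?P s') s"
        using assms(2,3) e relD(6)[OF assms(1)] iN N_W by (simp add: frame_def)
      fix s1 assume s1: "frame {10, 53, 52, 12, 13} {} s s1" "rel stk out s1" "?P s1"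
      have "vc S W (emits [10, 23] @ []) (?I l) s1"
      proof (rule vc_emits[OF s1(2)])
        fix s2 assume s2: "rel stk (out @ map (ireg s1) [10, 23]) s2" "rframe {42} {} s1 s2"
        show "vc S W [] (?I l) s2" unfolding vc.simps
          using s2(1) s1(3) e assms(2-5)
          by (intro exI[of _ "[]"] exI[of _ i]) (simp add: frameD[OF s1(1)] rframeD[OF s2(2)])
      qed (use assms(7) in auto)
      then show "vc S W (emits [10, 23]) (?I l) s1" by simp
    qed (auto simp: emits_def emit_def)
    fix s1 assume I: "?I l s1"
    show "run S W (Seq (While (ILess 23 13) (block ?body)) (block ?fin)) s1 (13 * N + 10) ?R"
    proof (rule run_seq[OF run_While[where I = ?I and tb = 12, OF I]])
      show "l * (12 + 1) + 1 \<le> 13 * N + 1" using iN by simp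
      fix rem s2 assume I: "?I rem s2" and h: "holds (ILess 23 13) s2"
      obtain "done" pos where I: "starts i l = done @ (if rem = 0 then [] else starts pos rem)" "pos + rem = i + l"
        "rel stk (out @ 3 # 0 # map ?f done) s2" "ireg s2 52 = int (length done)" "ireg s2 12 = int pos" "ireg s2 13 = int rem"
        "ireg s2 53 = int (OB + length (out @ [3]))" "ireg s2 45 = int i" "ireg s2 46 = int l" "ireg s2 51 = base q i"
        using I by blast
      note e2 = envD[OF relD(1)[OF I(3)]]
      have rem: "0 < rem" using h I(6) e2 by simp
      have pN: "pos < n" "pos < N" "rem < N" "pos + rem \<le> n" using I(2) rem assms(6) by (auto simp: N_def)
      define c where "c = C 2 pos rem"
      have c: "0 < c" "c \<le> rem" using cut_le[OF rem] by (auto simp: c_def)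
      have st: "starts i l = (done @ [pos]) @ (if rem - c = 0 then [] else starts (pos + c) (rem - c))"
        using I(1) rem c starts.simps[of pos rem] by (simp add: c_def)
      have dl: "Suc (length done) \<le> length (starts i l)" using st by simp
      show "run S W (block ?body) s2 12 (\<lambda>s'. \<exists>j<rem. ?I j s')"
      proof (rule run_block[OF vc_regs[OF I(3), where A = "{10}" and P = "\<lambda>s'. ireg s' 10 = ?f pos"]])
        show "vc S W [ILoad 10 12, ISub 10 10 51] (\<lambda>s'. frame {10} {} s2 s' \<and> ireg s' 10 = ?f pos) s2"
          using I base_W[of i pos q] pN iN N_W e2 by (simp add: frame_def)
        fix s3 assume s3: "frame {10} {} s2 s3" "rel stk (out @ 3 # 0 # map ?f done) s3" "ireg s3 10 = ?f pos"
        show "vc S W (emit 10 @ ?c1) (\<lambda>s'. \<exists>j<rem. ?I j s') s3"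
        proof (rule vc_emit[OF s3(2)])
          fix s4 assume s4: "rel stk ((out @ 3 # 0 # map ?f done) @ [ireg s3 10]) s4" "rframe {42} {} s3 s4"
          have s4': "rel stk (out @ 3 # 0 # map ?f (done @ [pos])) s4" using s4(1) s3(3) by simp
          have r4: "ireg s4 52 = int (length done)" "ireg s4 12 = int pos" "ireg s4 13 = int rem"
             "ireg s4 53 = int (OB + length (out @ [3]))" "ireg s4 45 = int i" "ireg s4 46 = int l" "ireg s4 51 = base q i"
            using I by (simp_all add: frameD[OF s3(1)] rframeD[OF s4(2)])
          have "imem s4 (addr 2 pos rem) = int c"
            using relD(8)[OF s4', of 2 rem pos] rem pN by (simp add: c_def)
          moreover have "int rem * int N + int pos + 2 * int NN = int (addr 2 pos rem)" by (simp add: addr_def)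
          ultimately have ld: "imem s4 (nat (int rem * int N + int pos + 2 * int NN)) = int c" by simp
          have b: "int (length done) + 1 \<le> int W" "int pos + int c \<le> int W" "rem - c \<le> W"
            using dl assms(7) W_S pN c N_W by linarith+
          have "vc S W ?c1 (\<lambda>s'. frame {52, 10, 12, 13} {} s4 s' \<and> ireg s' 52 = int (length (done @ [pos])) \<and>
             ireg s' 12 = int (pos + c) \<and> ireg s' 13 = int (rem - c)) s4"
            using r4 envD[OF relD(1)[OF s4']] addr_W[OF pN(3,2), of 2] ld b c(2)
            by (simp add: frame_def of_nat_diff)
          then show "vc S W ?c1 (\<lambda>s'. \<exists>j<rem. ?I j s') s4"
          proof (rule vc_mono)
            fix s5 assume s5: "frame {52, 10, 12, 13} {} s4 s5 \<and> ireg s5 52 = int (length (done @ [pos])) \<and>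
               ireg s5 12 = int (pos + c) \<and> ireg s5 13 = int (rem - c)"
            have r5: "rel stk (out @ 3 # 0 # map ?f (done @ [pos])) s5" by (rule rel_frame[OF s4' conjunct1[OF s5]]) auto
            have "?I (rem - c) s5"
            proof (intro exI conjI)
              show "pos + c + (rem - c) = i + l" using I(2) c by simp
              show "ireg s5 53 = int (OB + length (out @ [3]))" "ireg s5 45 = int i" "ireg s5 46 = int l" "ireg s5 51 = base q i"
                using r4 by (simp_all add: frameD(3)[OF conjunct1[OF s5]])
            qed (use st r5 s5 in auto)
            then show "\<exists>j<rem. ?I j s5" using c by (intro exI[of _ "rem - c"]) auto
          qed
        qed (use assms(7) dl in auto)
      qed (simp_all add: emit_def)
    next
      fix s2 assume "(\<exists>rem. ?I rem s2) \<and> \<not> holds (ILess 23 13) s2"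
      then obtain rem "done" pos where I: "starts i l = done @ (if rem = 0 then [] else starts pos rem)" "pos + rem = i + l"
        "rel stk (out @ 3 # 0 # map ?f done) s2" "ireg s2 52 = int (length done)" "ireg s2 12 = int pos" "ireg s2 13 = int rem"
        "ireg s2 53 = int (OB + length (out @ [3]))" "ireg s2 45 = int i" "ireg s2 46 = int l" "ireg s2 51 = base q i"
        and h: "\<not> holds (ILess 23 13) s2" by blast
      have d: "done = starts i l" using I(1) h I(6) envD[OF relD(1)[OF I(3)]] by (simp split: if_splits)
      let ?s3 = "effect (IStore 53 52) s2"
      have eq: "?s3 = s2\<lparr>imem := (imem s2)(OB + length (out @ [3]) := int (length (starts i l)))\<rparr>"
        by (simp only: effect.simps I(4,7) d nat_int)
      have "rel stk ((out @ [3]) @ 0 # map ?f done) s2" using I(3) by simp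
      from rel_patch[OF this, of "int (length (starts i l))"]
      have r3: "rel stk (out @ [3, int (length (starts i l))] @ map ?f (starts i l)) ?s3"
        unfolding eq d by simp
      note e3 = envD[OF relD(1)[OF r3]]
      show "run S W (block ?fin) s2 7 ?R"
      proof (rule run_block)
        have v: "vc S W ([IMul 10 46 20, IAdd 10 10 45, IAdd 10 10 37] @ push 10) ?R ?s3"
        proof (rule vc_regs[OF r3, where A = "{10}" and P = "\<lambda>s'. ireg s' 10 = int (addr 2 i l)"])
          show "vc S W [IMul 10 46 20, IAdd 10 10 45, IAdd 10 10 37] (\<lambda>s'. frame {10} {} ?s3 s' \<and> ireg s' 10 = int (addr 2 i l)) ?s3"
            using I(8,9) addr_W[OF iN(3,1), of 2] relD(1)[OF r3] e3 by (simp add: frame_def addr_def)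
          fix s4 assume s4: "rel stk (out @ [3, int (length (starts i l))] @ map ?f (starts i l)) s4" "ireg s4 10 = int (addr 2 i l)"
          show "vc S W (push 10) ?R s4"
            using vc_push[OF s4(1) assms(8) _ s4(2), of "[]" ?R] by simp
        qed auto
        have "safe S W (IStore 53 52) s2" using I(7) assms(7) by simp
        then show "vc S W ?fin ?R s2" using v by simp
      qed (simp add: push_def)
    qed auto
  qed (use N_ge_2 in simp)
qed

lemma run_rest:
  assumes "rel stk out s" "ireg s 45 = int i" "ireg s 46 = int l" "ireg s 47 = int m"
    "0 < m" "m \<le> l" "i + l \<le> n" "length stk + 1 < N"
  shows "run S W rest_prog s 16 (rel (stk @ (if m < l then [addr 2 (i + m) (l - m)] else []) @ [addr 0 i m]) out)"
  unfolding rest_prog_def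
proof (rule run_seq[where ?t1.0 = 9 and ?t2.0 = 6])
  note e = envD[OF relD(1)[OF assms(1)]]
  let ?stk = "stk @ (if m < l then [addr 2 (i + m) (l - m)] else [])"
  let ?I = "\<lambda>s'. rel ?stk out s' \<and> ireg s' 45 = int i \<and> ireg s' 47 = int m"
  let ?c = "[ISub 10 46 47, IMul 10 10 20, IAdd 10 10 45, IAdd 10 10 47, IAdd 10 10 37]"
  show "run S W (If (ILess 47 46) (block (?c @ push 10)) Skip) s 9 ?I"
  proof (rule run_If[where ?t0.0 = 8])
    assume "holds (ILess 47 46) s"
    then have ml: "m < l" using assms by simp
    define d where "d = l - m"
    have d: "int l - int m = int d" "d < N" "i + m < N" "d \<le> W" using ml assms(7) N_W by (auto simp: d_def N_def)
    have "addr 2 (i + m) d < S" using addr_less[OF d(2,3), of 2] S_bounds by simp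
    then have "int (d * N) \<le> int W" "int (d * N + i) \<le> int W" "int (d * N + i + m) \<le> int W"
      "int (d * N + i + m + 2 * NN) \<le> int W"
      using W_S unfolding addr_def of_nat_le_iff of_nat_less_iff by linarith+
    then have b: "int d * int N \<le> int W" "int d * int N + int i \<le> int W" "int d * int N + int i + int m \<le> int W"
      "int d * int N + int i + int m + 2 * int NN \<le> int W" "0 \<le> int d * int N" by simp_all
    show "run S W (block (?c @ push 10)) s 8 ?I"
    proof (rule run_block[OF vc_regs[OF assms(1), where A = "{10}" and P = "\<lambda>s'. ireg s' 10 = int (addr 2 (i + m) d)"]])
      show "vc S W ?c (\<lambda>s'. frame {10} {} s s' \<and> ireg s' 10 = int (addr 2 (i + m) d)) s"
        using assms(2-4) e b d(1,4) by (simp add: frame_def addr_def)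
      fix s1 assume s1: "frame {10} {} s s1" "rel stk out s1" "ireg s1 10 = int (addr 2 (i + m) d)"
      have "vc S W (push 10 @ []) ?I s1"
      proof (rule vc_push[OF s1(2) _ _ s1(3)])
        fix s2 assume s2: "rel (stk @ [addr 2 (i + m) d]) out s2" "rframe {40} {} s1 s2"
        then show "vc S W [] ?I s2" using ml assms(2,4) frameD(3)[OF s1(1)] by (simp add: d_def rframeD[OF s2(2)])
      qed (use assms(8) in auto)
      then show "vc S W (push 10) ?I s1" by simp
    qed (auto simp: push_def)
  next
    assume "\<not> holds (ILess 47 46) s"
    then show "run S W Skip s 8 ?I" using assms by (intro run_Skip) auto
  qed simp
  fix s1 assume I: "?I s1"
  show "run S W (block ([IMul 10 47 20, IAdd 10 10 45] @ push 10)) s1 6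
     (rel (stk @ (if m < l then [addr 2 (i + m) (l - m)] else []) @ [addr 0 i m]) out)"
  proof (rule run_block[OF vc_mono[OF vc_push_addr[of ?stk out s1 47 m i]]])
  qed (use I assms in \<open>auto simp: push_def N_def\<close>)
qed simp

end

section \<open>The main loop of the second phase\<close>

definition rebuild_prog :: prog where
  "rebuild_prog = Seq (block [ILoad 10 23, IAdd 41 36 37, IAdd 54 41 20, IAdd 42 54 23, IAdd 40 41 23, IMul 43 0 20])
     (Seq (If (IEq 10 23) Skip (block [IAdd 43 43 36]))
     (Seq (block (push 43)) (Seq (While (ILess 41 40) item_prog) (block [IAdd 0 54 23]))))"

definition enc :: "btree list \<Rightarrow> int list" where
  "enc Ts = concat (map encode Ts)"

lemma enc_simps [simp]: "enc [] = []" "enc (T # Ts) = encode T @ enc Ts" "enc (Ts @ Us) = enc Ts @ enc Us"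
  by (simp_all add: enc_def)

text \<open>
  The termination measure of the second phase. Popping a partition emits nothing, so it is charged
  once for each of its pieces.
\<close>

fun weight :: "nat \<times> nat \<times> nat \<Rightarrow> btree list \<Rightarrow> nat" where
  "weight (q, i, l) Ts = length (enc Ts) + (if q = 2 then length Ts else 0)"

context ram
begin

fun item_addr :: "nat \<times> nat \<times> nat \<Rightarrow> nat" where
  "item_addr (q, i, l) = addr q i l"

fun pending :: "nat \<times> nat \<times> nat \<Rightarrow> btree list \<Rightarrow> bool" where
  "pending (q, i, l) Ts \<longleftrightarrow> q \<le> 2 \<and> i + l \<le> n \<and> rep q i l Ts"

text \<open>The top of the stack is the last entry of the list, hence \<open>rev\<close>: what is
  still missing from the output is the encoding of the stacked trees from the top down. The total
  length of the stacked segments bounds the height of the stack.\<close>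

definition work :: "btree \<Rightarrow> nat \<Rightarrow> state \<Rightarrow> bool" where
  "work T j s \<longleftrightarrow> (\<exists>stk Tss out. rel (map item_addr stk) out s \<and> list_all2 pending stk Tss \<and>
     encode T = out @ enc (concat (rev Tss)) \<and> sum_list (map (snd \<circ> snd) stk) \<le> n \<and>
     j = sum_list (map2 weight stk Tss))"

lemma pending_length: "list_all2 pending stk Tss \<Longrightarrow> length stk \<le> sum_list (map (snd \<circ> snd) stk)"
proof (induction rule: list_all2_induct)
  case (Cons x xs y ys)
  obtain q i l where x: "x = (q, i, l)" by (cases x)
  then have "0 < l" using Cons rep_sound[of q i l y] by simp
  then show ?case using Cons x by simp
qed simp

lemma run_pop:
  assumes "rel (stk @ [addr q i l]) out s" "q \<le> 2" "0 < l" "i + l \<le> n"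
  shows "run S W (block [ISub 40 40 21, ILoad 43 40, ILoad 47 43, IMod 45 43 20, IDiv 10 43 20,
       IMod 46 10 20, IDiv 44 10 20]) s 8 (\<lambda>s'. rel stk out s' \<and> ireg s' 47 = int (C q i l) \<and>
       ireg s' 45 = int i \<and> ireg s' 46 = int l \<and> ireg s' 44 = int q)"
proof (rule run_block)
  note e = envD[OF relD(1)[OF assms(1)]]
  let ?c = "[ISub 40 40 21, ILoad 43 40, ILoad 47 43, IMod 45 43 20, IDiv 10 43 20, IMod 46 10 20, IDiv 44 10 20]"
  let ?P = "\<lambda>s'. ireg s' 47 = int (C q i l) \<and> ireg s' 45 = int i \<and> ireg s' 46 = int l \<and> ireg s' 44 = int q"
  let ?a = "addr q i l"
  let ?A = "{40, 43, 47, 45, 10, 46, 44}"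
  have lN: "l < N" "i < N" using assms(3,4) by (auto simp: N_def)
  have dec: "int ?a mod int N = int i" "int ?a div int N mod int N = int l" "int ?a div int N div int N = int q"
    using addr_decode[OF lN, of q] by (simp_all flip: of_nat_mod of_nat_div)
  have "?a div N \<le> ?a" by simp
  moreover have a: "?a < S" using addr_less[OF lN assms(2)] S_bounds by simp
  ultimately have "?a div N \<le> W" using W_S by linarith
  then have dW: "int ?a div int N \<le> int W" "0 \<le> int ?a div int N" by (simp_all flip: of_nat_div)
  have ld: "imem s (SB + length stk) = int ?a" "imem s ?a = int (C q i l)"
    using relD(7)[OF assms(1), of "length stk"] relD(8)[OF assms(1,2,3,4)] by auto
  have k: "ireg s 40 = int (SB + length stk) + 1" using relD(5)[OF assms(1)] by simp
  have "length stk < N" using relD(2)[OF assms(1)] by simp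
  then have sW: "int (SB + length stk) \<le> int W" "int (SB + length stk) < int S" using SB_OB W_S by linarith+
  have sm: "i \<le> W" "l \<le> W" "q \<le> W" using lN N_W assms(2) S_bounds W_S by auto
  have "vc S W ?c (\<lambda>s'. frame ?A {} s s' \<and> ireg s' 40 = int (SB + length stk) \<and> ?P s') s"
    using e k ld dec dW sW sm a
    by (simp add: frame_def del: of_nat_add)
  then show "vc S W ?c (\<lambda>s'. rel stk out s' \<and> ?P s') s"
  proof (rule vc_mono)
    fix s' assume a: "frame ?A {} s s' \<and> ireg s' 40 = int (SB + length stk) \<and> ?P s'"
    have f: "frame ?A {} s s'" using a by simp
    have "env s'" by (rule env_frame[OF relD(1)[OF assms(1)] f]) auto
    moreover have "tables (\<lambda>_ _ _. True) s'" using assms(1) tables_frame[OF _ f] by (simp add: rel_def)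
    ultimately have "rel stk out s'"
      using assms(1) a by (auto simp: rel_def frameD[OF f] nth_append)
    then show "rel stk out s' \<and> ?P s'" using a by simp
  qed
qed simp

lemma run_node_prefix:
  assumes "rel stk out s" "ireg s 47 = int c" "ireg s 45 = int i" "ireg s 46 = int l" "ireg s 44 = int q" "i < n"
    and "\<And>s'. rel stk out s' \<Longrightarrow> ireg s' 49 = int (c div 2) \<Longrightarrow> ireg s' 48 = int (c mod 2) \<Longrightarrow>
      ireg s' 45 = int i \<Longrightarrow> ireg s' 46 = int l \<Longrightarrow> ireg s' 44 = int q \<Longrightarrow> ireg s' 51 = base q i \<Longrightarrow>
      run S W dispatch_prog s' t R"
  shows "run S W node_prog s (t + 8) R"
  unfolding node_prog_def
proof (rule run_seq[where ?t1.0 = 4 and ?t2.0 = "t + 4"])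
  note e = envD[OF relD(1)[OF assms(1)]]
  let ?b = "\<lambda>s'. ireg s' 49 = int (c div 2) \<and> ireg s' 48 = int (c mod 2)"
  show "run S W (block [IConst 51 0, IDiv 49 47 24, IMod 48 47 24]) s 4
    (\<lambda>s'. frame {51, 49, 48} {} s s' \<and> ireg s' 51 = 0 \<and> ?b s')"
  proof (rule run_fits)
    assume "fits W s"
    then have "\<bar>ireg s 47\<bar> \<le> int W" by (simp add: fits_def)
    then have "c \<le> W" using assms(2) by simp
    then have "c div 2 \<le> W" by (rule le_trans[OF div_le_dividend])
    moreover have "int c mod 2 < 2" by simp
    ultimately have "int c div 2 \<le> int W" "int c mod 2 \<le> int W" using N_W N_ge_2 by linarith+
    then show "run S W (block [IConst 51 0, IDiv 49 47 24, IMod 48 47 24]) s 4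
      (\<lambda>s'. frame {51, 49, 48} {} s s' \<and> ireg s' 51 = 0 \<and> ?b s')"
      using assms(2) e by (intro run_block) (auto simp: frame_def zdiv_int zmod_int)
  qed
  fix s1 assume s1: "frame {51, 49, 48} {} s s1 \<and> ireg s1 51 = 0 \<and> ?b s1"
  have R1: "rel stk out s1" by (rule rel_frame[OF assms(1) conjunct1[OF s1]]) auto
  have r1: "ireg s1 45 = int i" "ireg s1 46 = int l" "ireg s1 44 = int q"
    using assms(3-5) by (simp_all add: frameD[OF conjunct1[OF s1]])
  note e1 = envD[OF relD(1)[OF R1]]
  show "run S W (Seq (If (IEq 44 23) (block [ILoad 51 45]) Skip) dispatch_prog) s1 (t + 4) R"
  proof (rule run_seq[where ?t1.0 = 3 and ?t2.0 = t])
    show "run S W (If (IEq 44 23) (block [ILoad 51 45]) Skip) s1 3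
      (\<lambda>s'. frame {51} {} s1 s' \<and> ireg s' 51 = base q i)"
      by (intro run_If[where ?t0.0 = 2] run_block run_Skip;
          use s1 r1 e1 assms(6) N_W in \<open>auto simp: frame_def base_def\<close>)
    fix s2 assume s2: "frame {51} {} s1 s2 \<and> ireg s2 51 = base q i"
    show "run S W dispatch_prog s2 t R"
      by (rule assms(7)[OF rel_frame[OF R1 conjunct1[OF s2]]])
        (use s1 s2 r1 in \<open>auto simp: frameD(3)[OF conjunct1[OF s2]]\<close>)
  qed simp
qed simp

lemma run_dispatch_leaf:
  assumes "rel stk out s" "ireg s 49 = 0" "ireg s 48 = int b"
    "run S W (if b = 0 then con_prog else strc_prog) s t R"
  shows "run S W dispatch_prog s (t + 2) R"
  unfolding dispatch_prog_def
  by (intro run_If[where ?t0.0 = "t + 1"] run_If[where ?t0.0 = t])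
     (use assms envD(4)[OF relD(1)[OF assms(1)]] in \<open>auto split: if_splits\<close>)

lemma run_dispatch_block:
  assumes "rel stk out s" "ireg s 49 = int c" "0 < c" "ireg s 48 = int b" "ireg s 46 = int (c * m)" "c * m \<le> n"
    "ireg s 45 = int i" "ireg s 44 = int q" "ireg s 51 = base q i"
    "\<And>s'. rel stk out s' \<Longrightarrow> ireg s' 49 = int c \<Longrightarrow> ireg s' 50 = int m \<Longrightarrow> ireg s' 45 = int i \<Longrightarrow>
      ireg s' 44 = int q \<Longrightarrow> ireg s' 51 = base q i \<Longrightarrow> run S W (if b = 0 then vec_prog else idx_prog) s' t R"
  shows "run S W dispatch_prog s (t + 4) R"
  unfolding dispatch_prog_def
proof (rule run_If[where ?t0.0 = "t + 3"])
  note e = envD[OF relD(1)[OF assms(1)]]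
  show "run S W (If (IEq 48 23) con_prog strc_prog) s (t + 3) R" if "holds (IEq 49 23) s" using that assms e by simp
  show "run S W (Seq (block [IDiv 50 46 49]) (If (IEq 48 23) vec_prog idx_prog)) s (t + 3) R"
  proof (rule run_seq[where ?t1.0 = 2 and ?t2.0 = "t + 1"])
    have "m = (c * m) div c" using assms(3) by simp
    also have "\<dots> \<le> c * m" by (rule div_le_dividend)
    finally have "m \<le> W" using assms(6) N_W by linarith
    then show "run S W (block [IDiv 50 46 49]) s 2 (\<lambda>s'. frame {50} {} s s' \<and> ireg s' 50 = int m)"
      using assms(2,3,5) by (intro run_block) (auto simp: frame_def)
    fix s1 assume s1: "frame {50} {} s s1 \<and> ireg s1 50 = int m"
    then have f: "frame {50} {} s s1" by simp
    have R1: "rel stk out s1" by (rule rel_frame[OF assms(1) f]) auto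
    have "run S W (if b = 0 then vec_prog else idx_prog) s1 t R"
      by (rule assms(10)[OF R1]) (use s1 assms in \<open>auto simp: frameD(3)[OF f]\<close>)
    then show "run S W (If (IEq 48 23) vec_prog idx_prog) s1 (t + 1) R"
      by (intro run_If[where ?t0.0 = t])
        (use assms(4) envD(4)[OF relD(1)[OF R1]] in \<open>auto simp: frameD(3)[OF f] split: if_splits\<close>)
  qed simp
qed simp

text \<open>Every case of \<open>run_item\<close> replaces the top item by items for its parts after
  emitting some words. This leaves only facts about that item to be checked.\<close>

lemma work_step:
  assumes "list_all2 pending stk Tss" "encode T = out @ enc (concat (rev (Tss @ [Ts])))"
    "sum_list (map (snd \<circ> snd) (stk @ [x])) \<le> n"
    "rel (map item_addr (stk @ new)) (out @ em) s" "list_all2 pending new newT"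
    "em @ enc (concat (rev newT)) = enc Ts" "sum_list (map (snd \<circ> snd) new) \<le> snd (snd x)"
    "sum_list (map2 weight new newT) < weight x Ts"
  shows "\<exists>j<sum_list (map2 weight (stk @ [x]) (Tss @ [Ts])). work T j s"
proof (intro exI conjI)
  have len: "length stk = length Tss" using assms(1) by (rule list_all2_lengthD)
  show "sum_list (map2 weight (stk @ new) (Tss @ newT)) < sum_list (map2 weight (stk @ [x]) (Tss @ [Ts]))"
    using len assms(8) by simp
  show "work T (sum_list (map2 weight (stk @ new) (Tss @ newT))) s"
    unfolding work_def
    by (intro exI[of _ "stk @ new"] exI[of _ "Tss @ newT"] exI[of _ "out @ em"] conjI)
       (use assms in \<open>auto intro: list_all2_appendI\<close>)
qed

lemma run_item:
  assumes "work T j s" "holds (ILess 41 40) s" "length (encode T) \<le> Q * N"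
  shows "run S W item_prog s (60 * N) (\<lambda>s'. \<exists>j'<j. work T j' s')"
proof -
  obtain stk' Tss' out where w: "rel (map item_addr stk') out s" "list_all2 pending stk' Tss'"
    "encode T = out @ enc (concat (rev Tss'))" "sum_list (map (snd \<circ> snd) stk') \<le> n"
    "j = sum_list (map2 weight stk' Tss')"
    using assms(1) unfolding work_def by blast
  have "stk' \<noteq> []" using assms(2) relD(3,5)[OF w(1)] by auto
  then obtain stk x where stk: "stk' = stk @ [x]" by (metis rev_exhaust)
  obtain q i l where x: "x = (q, i, l)" by (cases x)
  obtain Tss Ts where Tss: "Tss' = Tss @ [Ts]" "list_all2 pending stk Tss" "pending x Ts"
    using w(2) unfolding stk by (auto simp: list_all2_append1 list_all2_Cons1)
  have ok: "q \<le> 2" "i + l \<le> n" "rep q i l Ts" using Tss(3) x by auto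
  have l: "0 < l" using rep_sound[OF ok(3)] by simp
  \<comment> \<open>Each stacked item covers at least one entry of \<open>D\<close>, so after the
    pop there is room for two more.\<close>
  have "length stk + l \<le> n" using pending_length[OF Tss(2)] w(4) stk x by simp
  then have sl: "length (map item_addr stk) + 1 < N" using l by (simp add: N_def)
  have "length out + length (enc Ts) \<le> Q * N"
    using assms(3) unfolding w(3) Tss(1) by simp
  then have oS: "OB + length out + length (enc Ts) \<le> S" using SB_OB by linarith
  note step = work_step[OF Tss(2) w(3)[unfolded Tss(1)] w(4)[unfolded stk], unfolded x]
  let ?R = "\<lambda>s'. \<exists>j'<j. work T j' s'"
  have j: "j = sum_list (map2 weight (stk @ [(q, i, l)]) (Tss @ [Ts]))" using w(5) stk Tss(1) x by simp
  show ?thesis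
    unfolding item_prog_def
  proof (rule run_seq[OF run_pop[of "map item_addr stk" q i l out]])
    show "rel (map item_addr stk @ [addr q i l]) out s" using w(1) stk x by simp
    fix s1 assume s1: "rel (map item_addr stk) out s1 \<and> ireg s1 47 = int (C q i l) \<and>
       ireg s1 45 = int i \<and> ireg s1 46 = int l \<and> ireg s1 44 = int q"
    then have R1: "rel (map item_addr stk) out s1" and r1: "ireg s1 47 = int (C q i l)" "ireg s1 45 = int i"
      "ireg s1 46 = int l" "ireg s1 44 = int q" by auto
    have il: "i < n" using l ok(2) by simp
    have rest: "run S W rest_prog s1 (50 * N) ?R" if q: "q = 2"
    proof -
      define m where "m = C 2 i l"
      have m: "0 < m" "m \<le> l" using cut_le[OF l] by (auto simp: m_def)
      have "ireg s1 47 = int m" using r1 q by (simp add: m_def)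
      note rr = run_rest[OF R1 r1(2,3) this m ok(2) sl]
      show ?thesis
      proof (rule run_cons[OF rr])
        show "16 \<le> 50 * N" using N_ge_2 by simp
        fix s2 assume s2: "rel (map item_addr stk @ (if m < l then [addr 2 (i + m) (l - m)] else []) @ [addr 0 i m]) out s2"
        from ok(3)[unfolded q] show "?R s2"
        proof (cases rule: rep.cases)
          case (one T')
          show ?thesis unfolding j
            by (rule step[where new = "[(0, i, l)]" and newT = "[[T']]" and em = "[]"])
               (use s2 one m_def ok q in auto)
        next
          case (more m' T' Us)
          show ?thesis unfolding j
            by (rule step[where new = "[(2, i + m, l - m), (0, i, m)]" and newT = "[Us, [T']]" and em = "[]"])
               (use s2 more m_def ok q in auto)
        qed auto
      qed
    qed
    have node: "run S W node_prog s1 (50 * N) ?R" if q: "q < 2"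
    proof (rule run_cons[OF run_node_prefix[OF R1 r1 il, where t = "40 * N + 4"]])
      show "40 * N + 4 + 8 \<le> 50 * N" using N_ge_2 by simp
      fix s2 assume R2: "rel (map item_addr stk) out s2" and c2: "ireg s2 49 = int (C q i l div 2)"
        and b2: "ireg s2 48 = int (C q i l mod 2)" and r2: "ireg s2 45 = int i" "ireg s2 46 = int l"
          "ireg s2 44 = int q" "ireg s2 51 = base q i"
      from ok(3) show "run S W dispatch_prog s2 (40 * N + 4) ?R"
      proof (cases rule: rep.cases)
        case con
        have c: "ireg s2 49 = 0" "ireg s2 48 = int 0" using c2 b2 con by auto
        have "run S W con_prog s2 5 (rel (map item_addr stk) (out @ [0, int l]))"
          by (rule run_con[OF R2 r2(2)]) (use oS con in simp)
        then have "run S W (if (0::nat) = 0 then con_prog else strc_prog) s2 5 ?R"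
          unfolding if_P[OF refl]
        proof (rule run_cons)
          fix s3 assume "rel (map item_addr stk) (out @ [0, int l]) s3"
          then show "?R s3" unfolding j
            by (intro step[where new = "[]" and newT = "[]" and em = "[0, int l]"]) (use con in auto)
        qed simp
        from run_dispatch_leaf[OF R2 c this] show ?thesis
          by (rule run_cons) (use N_ge_2 in auto)
      next
        case (vec c m T')
        have c: "ireg s2 49 = int c" "ireg s2 48 = int 0" using c2 b2 vec by auto
        have cm: "c * m \<le> n" using ok(2) vec by simp
        have l46: "ireg s2 46 = int (c * m)" using r2 vec by simp
        have "1 * m < c * m" using vec by (intro mult_strict_right_mono) auto
        then have im: "i + m < n" using ok(2) vec(1) by linarith
        have mc: "i + m \<le> n" "m \<le> c * m" using im \<open>1 * m < c * m\<close> by linarith+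
        have "run S W dispatch_prog s2 (20 + 4) ?R"
        proof (rule run_dispatch_block[OF R2 c(1) _ c(2) l46 cm r2(1,3,4)])
          show "0 < c" using vec by simp
          fix s3 assume s3: "rel (map item_addr stk) out s3" "ireg s3 49 = int c" "ireg s3 50 = int m"
            "ireg s3 45 = int i" "ireg s3 44 = int q"
          have "run S W vec_prog s3 20 (rel (map item_addr stk @ [addr q i m]) (out @ [1, int c, D ! (i + m) - D ! i]))"
            by (rule run_vec[OF s3 im ok(1)]) (use oS vec sl in auto)
          then show "run S W (if (0::nat) = 0 then vec_prog else idx_prog) s3 20 ?R"
            unfolding if_P[OF refl]
          proof (rule run_cons)
            fix s4 assume "rel (map item_addr stk @ [addr q i m]) (out @ [1, int c, D ! (i + m) - D ! i]) s4"
            then show "?R s4" unfolding j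
              by (intro step[where new = "[(q, i, m)]" and newT = "[[T']]" and em = "[1, int c, D ! (i + m) - D ! i]"])
                 (use vec mc(1) ok q in auto)
          qed simp
        qed
        then show ?thesis by (rule run_cons) (use N_ge_2 in auto)
      next
        case (idx c m T')
        have "C q i l div 2 = c" "C q i l mod 2 = 1" using idx by auto
        then have c: "ireg s2 49 = int c" "ireg s2 48 = int 1" using c2 b2 by auto
        have cm: "c * m \<le> n" "i + c * m \<le> n" using ok(2) idx by auto
        have l46: "ireg s2 46 = int (c * m)" using r2 idx by simp
        have "1 * m \<le> c * m" using idx by (intro mult_le_mono1) simp
        then have mc: "i + m \<le> n" "m \<le> c * m" using cm by linarith+
        let ?xs = "map (\<lambda>k. D ! (i + k * m) - base q i) [0..<c]"
        have "run S W dispatch_prog s2 (20 * N + 4) ?R"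
        proof (rule run_dispatch_block[OF R2 c(1) _ c(2) l46 cm(1) r2(1,3,4)])
          show "0 < c" using idx by simp
          fix s3 assume s3: "rel (map item_addr stk) out s3" "ireg s3 49 = int c" "ireg s3 50 = int m"
            "ireg s3 45 = int i" "ireg s3 44 = int q" "ireg s3 51 = base q i"
          have "run S W idx_prog s3 (20 * N) (rel (map item_addr stk @ [addr 0 i m]) (out @ [2, int c] @ ?xs))"
            by (rule run_idx[OF s3(1-4,6) _ _ cm(2)]) (use oS idx sl in auto)
          then have "run S W idx_prog s3 (20 * N) ?R"
          proof (rule run_cons)
            fix s4 assume "rel (map item_addr stk @ [addr 0 i m]) (out @ [2, int c] @ ?xs) s4"
            then show "?R s4" unfolding j
              by (intro step[where new = "[(0, i, m)]" and newT = "[[T']]" and em = "[2, int c] @ ?xs"])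
                 (use idx cm ok q mc(1) in auto)
          qed simp
          then show "run S W (if (1::nat) = 0 then vec_prog else idx_prog) s3 (20 * N) ?R" by simp
        qed
        then show ?thesis by (rule run_cons) (use N_ge_2 in auto)
      next
        \<comment> \<open>The new item is charged one unit per piece, while a header of two words
          and one index per piece are emitted; the measure drops by two.\<close>
        case (strc Us)
        have c: "ireg s2 49 = 0" "ireg s2 48 = int 1" using c2 b2 strc by auto
        have lU: "length (starts i l) = length Us" using rep_sound[OF strc(5)] by simp
        let ?em = "[3, int (length (starts i l))] @ map (\<lambda>j. D ! j - base q i) (starts i l)"
        have "run S W strc_prog s2 (40 * N) (rel (map item_addr stk @ [addr 2 i l]) (out @ ?em))"
          by (rule run_strc[OF R2 r2(1,2,4) l ok(2)]) (use oS strc lU sl in auto)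
        then have "run S W strc_prog s2 (40 * N) ?R"
        proof (rule run_cons)
          fix s3 assume "rel (map item_addr stk @ [addr 2 i l]) (out @ ?em) s3"
          then show "?R s3" unfolding j
            by (intro step[where new = "[(2, i, l)]" and newT = "[Us]" and em = ?em])
               (use strc lU ok q in \<open>auto simp: enc_def\<close>)
        qed simp
        then have "run S W (if (1::nat) = 0 then con_prog else strc_prog) s2 (40 * N) ?R" by simp
        from run_dispatch_leaf[OF R2 c this] show ?thesis
          by (rule run_cons) auto
      qed (use q in auto)
    qed
    show "run S W (If (IEq 44 24) rest_prog node_prog) s1 (50 * N + 1) ?R"
    proof (rule run_If[where ?t0.0 = "50 * N"])
      note e1 = envD[OF relD(1)[OF R1]]
      show "run S W rest_prog s1 (50 * N) ?R" if "holds (IEq 44 24) s1" using that r1 e1 rest by simp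
      show "run S W node_prog s1 (50 * N) ?R" if "\<not> holds (IEq 44 24) s1"
        using that r1 e1 node ok(1) by (cases "q = 2") auto
    qed simp
  qed (use ok l N_ge_2 in auto)
qed

text \<open>Each round lowers the measure, which starts at the length of the output, at most
  \<open>Q * N\<close>. So there are linearly many rounds, and a round is linear at worst because of
  the indices it may write.\<close>

lemma run_rebuild:
  assumes "env s" "tables (\<lambda>_ _ _. True) s"
  shows "run S W rebuild_prog s ((61 * Q + 20) * N * N) (\<lambda>s'. \<exists>T. outputs S s' T \<and> optimal_tree K D T)"
proof -
  define q :: nat where "q = (if D ! 0 = 0 then 0 else 1)"
  have q: "q < 2" "q \<le> 2" by (auto simp: q_def)
  have "\<exists>T. rep q 0 n [T]"
    using rep_exists_0[OF n_pos, of 0] rep_exists_1[OF n_pos, of 0] by (cases "D ! 0 = 0") (simp_all add: q_def)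
  then obtain T where T: "rep q 0 n [T]" ..
  have opt: "optimal_tree K D T" by (rule rep_optimal[OF T q_def])
  have lenT: "length (encode T) \<le> Q * N" using rep_encode_bound[OF T q(1)] by (simp add: N_def)
  note e = envD[OF assms(1)]
  let ?R = "\<lambda>s'. \<exists>T. outputs S s' T \<and> optimal_tree K D T"
  have aW: "int n * int N \<le> int W" "int n * int N + int q * int NN \<le> int W" "0 \<le> int n * int N"
    using addr_W[OF n_less_N _ q(2), of 0] n_less_N by auto
  have "3 * NN + N + N \<le> W" "3 * NN \<le> W" using S_bounds W_S by linarith+
  then have sW: "3 * int NN + int N \<le> int W" "3 * int NN \<le> int W" by linarith+
  show ?thesis
    unfolding rebuild_prog_def
  proof (rule run_seq[where ?t1.0 = 7 and ?t2.0 = "12 + (Q * N) * (60 * N + 1)"])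
    let ?A = "{10, 41, 54, 42, 40, 43}"
    let ?c = "[ILoad 10 23, IAdd 41 36 37, IAdd 54 41 20, IAdd 42 54 23, IAdd 40 41 23, IMul 43 0 20]"
    show "run S W (block ?c) s 7 (\<lambda>s'. rel [] [] s' \<and> ireg s' 10 = D ! 0 \<and> ireg s' 43 = int (addr 0 0 n))"
    proof (rule run_block)
      have "vc S W ?c (\<lambda>s'. frame ?A {} s s' \<and> ireg s' 10 = D ! 0 \<and> ireg s' 43 = int (addr 0 0 n) \<and>
        ireg s' 41 = int SB \<and> ireg s' 54 = int OB \<and> ireg s' 42 = int OB \<and> ireg s' 40 = int SB) s"
        using e n_pos N_W aW sW by (simp add: frame_def addr_def SB_def OB_def)
      then show "vc S W ?c (\<lambda>s'. rel [] [] s' \<and> ireg s' 10 = D ! 0 \<and> ireg s' 43 = int (addr 0 0 n)) s"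
      proof (rule vc_mono)
        fix s' assume a: "frame ?A {} s s' \<and> ireg s' 10 = D ! 0 \<and> ireg s' 43 = int (addr 0 0 n) \<and>
          ireg s' 41 = int SB \<and> ireg s' 54 = int OB \<and> ireg s' 42 = int OB \<and> ireg s' 40 = int SB"
        then have f: "frame ?A {} s s'" by simp
        have "env s'" by (rule env_frame[OF assms(1) f]) auto
        then show "rel [] [] s' \<and> ireg s' 10 = D ! 0 \<and> ireg s' 43 = int (addr 0 0 n)"
          using a tables_frame[OF assms(2) f] by (simp add: rel_def)
      qed
    qed simp
    fix s1 assume s1: "rel [] [] s1 \<and> ireg s1 10 = D ! 0 \<and> ireg s1 43 = int (addr 0 0 n)"
    then have R1: "rel [] [] s1" by simp
    note e1 = envD[OF relD(1)[OF R1]]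
    show "run S W (Seq (If (IEq 10 23) Skip (block [IAdd 43 43 36]))
      (Seq (block (push 43)) (Seq (While (ILess 41 40) item_prog) (block [IAdd 0 54 23])))) s1
      (12 + (Q * N) * (60 * N + 1)) ?R"
    proof (rule run_seq[where ?t1.0 = 3 and ?t2.0 = "9 + (Q * N) * (60 * N + 1)"])
      show "run S W (If (IEq 10 23) Skip (block [IAdd 43 43 36])) s1 3 (\<lambda>s'. frame {43} {} s1 s' \<and> ireg s' 43 = int (addr q 0 n))"
        by (intro run_If[where ?t0.0 = 2] run_block run_Skip;
            use s1 e1 aW in \<open>simp add: q_def frame_def addr_def\<close>)
      fix s2 assume s2: "frame {43} {} s1 s2 \<and> ireg s2 43 = int (addr q 0 n)"
      then have R2: "rel [] [] s2" using rel_frame[OF R1, of "{43}" "{}" s2] by simp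
      show "run S W (Seq (block (push 43)) (Seq (While (ILess 41 40) item_prog) (block [IAdd 0 54 23]))) s2
        (9 + (Q * N) * (60 * N + 1)) ?R"
      proof (rule run_seq[where ?t1.0 = 3 and ?t2.0 = "5 + (Q * N) * (60 * N + 1)"])
        show "run S W (block (push 43)) s2 3 (work T (length (encode T)))"
        proof (rule run_block)
          have "vc S W (push 43 @ []) (work T (length (encode T))) s2"
          proof (rule vc_push[OF R2 _ _ conjunct2[OF s2]])
            fix s3 assume "rel ([] @ [addr q 0 n]) [] s3"
            then have "work T (length (encode T)) s3"
              unfolding work_def using T q
              by (intro exI[of _ "[(q, 0, n)]"] exI[of _ "[[T]]"] exI[of _ "[]"]) auto
            then show "vc S W [] (work T (length (encode T))) s3" by simp
          qed (use N_ge_2 in auto)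
          then show "vc S W (push 43) (work T (length (encode T))) s2" by simp
        qed (simp add: push_def)
        fix s3 assume s3: "work T (length (encode T)) s3"
        show "run S W (Seq (While (ILess 41 40) item_prog) (block [IAdd 0 54 23])) s3 (5 + (Q * N) * (60 * N + 1)) ?R"
        proof (rule run_seq[OF run_While[where I = "work T", OF s3]])
          show "run S W item_prog s (60 * N) (\<lambda>s'. \<exists>j'<j. work T j' s')"
            if "work T j s" "holds (ILess 41 40) s" for j s
            using run_item that lenT by blast
          show "length (encode T) * (60 * N + 1) + 1 \<le> (Q * N) * (60 * N + 1) + 1"
            using lenT by (intro add_le_mono1 mult_le_mono1)
          fix s4 assume s4: "(\<exists>j. work T j s4) \<and> \<not> holds (ILess 41 40) s4"
          then obtain stk Tss out where w: "rel (map item_addr stk) out s4" "list_all2 pending stk Tss"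
            "encode T = out @ enc (concat (rev Tss))" unfolding work_def by blast
          have "stk = []" using s4 relD(3,5)[OF w(1)] by auto
          then have out: "out = encode T" "rel [] out s4" using w by auto
          have OBW: "int OB \<le> int W" using SB_OB W_S by linarith
          have OBS: "OB + length (encode T) \<le> S" using lenT SB_OB by linarith
          have "outputs S (effect (IAdd 0 54 23) s4) T"
            unfolding outputs_def
            using out OBS envD(4)[OF relD(1)[OF out(2)]]
            by (intro exI[of _ OB]) (simp add: rel_def)
          then show "run S W (block [IAdd 0 54 23]) s4 2 ?R"
            using opt OBW relD(4)[OF out(2)] envD(4)[OF relD(1)[OF out(2)]]
            by (intro run_block) auto
        qed simp
      qed simp
    qed simp
  next
    have "(Q * N) * (60 * N + 1) = 60 * (Q * N * N) + Q * N" "(61 * Q + 20) * N * N = 61 * (Q * N * N) + 20 * (N * N)"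
      by (simp_all add: algebra_simps)
    moreover have "Q * N * 1 \<le> Q * N * N" using N_ge_2 by (intro mult_le_mono2) simp
    ultimately show "7 + (12 + (Q * N) * (60 * N + 1)) \<le> (61 * Q + 20) * N * N"
      using N_sq(2) unfolding mult_1_right by linarith
  qed
qed

end

section \<open>The complete algorithm\<close>

primrec write_code :: "nat \<Rightarrow> int list \<Rightarrow> instr list" where
  "write_code a [] = []"
| "write_code a (x # xs) = [IConst 10 (int a), IConst 11 x, IStore 10 11] @ write_code (Suc a) xs"

section \<open>The empty sequence\<close>

lemma cost_ge_leaf:
  assumes "basic_tree T" "Kcon K > 0" "Kvec K > 0" "Kidx K > 0" "Kstrc K > 0" "Klookup K > 0"
  shows "Kcon K \<le> cost K T \<or> Kstrc K \<le> cost K T"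
  using assms(1)
proof (induction T)
  case (Idx c xs T)
  have "0 \<le> real c * Klookup K" using assms by simp
  then have "cost K T \<le> cost K (Idx c xs T)" unfolding cost.simps using assms by linarith
  moreover have "Kcon K \<le> cost K T \<or> Kstrc K \<le> cost K T" using Idx by simp
  ultimately show ?case by linarith
next
  case (Strc c xs Cs)
  interpret reconstruction K "[]" by unfold_locales (fact assms)+
  have "0 \<le> real c * Klookup K" using assms by simp
  moreover have "0 \<le> sum_list (map (cost K) Cs)" by (intro sum_list_nonneg) (auto simp: cost_nonneg)
  ultimately show ?case by simp
qed (use assms in auto)

text \<open>A leaf is never empty, so the root is an inner node. Count 0 suffices, and below
  \<open>Vec\<close> and \<open>Idx\<close> the leaf \<open>Con 1\<close> is the candidate for a
  cheapest child.\<close>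

definition empty_trees :: "btree set" where
  "empty_trees = {Strc 0 [] [], Vec 0 0 (Con 1), Idx 0 [] (Con 1)}"

lemma empty_optimal:
  assumes "Kcon K > 0" "Kvec K > 0" "Kidx K > 0" "Kstrc K > 0" "Klookup K > 0"
  obtains T where "T \<in> empty_trees" "optimal_tree K [] T"
proof -
  define T where "T = arg_min_on (cost K) empty_trees"
  have "finite empty_trees" "empty_trees \<noteq> {}" by (simp_all add: empty_trees_def)
  from arg_min_if_finite[OF this, of "cost K"]
  have T: "T \<in> empty_trees" "\<And>T'. T' \<in> empty_trees \<Longrightarrow> cost K T \<le> cost K T'"
    unfolding T_def by (auto simp: not_less)
  have le: "cost K T \<le> Kstrc K" "cost K T \<le> Kvec K + Kcon K" "cost K T \<le> Kidx K + Kcon K"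
    using T(2)[of "Strc 0 [] []"] T(2)[of "Vec 0 0 (Con 1)"] T(2)[of "Idx 0 [] (Con 1)"]
    by (auto simp: empty_trees_def)
  have "cost K T \<le> cost K T'" if "represents T' []" for T'
  proof (cases T')
    case (Con c)
    then show ?thesis using that by (simp add: represents_def)
  next
    case (Vec c d C)
    \<comment> \<open>A child costs at least as much as a leaf or as the empty \<open>Strc\<close>;
      in the latter case the empty \<open>Strc\<close> alone is cheaper.\<close>
    then show ?thesis using cost_ge_leaf[OF _ assms, of C] that le assms by (auto simp: represents_def)
  next
    case (Idx c xs C)
    have "0 \<le> real c * Klookup K" using assms by simp
    moreover have "Kcon K \<le> cost K C \<or> Kstrc K \<le> cost K C"
      using cost_ge_leaf[OF _ assms, of C] that Idx by (simp add: represents_def)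
    ultimately show ?thesis unfolding Idx cost.simps using le assms by linarith
  next
    case (Strc c xs Cs)
    interpret reconstruction K "[]" by unfold_locales (fact assms)+
    have "0 \<le> real c * Klookup K" using assms by simp
    moreover have "0 \<le> sum_list (map (cost K) Cs)" by (intro sum_list_nonneg) (auto simp: cost_nonneg)
    ultimately show ?thesis using le Strc by simp
  qed
  moreover have "represents T []" using T(1) by (auto simp: empty_trees_def represents_def)
  ultimately show ?thesis using that T(1) by (auto simp: optimal_tree_def)
qed

text \<open>The tables begin at length 1, so the empty input gets a tree fixed in advance. This tree
  is the only part of the program that depends on the constants.\<close>

definition rebuild_all :: "btree \<Rightarrow> prog" where
  "rebuild_all T = If (ILess 23 0) (Seq fill_prog rebuild_prog) (block (write_code 0 (encode T)))"

text \<open>The longest of the three encodings, that of \<open>Vec 0 0 (Con 1)\<close>, has five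
  words, and each takes three instructions.\<close>

lemma run_empty:
  assumes "T \<in> empty_trees" "optimal_tree K [] T" "5 \<le> S" "5 \<le> W"
  shows "run S W (rebuild_all T) (init_state K []) 20 (\<lambda>s. \<exists>T. outputs S s T \<and> optimal_tree K [] T)"
  unfolding rebuild_all_def
proof (rule run_If[where ?t0.0 = 19])
  have "vc S W (write_code 0 (encode T)) (\<lambda>s. outputs S s T) (init_state K [])"
    using assms(1,3,4) unfolding outputs_def empty_trees_def
    by (auto simp: init_state_def less_Suc_eq)
  then have "vc S W (write_code 0 (encode T)) (\<lambda>s. \<exists>T. outputs S s T \<and> optimal_tree K [] T) (init_state K [])"
    by (rule vc_mono) (use assms(2) in auto)
  then show "run S W (block (write_code 0 (encode T))) (init_state K []) 19 (\<lambda>s. \<exists>T. outputs S s T \<and> optimal_tree K [] T)"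
    by (rule run_block) (use assms(1) in \<open>auto simp: empty_trees_def\<close>)
qed (simp_all add: init_state_def)

lemma (in ram) run_rebuild_all:
  "run S W (rebuild_all T) (init_state K D) ((61 * Q + 450) * (length D + 1) ^ 4)
     (\<lambda>s. \<exists>T. outputs S s T \<and> optimal_tree K D T)"
  unfolding rebuild_all_def
proof (rule run_If)
  let ?s = "init_state K D"
  have i: "ireg ?s 0 = int n" "ireg ?s 23 = 0"
    "creg ?s 0 = Kcon K" "creg ?s (Suc 0) = Kvec K" "creg ?s 2 = Kidx K" "creg ?s 3 = Kstrc K"
    "creg ?s 4 = Kl" "creg ?s 5 = 0" "\<And>j. j < n \<Longrightarrow> imem ?s j = D ! j"
    by (simp_all add: init_state_def)
  show "run S W (Seq fill_prog rebuild_prog) ?s (420 * N * N * N * N + (61 * Q + 20) * N * N)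
     (\<lambda>s. \<exists>T. outputs S s T \<and> optimal_tree K D T)"
  proof (rule run_seq[OF run_fill[OF i]])
    fix s' assume "env s' \<and> tables (\<lambda>_ _ _. True) s'"
    then show "run S W rebuild_prog s' ((61 * Q + 20) * N * N) (\<lambda>s. \<exists>T. outputs S s T \<and> optimal_tree K D T)"
      using run_rebuild by blast
  qed simp_all
  show "run S W (block (write_code 0 (encode T))) ?s (420 * N * N * N * N + (61 * Q + 20) * N * N)
     (\<lambda>s. \<exists>T. outputs S s T \<and> optimal_tree K D T)" if "\<not> holds (ILess 23 0) ?s"
    using that i n_pos by simp
  have "N * N * 1 \<le> N * N * (N * N)" using N_ge_2 by (intro mult_le_mono2) simp
  then have "(61 * Q + 20) * (N * N) \<le> (61 * Q + 20) * (N * N * (N * N))" by (intro mult_le_mono2) simp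
  moreover have "1 \<le> N * N * (N * N)" using N_ge_2 by simp
  moreover have "(61 * Q + 450) * (length D + 1) ^ 4 =
      430 * (N * N * (N * N)) + (61 * Q + 20) * (N * N * (N * N))"
    unfolding N_def[symmetric] by (simp add: power4_eq_xxxx algebra_simps)
  moreover have "420 * N * N * N * N = 420 * (N * N * (N * N))" "(61 * Q + 20) * N * N = (61 * Q + 20) * (N * N)"
    by (simp_all add: mult.assoc)
  ultimately show "1 + (420 * N * N * N * N + (61 * Q + 20) * N * N) \<le> (61 * Q + 450) * (length D + 1) ^ 4"
    by linarith
qed

section \<open>Word size, asymptotics and the final bounds\<close>

lemma abs_le_magnitude: "x \<in> set D \<Longrightarrow> \<bar>x\<bar> \<le> int (magnitude D)"
proof -
  assume "x \<in> set D"
  then have "\<bar>x\<bar> \<le> Max (insert 0 (abs ` set D))" by (intro Max_ge) auto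
  then show ?thesis by (simp add: magnitude_def)
qed

lemma bigo_shifted_power: "(\<lambda>n. real (a * (n + 1) ^ k)) \<in> O(\<lambda>n. real n ^ k)"
\<comment> \<open>For \<open>n \<ge> 1\<close>, \<open>n + 1 \<le> 2 * n\<close> gives the factor
  \<open>2 ^ k\<close>.\<close>
proof (rule bigoI[where c = "real a * 2 ^ k"])
  show "eventually (\<lambda>n. norm (real (a * (n + 1) ^ k)) \<le> real a * 2 ^ k * norm (real n ^ k)) at_top"
    using eventually_ge_at_top[of 1]
  proof eventually_elim
    case (elim n)
    have "(real n + 1) ^ k \<le> (2 * real n) ^ k" using elim by (intro power_mono) auto
    then have "real a * (real n + 1) ^ k \<le> real a * (2 * real n) ^ k" by (intro mult_left_mono) auto
    then show ?case by (simp add: power_mult_distrib algebra_simps)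
  qed
qed

theorem theorem1:
  fixes K :: cost_consts
  assumes "Kcon K > 0" and "Kvec K > 0" and "Kidx K > 0" and "Kstrc K > 0" and "Klookup K > 0"
  shows "\<exists>P time space.
    (\<lambda>n. real (time n)) \<in> O(\<lambda>n. real n ^ 4) \<and>
    (\<lambda>n. real (space n)) \<in> O(\<lambda>n. real n ^ 2) \<and>
    solves_reconstruction K P time space"
proof -
  interpret R: reconstruction K "[]" by unfold_locales (fact assms)+
  obtain T0 where T0: "T0 \<in> empty_trees" "optimal_tree K [] T0" using empty_optimal[OF assms] .
  \<comment> \<open>\<open>Q\<close> and \<open>Ksum\<close> are functions of the cost constants, so
    these values serve every \<open>D\<close>.\<close>
  define q where "q = reconstruction.Q K"
  define k where "k = reconstruction.Ksum K"
  have k: "0 < k" using R.Ksum_pos by (simp add: k_def)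
  define time :: "nat \<Rightarrow> nat" where "time n = (61 * q + 450) * (n + 1) ^ 4" for n
  \<comment> \<open>\<open>13 = 3 + 2 + 8\<close>: in the requirement
    \<open>(3 * N + 2 + q) * N + 8\<close> every term is raised to a multiple of
    \<open>N * N\<close>.\<close>
  define space :: "nat \<Rightarrow> nat" where "space n = (13 + q) * (n + 1) ^ 2" for n
  \<comment> \<open>The exponent has to absorb all constant factors: as the magnitude
    \<open>M\<close> is at least 2, \<open>z \<le> 2 ^ z \<le> M ^ z\<close>, and a further
    \<open>M ^ 2\<close> pays for the quadratic quantities.\<close>
  define z where "z = 13 + q + nat \<lceil>10 * k\<rceil>"
  have "10 * k \<le> real (nat \<lceil>10 * k\<rceil>)" by (rule real_nat_ceiling_ge)
  then have kz: "10 * k \<le> real z" by (simp add: z_def)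
  have sol: "\<exists>t s T. exec (space (length D)) (magnitude D ^ (z + 2)) (rebuild_all T0) (init_state K D) t s \<and>
        t \<le> time (length D) \<and> outputs (space (length D)) s T \<and> optimal_tree K D T" for D
  proof -
    define M where "M = magnitude D"
    define W where "W = M ^ (z + 2)"
    define N where "N = length D + 1"
    have M: "2 \<le> M" "N \<le> M" "1 \<le> M" by (auto simp: M_def magnitude_def N_def)
    have "z * M ^ 2 \<le> 2 ^ z * M ^ 2" by (intro mult_le_mono1) simp
    also have "\<dots> \<le> M ^ z * M ^ 2" using M by (intro mult_le_mono1 power_mono) auto
    finally have zW: "z * M ^ 2 \<le> W" by (simp only: W_def power_add)
    have NM: "N ^ 2 \<le> M ^ 2" "N * M \<le> M ^ 2" "M \<le> M ^ 2"
      using M by (auto simp: power2_eq_square intro: mult_le_mono)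
    have SW: "space (length D) \<le> W"
    proof -
      have "space (length D) \<le> z * M ^ 2"
        unfolding space_def N_def[symmetric] z_def using NM by (intro mult_le_mono) auto
      then show ?thesis using zW by simp
    qed
    have kW: "10 * real N * k \<le> real W"
    proof -
      have "10 * real N * k = (10 * k) * real N" by simp
      also have "\<dots> \<le> real z * real (M ^ 2)" using kz k M NM by (intro mult_mono) (auto simp: )
      also have "\<dots> \<le> real W" using zW of_nat_le_iff of_nat_mult by metis
      finally show ?thesis .
    qed
    have fits: "fits W (init_state K D)"
    proof -
      have MW: "M \<le> W" using zW NM(3) le_trans[of M "1 * M ^ 2" "z * M ^ 2"] mult_le_mono1[of 1 z "M ^ 2"]
        by (simp add: z_def)
      have "length D \<le> M" using M by (simp add: N_def)
      then have 1: "int (length D) \<le> int W" using MW by linarith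
      have 2: "\<bar>D ! j\<bar> \<le> int W" if "j < length D" for j
        using abs_le_magnitude[of "D ! j" D] that MW by (simp add: M_def)
      have "k \<le> 10 * real N * k" using k by (simp add: N_def algebra_simps)
      then have "k \<le> real W" using kW by simp
      then have "Kcon K \<le> W" "Kvec K \<le> W" "Kidx K \<le> W" "Kstrc K \<le> W" "Klookup K \<le> W"
        using assms by (auto simp: k_def R.Ksum_def)
      then show ?thesis using assms 1 2 by (auto simp: fits_def init_state_def)
    qed
    have "run (space (length D)) W (rebuild_all T0) (init_state K D) (time (length D))
      (\<lambda>s. \<exists>T. outputs (space (length D)) s T \<and> optimal_tree K D T)"
    proof (cases "D = []")
      case True
      have "5 \<le> space 0" by (simp add: space_def)
      then show ?thesis using True SW T0
        by (intro run_cons[OF run_empty[THEN subst[OF True[symmetric], of "\<lambda>D. run _ _ _ (init_state K D) _ (\<lambda>s. \<exists>T. outputs _ s T \<and> optimal_tree K D T)"]]])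
           (auto simp: time_def)
    next
      case False
      have "1 \<le> N" by (simp add: N_def)
      then have "1 * N \<le> N * N" "1 * 1 \<le> N * N" by (intro mult_le_mono; simp)+
      moreover from this have "q * (1 * N) \<le> q * (N * N)" by (intro mult_le_mono2)
      moreover have "(3 * N + 2 + q) * N = 3 * (N * N) + 2 * N + q * N"
        "space (length D) = 13 * (N * N) + q * (N * N)"
        by (simp_all add: space_def N_def power2_eq_square algebra_simps)
      ultimately have space: "(3 * N + 2 + q) * N + 8 \<le> space (length D)"
        unfolding mult_1 by linarith
      interpret ram K D "space (length D)" W M
      proof
        show "(3 * (length D + 1) + 2 + R.Q) * (length D + 1) + 8 \<le> space (length D)"
          using space by (simp only: N_def q_def)
        have "4 * (N * M) \<le> z * M ^ 2" using NM by (intro mult_le_mono) (auto simp: z_def)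
        then show "4 * (length D + 1) * M \<le> W" using zW unfolding N_def mult.assoc by linarith
        show "10 * real (length D + 1) * R.Ksum \<le> real W" using kW by (simp add: N_def k_def)
      qed (use False SW abs_le_magnitude in \<open>auto simp: M_def\<close>)
      show ?thesis using run_rebuild_all by (simp add: time_def q_def)
    qed
    then show ?thesis using fits unfolding run_def W_def M_def by blast
  qed
  have "(\<lambda>n. real (time n)) \<in> O(\<lambda>n. real n ^ 4)" "(\<lambda>n. real (space n)) \<in> O(\<lambda>n. real n ^ 2)"
    unfolding time_def space_def by (rule bigo_shifted_power)+
  moreover have "solves_reconstruction K (rebuild_all T0) time space"
    unfolding solves_reconstruction_def using sol by blast
  ultimately show ?thesis by blast
qed

end
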